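(* Let $p_1,p_2,p_3\in(1,\infty)$ satisfy $\frac1{p_1}+\frac1{p_2}+\frac1{p_3}\le 1$. Then the Banach space $\ell_{p_1}\widehat{\otimes}\ell_{p_2}\widehat{\otimes}\ell_{p_3}$ does not have finite cotype. Moreover, there exist universal constants $c,c'\in(0,\infty)$ such that for every $p_1,p_2,p_3\in(1,\infty)$ satisfying $\frac1{p_1}+\frac1{p_2}+\frac1{p_3}\le 1$, every $q\in[2,\infty)$ and every integer $n>15$, $$C_q\left(\ell_{p_1}^{n}\widehat{\otimes}\ell_{p_2}^{n}\widehat{\otimes}\ell_{p_3}^{n}\right)\ge \frac{c'}{\log n}\cdot\exp\left(\frac{c}{q}\cdot\frac{(\log\log n)^2}{\log\log\log n}\right).$$
   Context: All Banach spaces are over $\mathbb{R}$ and $\log$ is the natural logarithm. $\ell_p^n$ is $\mathbb{R}^n$ with the $\ell_p$ norm. Projective tensor product: for Banach spaces $X,Y$, $X\widehat{\otimes}Y$ is the completion of the algebraic tensor product $X\otimes Y$ under the norm $\|z\|_{X\widehat{\otimes}Y}=\inf\{\sum_{i=1}^N\|x_i\|_X\|y_i\|_Y:\ N\in\mathbb{N},\ x_i\in X,\ y_i\in Y,\ z=\sum_{i=1}^N x_i\otimes y_i\}$. Threefold products are obtained by iterating this (associative) operation. Cotype: for $q\in[2,\infty)$, a Banach space $X$ has cotype $q$ if there is $C\in(0,\infty)$ such that for every $N\in\mathbb{N}$ and all $x_1,\dots,x_N\in X$, $$\left(\sum_{i=1}^N\|x_i\|_X^q\right)^{1/q}\le C\left(\mathbb{E}\left[\left\|\sum_{i=1}^N\varepsilon_ix_i\right\|_X^2\right]\right)^{1/2},$$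 with $\varepsilon=(\varepsilon_1,\dots,\varepsilon_N)$ uniform on $\{-1,1\}^N$. The infimum of such $C$ is denoted $C_q(X)$. $X$ has finite cotype if it has cotype $q$ for some $q\in[2,\infty)$. *)

theory Defs
  imports "HOL-Probability.Probability_Mass_Function"
begin

section \<open>Normed spaces with explicit carrier and operations\<close>

text \<open>The spaces in question depend on real parameters and the completion is a quotient depending
  on the norm, so they cannot be instances of the type class \<^class>\<open>banach\<close>.\<close>

record 'a nspace =
  pts :: "'a set"
  vzero :: 'a
  vadd :: "'a \<Rightarrow> 'a \<Rightarrow> 'a"
  vscale :: "real \<Rightarrow> 'a \<Rightarrow> 'a"
  vnorm :: "'a \<Rightarrow> real"

definition vdiff :: "'a nspace \<Rightarrow> 'a \<Rightarrow> 'a \<Rightarrow> 'a" where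
  "vdiff X x y = vadd X x (vscale X (-1) y)"

primrec vsum :: "'a nspace \<Rightarrow> (nat \<Rightarrow> 'a) \<Rightarrow> nat \<Rightarrow> 'a" where
  "vsum X x 0 = vzero X"
| "vsum X x (Suc N) = vadd X (vsum X x N) (x N)"


section \<open>The spaces $\ell_p$ and $\ell_p^n$\<close>

definition lp :: "real \<Rightarrow> (nat \<Rightarrow> real) nspace" where
  "lp p = \<lparr> pts = {x. summable (\<lambda>k. \<bar>x k\<bar> powr p)},
            vzero = (\<lambda>k. 0),
            vadd = (\<lambda>x y k. x k + y k),
            vscale = (\<lambda>r x k. r * x k),
            vnorm = (\<lambda>x. (\<Sum>k. \<bar>x k\<bar> powr p) powr (1 / p)) \<rparr>"

text \<open>Vectors of $\mathbb{R}^n$ are functions on the natural numbers vanishing from \<open>n\<close> on.\<close>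

definition lp_fin :: "real \<Rightarrow> nat \<Rightarrow> (nat \<Rightarrow> real) nspace" where
  "lp_fin p n = \<lparr> pts = {x. \<forall>k\<ge>n. x k = 0},
            vzero = (\<lambda>k. 0),
            vadd = (\<lambda>x y k. x k + y k),
            vscale = (\<lambda>r x k. r * x k),
            vnorm = (\<lambda>x. (\<Sum>k<n. \<bar>x k\<bar> powr p) powr (1 / p)) \<rparr>"


section \<open>Completion\<close>

definition cauchy_seqs :: "'a nspace \<Rightarrow> (nat \<Rightarrow> 'a) set" where
  "cauchy_seqs X = {s. (\<forall>n. s n \<in> pts X) \<and>
     (\<forall>e>0. \<exists>M. \<forall>m\<ge>M. \<forall>n\<ge>M. vnorm X (vdiff X (s m) (s n)) < e)}"

definition cauchy_eq :: "'a nspace \<Rightarrow> ((nat \<Rightarrow> 'a) \<times> (nat \<Rightarrow> 'a)) set" where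
  "cauchy_eq X = {(s, t). s \<in> cauchy_seqs X \<and> t \<in> cauchy_seqs X \<and>
     (\<lambda>n. vnorm X (vdiff X (s n) (t n))) \<longlonglongrightarrow> 0}"

text \<open>Cauchy sequences modulo null sequences, with termwise operations on representatives.\<close>

definition nspace_completion :: "'a nspace \<Rightarrow> (nat \<Rightarrow> 'a) set nspace" where
  "nspace_completion X = \<lparr> pts = cauchy_seqs X // cauchy_eq X,
     vzero = cauchy_eq X `` {\<lambda>n. vzero X},
     vadd = (\<lambda>A B. \<Union>s\<in>A. \<Union>t\<in>B. cauchy_eq X `` {\<lambda>n. vadd X (s n) (t n)}),
     vscale = (\<lambda>r A. \<Union>s\<in>A. cauchy_eq X `` {\<lambda>n. vscale X r (s n)}),
     vnorm = (\<lambda>A. THE l. \<forall>s\<in>A. (\<lambda>n. vnorm X (s n)) \<longlonglongrightarrow> l) \<rparr>"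


section \<open>Projective tensor product\<close>

definition bilinear_form :: "'a nspace \<Rightarrow> 'b nspace \<Rightarrow> ('a \<Rightarrow> 'b \<Rightarrow> real) \<Rightarrow> bool" where
  "bilinear_form X Y B \<longleftrightarrow>
     (\<forall>x\<in>pts X. \<forall>x'\<in>pts X. \<forall>y\<in>pts Y. B (vadd X x x') y = B x y + B x' y) \<and>
     (\<forall>x\<in>pts X. \<forall>y\<in>pts Y. \<forall>y'\<in>pts Y. B x (vadd Y y y') = B x y + B x y') \<and>
     (\<forall>r. \<forall>x\<in>pts X. \<forall>y\<in>pts Y. B (vscale X r x) y = r * B x y) \<and>
     (\<forall>r. \<forall>x\<in>pts X. \<forall>y\<in>pts Y. B x (vscale Y r y) = r * B x y)"

text \<open>The algebraic tensor product is realised in the standard way inside the space of linear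
  functionals on all (not necessarily bounded) bilinear forms, the elementary tensor of \<open>x\<close> and \<open>y\<close>
  being evaluation at \<open>(x, y)\<close>.  Bilinear forms separate the elements of the abstract tensor product,
  so this is a faithful copy of it.  The value \<open>0\<close> off the bilinear forms is a dummy.\<close>

type_synonym ('a, 'b) tens = "('a \<Rightarrow> 'b \<Rightarrow> real) \<Rightarrow> real"

definition elem_tensor :: "'a nspace \<Rightarrow> 'b nspace \<Rightarrow> 'a \<Rightarrow> 'b \<Rightarrow> ('a, 'b) tens" where
  "elem_tensor X Y x y = (\<lambda>B. if bilinear_form X Y B then B x y else 0)"

definition tensor_rep ::
  "'a nspace \<Rightarrow> 'b nspace \<Rightarrow> ('a, 'b) tens \<Rightarrow> nat \<Rightarrow> (nat \<Rightarrow> 'a) \<Rightarrow> (nat \<Rightarrow> 'b) \<Rightarrow> bool" where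
  "tensor_rep X Y z N x y \<longleftrightarrow>
     (\<forall>i<N. x i \<in> pts X \<and> y i \<in> pts Y) \<and>
     z = (\<lambda>B. \<Sum>i<N. elem_tensor X Y (x i) (y i) B)"

definition alg_tensor :: "'a nspace \<Rightarrow> 'b nspace \<Rightarrow> ('a, 'b) tens nspace" where
  "alg_tensor X Y = \<lparr> pts = {z. \<exists>N x y. tensor_rep X Y z N x y},
     vzero = (\<lambda>B. 0),
     vadd = (\<lambda>z w B. z B + w B),
     vscale = (\<lambda>r z B. r * z B),
     vnorm = (\<lambda>z. Inf {\<Sum>i<N. vnorm X (x i) * vnorm Y (y i) | N x y. tensor_rep X Y z N x y}) \<rparr>"

definition proj_tensor ::
  "'a nspace \<Rightarrow> 'b nspace \<Rightarrow> (nat \<Rightarrow> ('a, 'b) tens) set nspace"  (infixl "\<otimes>\<^sub>\<pi>" 70) where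
  "X \<otimes>\<^sub>\<pi> Y = nspace_completion (alg_tensor X Y)"


section \<open>Cotype\<close>

definition cotype_ineq :: "real \<Rightarrow> 'a nspace \<Rightarrow> real \<Rightarrow> bool" where
  "cotype_ineq q X C \<longleftrightarrow>
     (\<forall>N. \<forall>x::nat \<Rightarrow> 'a. (\<forall>i<N. x i \<in> pts X) \<longrightarrow>
        (\<Sum>i<N. vnorm X (x i) powr q) powr (1 / q) \<le>
        C * sqrt (measure_pmf.expectation (pmf_of_set ({..<N} \<rightarrow>\<^sub>E {-1, 1}))
                    (\<lambda>\<epsilon>. (vnorm X (vsum X (\<lambda>i. vscale X (\<epsilon> i) (x i)) N))\<^sup>2)))"

definition has_cotype :: "real \<Rightarrow> 'a nspace \<Rightarrow> bool" where
  "has_cotype q X \<longleftrightarrow> (\<exists>C>0. cotype_ineq q X C)"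

definition has_finite_cotype :: "'a nspace \<Rightarrow> bool" where
  "has_finite_cotype X \<longleftrightarrow> (\<exists>q\<ge>2. has_cotype q X)"

text \<open>Extended real valued, so that the constant is \<open>\<infinity>\<close> when \<open>X\<close> does not have cotype \<open>q\<close>.\<close>

definition cotype_const :: "real \<Rightarrow> 'a nspace \<Rightarrow> ereal" where
  "cotype_const q X = Inf (ereal ` {C. C > 0 \<and> cotype_ineq q X C})"

end

theory Submission
  imports Defs "HOL-Real_Asymp.Real_Asymp"
begin

text \<open>Let \<open>S a\<close> be the exponent vectors of a 3-query locally decodable code of length \<open>N\<close> over
  $\mathbb{F}_{67}$ with \<open>k\<close> message symbols, where $N = 2^{2^{O(\sqrt{\log k \log\log k})}}$ by way of
  matching vectors modulo $33$.  For a message \<open>z\<close> the array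
  $\sin(\frac{2\pi}{67}\langle z, S_a + S_b + S_c\rangle)$ is a sum of four products of bounded vectors,
  so its projective norm is $O(N^{1/p_1 + 1/p_2 + 1/p_3})$.  Its first-order part in \<open>z\<close> is a signed sum of
  arrays $t_1, \dots, t_k$; the decoding triples of the \<open>i\<close>-th symbol form a matching, i.e. a trilinear
  form which is bounded by Hoelder's inequality and shows that $t_i$ has projective norm of the same order
  $N^{1/p_1 + 1/p_2 + 1/p_3}$.  Extracting the first-order part costs only a factor polynomial in $\log N$:
  use the noise operator at finitely many parameters and the derivative at $0$ of a polynomial of
  degree $O(\log N)$ (the argument behind Pisier's bound on the K-convexity constant).  Hence
  the cotype constant is at least $k^{1/q}$ up to powers of $\log N$, and these powers are absorbed by
  interpolating with the trivial bound 1.\<close>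

section \<open>Completion and the projective norm\<close>

text \<open>On a decoding triple of symbol i the phase is 2 pi z_i / 67, but elsewhere it is a
  character of z of uncontrolled degree. So each single message yields an array of small norm that
  depends on the message nonlinearly, whereas cotype speaks of signed sums of fixed tensors; this
  forces the linearisation. It is cheap because there are only N^3 entries: noise of size at most
  1/67 damps a character of degree above m to 67^(-m), so once 67^m >= N^3 the crude entrywise bound
  handles those degrees, and only m = O(log N) degrees need exact treatment. A derivative at 0 needs
  noise parameters of both signs, which averaging over a group of order 67 permits down to -1/66.
  The moduli come from decoding: three queries need a three-term polynomial that vanishes at 4^0 and
  at the two idempotent powers of 4 but not at 4 itself, where 4 has order 33 = 3 * 11 modulo the
  prime 67. Two prime factors are what makes the matching family large: log k reaches the order (log
  log n)^2 / log log log n for length n, more than the O(log log n) lost through powers of log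
  n.\<close>

locale function_space =
  fixes X :: "('i \<Rightarrow> real) nspace"
  assumes vzero_eq [simp]: "vzero X = (\<lambda>_. 0)"
    and vadd_eq [simp]: "vadd X = (\<lambda>x y k. x k + y k)"
    and vscale_eq [simp]: "vscale X = (\<lambda>r x k. r * x k)"
    and zero_in [intro, simp]: "(\<lambda>_. 0) \<in> pts X"
    and add_in [intro]: "x \<in> pts X \<Longrightarrow> y \<in> pts X \<Longrightarrow> (\<lambda>k. x k + y k) \<in> pts X"
    and scale_in [intro]: "x \<in> pts X \<Longrightarrow> (\<lambda>k. r * x k) \<in> pts X"
    and norm_ge_0: "x \<in> pts X \<Longrightarrow> 0 \<le> vnorm X x"
    and norm_add: "x \<in> pts X \<Longrightarrow> y \<in> pts X \<Longrightarrow>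
      vnorm X (\<lambda>k. x k + y k) \<le> vnorm X x + vnorm X y"
    and norm_scale: "x \<in> pts X \<Longrightarrow> vnorm X (\<lambda>k. r * x k) = \<bar>r\<bar> * vnorm X x"
begin

lemma vdiff_eq [simp]: "vdiff X x y = (\<lambda>k. x k - y k)"
  by (simp add: vdiff_def)

lemma diff_in [intro]: "x \<in> pts X \<Longrightarrow> y \<in> pts X \<Longrightarrow> (\<lambda>k. x k - y k) \<in> pts X"
  using add_in[OF _ scale_in[of y "-1"], of x] by simp

lemma norm_zero [simp]: "vnorm X (\<lambda>_. 0) = 0"
  using norm_scale[OF zero_in, of 0] by simp

lemma norm_minus_commute:
  assumes "x \<in> pts X" "y \<in> pts X"
  shows "vnorm X (\<lambda>k. x k - y k) = vnorm X (\<lambda>k. y k - x k)"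
  using norm_scale[OF diff_in[OF assms], of "-1"] by simp

lemma norm_triangle_diff:
  assumes "x \<in> pts X" "y \<in> pts X" "z \<in> pts X"
  shows "vnorm X (\<lambda>k. x k - z k) \<le> vnorm X (\<lambda>k. x k - y k) + vnorm X (\<lambda>k. y k - z k)"
  using norm_add[OF diff_in[OF assms(1,2)] diff_in[OF assms(2,3)]] by simp

lemma norm_diff_abs_le:
  assumes "x \<in> pts X" "y \<in> pts X"
  shows "\<bar>vnorm X x - vnorm X y\<bar> \<le> vnorm X (\<lambda>k. x k - y k)"
  using norm_add[OF diff_in[OF assms] assms(2)] norm_add[OF diff_in[OF assms(2,1)] assms(1)]
    norm_minus_commute[OF assms] by simp

lemma norm_diff_add_le:
  assumes "x \<in> pts X" "y \<in> pts X" "x' \<in> pts X" "y' \<in> pts X"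
  shows "vnorm X (\<lambda>k. (x k + y k) - (x' k + y' k)) \<le>
    vnorm X (\<lambda>k. x k - x' k) + vnorm X (\<lambda>k. y k - y' k)"
proof -
  have "(\<lambda>k. (x k + y k) - (x' k + y' k)) = (\<lambda>k. (x k - x' k) + (y k - y' k))"
    by (simp add: fun_eq_iff)
  thus ?thesis using norm_add[OF diff_in[OF assms(1,3)] diff_in[OF assms(2,4)]] by simp
qed

lemma norm_diff_scale:
  assumes "x \<in> pts X" "y \<in> pts X"
  shows "vnorm X (\<lambda>k. r * x k - r * y k) = \<bar>r\<bar> * vnorm X (\<lambda>k. x k - y k)"
  using norm_scale[OF diff_in[OF assms], of r] by (simp add: right_diff_distrib)

lemma sum_in:
  "finite A \<Longrightarrow> (\<And>i. i \<in> A \<Longrightarrow> f i \<in> pts X) \<Longrightarrow> (\<lambda>k. \<Sum>i\<in>A. f i k) \<in> pts X"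
  by (induction A rule: finite_induct) auto

section \<open>Cauchy sequences modulo null sequences\<close>

lemma cauchy_seqs_iff:
  "s \<in> cauchy_seqs X \<longleftrightarrow> (\<forall>n. s n \<in> pts X) \<and>
     (\<forall>e>0. \<exists>M. \<forall>m\<ge>M. \<forall>n\<ge>M. vnorm X (\<lambda>k. s m k - s n k) < e)"
  by (simp add: cauchy_seqs_def)

lemma cauchy_eq_iff:
  "(s, t) \<in> cauchy_eq X \<longleftrightarrow> s \<in> cauchy_seqs X \<and> t \<in> cauchy_seqs X \<and>
     (\<lambda>n. vnorm X (\<lambda>k. s n k - t n k)) \<longlonglongrightarrow> 0"
  by (simp add: cauchy_eq_def)

lemma cauchy_seqs_in: "s \<in> cauchy_seqs X \<Longrightarrow> s n \<in> pts X"
  by (simp add: cauchy_seqs_iff)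

lemma const_cauchy: "x \<in> pts X \<Longrightarrow> (\<lambda>_. x) \<in> cauchy_seqs X"
  by (auto simp: cauchy_seqs_iff)

lemma add_cauchy:
  assumes "s \<in> cauchy_seqs X" "t \<in> cauchy_seqs X"
  shows "(\<lambda>n k. s n k + t n k) \<in> cauchy_seqs X"
  unfolding cauchy_seqs_iff
proof (intro conjI allI impI)
  fix n show "(\<lambda>k. s n k + t n k) \<in> pts X"
    using assms by (auto simp: cauchy_seqs_iff)
next
  fix e :: real assume "e > 0"
  then have e2: "e/2 > 0" by simp
  obtain M1 where M1: "\<And>m n. m\<ge>M1 \<Longrightarrow> n\<ge>M1 \<Longrightarrow> vnorm X (\<lambda>k. s m k - s n k) < e/2"
    using assms(1) e2 unfolding cauchy_seqs_iff by blast
  obtain M2 where M2: "\<And>m n. m\<ge>M2 \<Longrightarrow> n\<ge>M2 \<Longrightarrow> vnorm X (\<lambda>k. t m k - t n k) < e/2"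
    using assms(2) e2 unfolding cauchy_seqs_iff by blast
  show "\<exists>M. \<forall>m\<ge>M. \<forall>n\<ge>M. vnorm X (\<lambda>k. s m k + t m k - (s n k + t n k)) < e"
  proof (intro exI[of _ "max M1 M2"] allI impI)
    fix m n assume "m \<ge> max M1 M2" "n \<ge> max M1 M2"
    then show "vnorm X (\<lambda>k. s m k + t m k - (s n k + t n k)) < e"
      using M1[of m n] M2[of m n]
        norm_diff_add_le[of "s m" "t m" "s n" "t n"] assms[THEN cauchy_seqs_in] by fastforce
  qed
qed

lemma scale_cauchy:
  assumes "s \<in> cauchy_seqs X"
  shows "(\<lambda>n k. r * s n k) \<in> cauchy_seqs X"
  unfolding cauchy_seqs_iff
proof (intro conjI allI impI)
  fix n show "(\<lambda>k. r * s n k) \<in> pts X"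
    using assms by (auto simp: cauchy_seqs_iff)
next
  fix e :: real assume "e > 0"
  then have "e / (\<bar>r\<bar> + 1) > 0" by simp
  then obtain M where M: "\<And>m n. m\<ge>M \<Longrightarrow> n\<ge>M \<Longrightarrow> vnorm X (\<lambda>k. s m k - s n k) < e / (\<bar>r\<bar> + 1)"
    using assms(1) unfolding cauchy_seqs_iff by blast
  show "\<exists>M. \<forall>m\<ge>M. \<forall>n\<ge>M. vnorm X (\<lambda>k. r * s m k - r * s n k) < e"
  proof (intro exI[of _ M] allI impI)
    fix m n assume mn: "m \<ge> M" "n \<ge> M"
    have "\<bar>r\<bar> * vnorm X (\<lambda>k. s m k - s n k) \<le> (\<bar>r\<bar> + 1) * vnorm X (\<lambda>k. s m k - s n k)"
      using norm_ge_0[OF diff_in[OF cauchy_seqs_in[OF assms, of m] cauchy_seqs_in[OF assms, of n]]]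
      by (intro mult_right_mono) auto
    also have "\<dots> < e" using M[OF mn] by (simp add: field_simps add_pos_nonneg)
    finally show "vnorm X (\<lambda>k. r * s m k - r * s n k) < e"
      using norm_diff_scale cauchy_seqs_in[OF assms] by simp
  qed
qed

lemma equiv_cauchy_eq: "equiv (cauchy_seqs X) (cauchy_eq X)"
proof (rule equivI)
  show "cauchy_eq X \<subseteq> cauchy_seqs X \<times> cauchy_seqs X"
    by (auto simp: cauchy_eq_iff)
  show "refl_on (cauchy_seqs X) (cauchy_eq X)"
    by (auto simp: refl_on_def cauchy_eq_iff)
  show "sym (cauchy_eq X)"
  proof (rule symI)
    fix s t assume st: "(s, t) \<in> cauchy_eq X"
    then have "(\<lambda>n. vnorm X (\<lambda>k. s n k - t n k)) = (\<lambda>n. vnorm X (\<lambda>k. t n k - s n k))"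
      by (intro ext norm_minus_commute) (auto simp: cauchy_eq_iff cauchy_seqs_in)
    with st show "(t, s) \<in> cauchy_eq X" by (simp add: cauchy_eq_iff)
  qed
  show "trans (cauchy_eq X)"
  proof (rule transI)
    fix s t u assume st: "(s, t) \<in> cauchy_eq X" and tu: "(t, u) \<in> cauchy_eq X"
    have in_pts: "s n \<in> pts X" "t n \<in> pts X" "u n \<in> pts X" for n
      using st tu by (auto simp: cauchy_eq_iff cauchy_seqs_in)
    have "(\<lambda>n. vnorm X (\<lambda>k. s n k - t n k) + vnorm X (\<lambda>k. t n k - u n k)) \<longlonglongrightarrow> 0"
      using st tu by (intro tendsto_add_zero) (auto simp: cauchy_eq_iff)
    then have "(\<lambda>n. vnorm X (\<lambda>k. s n k - u n k)) \<longlonglongrightarrow> 0"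
    proof (rule tendsto_sandwich[OF _ _ tendsto_const[of 0], rotated 2])
      show "\<forall>\<^sub>F n in sequentially. 0 \<le> vnorm X (\<lambda>k. s n k - u n k)"
        by (intro always_eventually allI norm_ge_0 diff_in in_pts)
      show "\<forall>\<^sub>F n in sequentially. vnorm X (\<lambda>k. s n k - u n k) \<le>
          vnorm X (\<lambda>k. s n k - t n k) + vnorm X (\<lambda>k. t n k - u n k)"
        by (intro always_eventually allI norm_triangle_diff in_pts)
    qed
    with st tu show "(s, u) \<in> cauchy_eq X" by (auto simp: cauchy_eq_iff)
  qed
qed

lemma cauchy_eq_norm_lim:
  assumes "(s, t) \<in> cauchy_eq X" "(\<lambda>n. vnorm X (s n)) \<longlonglongrightarrow> l"
  shows "(\<lambda>n. vnorm X (t n)) \<longlonglongrightarrow> l"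
proof -
  have in_pts: "s n \<in> pts X" "t n \<in> pts X" for n
    using assms by (auto simp: cauchy_eq_iff cauchy_seqs_in)
  have "(\<lambda>n. vnorm X (\<lambda>k. s n k - t n k)) \<longlonglongrightarrow> 0"
    using assms by (auto simp: cauchy_eq_iff)
  then have "(\<lambda>n. vnorm X (t n) - vnorm X (s n)) \<longlonglongrightarrow> 0"
    by (rule Lim_null_comparison[rotated])
      (use norm_diff_abs_le in_pts in \<open>auto intro!: always_eventually simp: abs_minus_commute\<close>)
  from tendsto_add[OF this assms(2)] show ?thesis by simp
qed

lemma cauchy_norm_convergent:
  assumes "s \<in> cauchy_seqs X"
  shows "convergent (\<lambda>n. vnorm X (s n))"
proof (rule Cauchy_convergent, rule metric_CauchyI)
  fix e :: real assume "e > 0"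
  then obtain M where M: "\<And>m n. m\<ge>M \<Longrightarrow> n\<ge>M \<Longrightarrow> vnorm X (\<lambda>k. s m k - s n k) < e"
    using assms(1) unfolding cauchy_seqs_iff by blast
  show "\<exists>M. \<forall>m\<ge>M. \<forall>n\<ge>M. dist (vnorm X (s m)) (vnorm X (s n)) < e"
    unfolding dist_real_def
    using M norm_diff_abs_le cauchy_seqs_in[OF assms] by (meson order_le_less_trans)
qed

definition cls :: "(nat \<Rightarrow> 'i \<Rightarrow> real) \<Rightarrow> (nat \<Rightarrow> 'i \<Rightarrow> real) set" where
  "cls s = cauchy_eq X `` {s}"

text \<open>Constant sequences, an isometric copy of the uncompleted space. All vectors fed into the
  cotype inequality lie in this copy.\<close>

definition emb :: "('i \<Rightarrow> real) \<Rightarrow> (nat \<Rightarrow> 'i \<Rightarrow> real) set" where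
  "emb x = cls (\<lambda>_. x)"

lemma pts_completion_iff: "A \<in> pts (nspace_completion X) \<longleftrightarrow> (\<exists>s\<in>cauchy_seqs X. A = cls s)"
  by (auto simp: nspace_completion_def cls_def quotient_def)

lemma cls_in: "s \<in> cauchy_seqs X \<Longrightarrow> cls s \<in> pts (nspace_completion X)"
  by (auto simp: pts_completion_iff)

lemma mem_cls: "s \<in> cauchy_seqs X \<Longrightarrow> s \<in> cls s"
  using equiv_class_self[OF equiv_cauchy_eq] by (simp add: cls_def)

text \<open>Makes the definite description in the completed norm meaningful: by the reverse triangle
  inequality norms converge along a Cauchy sequence, and equivalent sequences share the
  limit.\<close>

lemma norm_cls:
  assumes "s \<in> cauchy_seqs X"
  shows "(\<lambda>n. vnorm X (s n)) \<longlonglongrightarrow> vnorm (nspace_completion X) (cls s)"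
proof -
  obtain l where l: "(\<lambda>n. vnorm X (s n)) \<longlonglongrightarrow> l"
    using cauchy_norm_convergent[OF assms] by (auto simp: convergent_def)
  have "(THE l. \<forall>t\<in>cls s. (\<lambda>n. vnorm X (t n)) \<longlonglongrightarrow> l) = l"
  proof (rule the_equality)
    show "\<forall>t\<in>cls s. (\<lambda>n. vnorm X (t n)) \<longlonglongrightarrow> l"
      using l cauchy_eq_norm_lim by (auto simp: cls_def)
    show "l' = l" if "\<forall>t\<in>cls s. (\<lambda>n. vnorm X (t n)) \<longlonglongrightarrow> l'" for l'
      using that l mem_cls[OF assms] LIMSEQ_unique by blast
  qed
  with l show ?thesis by (simp add: nspace_completion_def)
qed

text \<open>The union over all pairs of representatives collapses, since every pair produces the
  same class.\<close>

lemma vadd_cls: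
  assumes "s \<in> cauchy_seqs X" "t \<in> cauchy_seqs X"
  shows "vadd (nspace_completion X) (cls s) (cls t) = cls (\<lambda>n k. s n k + t n k)"
proof -
  have *: "cls (\<lambda>n k. s' n k + t' n k) = cls (\<lambda>n k. s n k + t n k)"
    if "s' \<in> cls s" "t' \<in> cls t" for s' t'
  proof -
    have c: "(s, s') \<in> cauchy_eq X" "(t, t') \<in> cauchy_eq X" using that by (auto simp: cls_def)
    have in_pts: "s n \<in> pts X" "t n \<in> pts X" "s' n \<in> pts X" "t' n \<in> pts X" for n
      using c by (auto simp: cauchy_eq_iff cauchy_seqs_in)
    have "(\<lambda>n. vnorm X (\<lambda>k. s n k - s' n k) + vnorm X (\<lambda>k. t n k - t' n k)) \<longlonglongrightarrow> 0"
      using c by (intro tendsto_add_zero) (auto simp: cauchy_eq_iff)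
    then have "(\<lambda>n. vnorm X (\<lambda>k. s n k + t n k - (s' n k + t' n k))) \<longlonglongrightarrow> 0"
    proof (rule tendsto_sandwich[OF _ _ tendsto_const[of 0], rotated 2])
      show "\<forall>\<^sub>F n in sequentially. 0 \<le> vnorm X (\<lambda>k. s n k + t n k - (s' n k + t' n k))"
        by (intro always_eventually allI norm_ge_0 diff_in add_in in_pts)
      show "\<forall>\<^sub>F n in sequentially. vnorm X (\<lambda>k. s n k + t n k - (s' n k + t' n k)) \<le>
          vnorm X (\<lambda>k. s n k - s' n k) + vnorm X (\<lambda>k. t n k - t' n k)"
        by (intro always_eventually allI norm_diff_add_le in_pts)
    qed
    then have "((\<lambda>n k. s n k + t n k), (\<lambda>n k. s' n k + t' n k)) \<in> cauchy_eq X"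
      using c by (auto simp: cauchy_eq_iff intro!: add_cauchy)
    then show ?thesis unfolding cls_def by (rule equiv_class_eq[OF equiv_cauchy_eq, symmetric])
  qed
  have "vadd (nspace_completion X) (cls s) (cls t) =
      (\<Union>s'\<in>cls s. \<Union>t'\<in>cls t. cls (\<lambda>n k. s' n k + t' n k))"
    by (simp add: nspace_completion_def cls_def)
  also have "\<dots> = cls (\<lambda>n k. s n k + t n k)"
    using *[OF mem_cls mem_cls, OF assms] * mem_cls[OF assms(1)] mem_cls[OF assms(2)] by blast
  finally show ?thesis .
qed

lemma vscale_cls:
  assumes "s \<in> cauchy_seqs X"
  shows "vscale (nspace_completion X) r (cls s) = cls (\<lambda>n k. r * s n k)"
proof -
  have *: "cls (\<lambda>n k. r * s' n k) = cls (\<lambda>n k. r * s n k)" if "s' \<in> cls s" for s'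
  proof -
    have c: "(s, s') \<in> cauchy_eq X" using that by (auto simp: cls_def)
    have in_pts: "s n \<in> pts X" "s' n \<in> pts X" for n
      using c by (auto simp: cauchy_eq_iff cauchy_seqs_in)
    have "(\<lambda>n. \<bar>r\<bar> * vnorm X (\<lambda>k. s n k - s' n k)) \<longlonglongrightarrow> \<bar>r\<bar> * 0"
      using c by (intro tendsto_mult tendsto_const) (auto simp: cauchy_eq_iff)
    then have "((\<lambda>n k. r * s n k), (\<lambda>n k. r * s' n k)) \<in> cauchy_eq X"
      using c in_pts norm_diff_scale by (auto simp: cauchy_eq_iff intro!: scale_cauchy)
    then show ?thesis unfolding cls_def by (rule equiv_class_eq[OF equiv_cauchy_eq, symmetric])
  qed
  have "vscale (nspace_completion X) r (cls s) = (\<Union>s'\<in>cls s. cls (\<lambda>n k. r * s' n k))"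
    by (simp add: nspace_completion_def cls_def)
  also have "\<dots> = cls (\<lambda>n k. r * s n k)"
    using * mem_cls[OF assms] by blast
  finally show ?thesis .
qed

lemma emb_in: "x \<in> pts X \<Longrightarrow> emb x \<in> pts (nspace_completion X)"
  by (simp add: emb_def cls_in const_cauchy)

lemma norm_emb: "x \<in> pts X \<Longrightarrow> vnorm (nspace_completion X) (emb x) = vnorm X x"
  using norm_cls[OF const_cauchy, of x] LIMSEQ_unique tendsto_const unfolding emb_def by blast

lemma vadd_emb:
  "x \<in> pts X \<Longrightarrow> y \<in> pts X \<Longrightarrow> vadd (nspace_completion X) (emb x) (emb y) = emb (\<lambda>k. x k + y k)"
  by (simp add: emb_def vadd_cls const_cauchy)

lemma vscale_emb:
  "x \<in> pts X \<Longrightarrow> vscale (nspace_completion X) r (emb x) = emb (\<lambda>k. r * x k)"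
  by (simp add: emb_def vscale_cls const_cauchy)

lemma vsum_emb:
  "(\<And>i. i < N \<Longrightarrow> x i \<in> pts X) \<Longrightarrow>
    vsum (nspace_completion X) (\<lambda>i. emb (x i)) N = emb (\<lambda>k. \<Sum>i<N. x i k)"
proof (induction N)
  case 0
  then show ?case by (simp add: nspace_completion_def emb_def cls_def)
next
  case (Suc N)
  have "(\<lambda>k. \<Sum>i<N. x i k) \<in> pts X" using Suc.prems by (intro sum_in) auto
  with Suc show ?case by (simp add: vadd_emb)
qed

end

text \<open>All that the projective norm asks of a factor. The points of a completion are classes of
  sequences, so it is no \<open>function_space\<close>; yet it is \<open>homogeneous\<close>, and
  this lets the product be iterated.\<close>

definition homogeneous :: "'a nspace \<Rightarrow> bool" where
  "homogeneous X \<longleftrightarrow> (\<forall>x\<in>pts X. 0 \<le> vnorm X x \<and>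
     (\<forall>r. vscale X r x \<in> pts X \<and> vnorm X (vscale X r x) = \<bar>r\<bar> * vnorm X x))"

lemma (in function_space) homogeneous: "homogeneous X"
  by (auto simp: homogeneous_def norm_ge_0 norm_scale)

lemma (in function_space) homogeneous_completion: "homogeneous (nspace_completion X)"
  unfolding homogeneous_def
proof (intro ballI conjI allI)
  fix A r assume "A \<in> pts (nspace_completion X)"
  then obtain s where s: "s \<in> cauchy_seqs X" and A: "A = cls s"
    by (auto simp: pts_completion_iff)
  show "0 \<le> vnorm (nspace_completion X) A"
    unfolding A by (rule LIMSEQ_le_const[OF norm_cls[OF s]])
      (intro exI[of _ 0] allI impI norm_ge_0 cauchy_seqs_in[OF s])
  show "vscale (nspace_completion X) r A \<in> pts (nspace_completion X)"
    using s by (simp add: A vscale_cls cls_in scale_cauchy)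
  have "(\<lambda>n. \<bar>r\<bar> * vnorm X (s n)) \<longlonglongrightarrow> \<bar>r\<bar> * vnorm (nspace_completion X) A"
    unfolding A by (intro tendsto_mult tendsto_const norm_cls s)
  moreover have "(\<lambda>n. \<bar>r\<bar> * vnorm X (s n)) \<longlonglongrightarrow> vnorm (nspace_completion X) (cls (\<lambda>n k. r * s n k))"
    using norm_cls[OF scale_cauchy[OF s], of r] norm_scale cauchy_seqs_in[OF s] by simp
  ultimately show "vnorm (nspace_completion X) (vscale (nspace_completion X) r A) =
      \<bar>r\<bar> * vnorm (nspace_completion X) A"
    using s by (simp add: A vscale_cls LIMSEQ_unique)
qed

section \<open>The projective norm on the algebraic tensor product\<close>

lemma bilinear_formD:
  assumes "bilinear_form X Y B"
  shows "x \<in> pts X \<Longrightarrow> x' \<in> pts X \<Longrightarrow> y \<in> pts Y \<Longrightarrow> B (vadd X x x') y = B x y + B x' y"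
    and "x \<in> pts X \<Longrightarrow> y \<in> pts Y \<Longrightarrow> y' \<in> pts Y \<Longrightarrow> B x (vadd Y y y') = B x y + B x y'"
    and "x \<in> pts X \<Longrightarrow> y \<in> pts Y \<Longrightarrow> B (vscale X r x) y = r * B x y"
    and "x \<in> pts X \<Longrightarrow> y \<in> pts Y \<Longrightarrow> B x (vscale Y r y) = r * B x y"
  using assms by (auto simp: bilinear_form_def)

lemma alg_tensor_sel [simp]:
  "vzero (alg_tensor X Y) = (\<lambda>_. 0)"
  "vadd (alg_tensor X Y) = (\<lambda>z w B. z B + w B)"
  "vscale (alg_tensor X Y) = (\<lambda>r z B. r * z B)"
  by (simp_all add: alg_tensor_def)

lemma pts_alg_tensor: "z \<in> pts (alg_tensor X Y) \<longleftrightarrow> (\<exists>N x y. tensor_rep X Y z N x y)"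
  by (simp add: alg_tensor_def)

locale homogeneous_pair =
  fixes X :: "'a nspace" and Y :: "'b nspace"
  assumes homX: "homogeneous X" and homY: "homogeneous Y"
begin

definition costs :: "('a, 'b) tens \<Rightarrow> real set" where
  "costs z = {\<Sum>i<N. vnorm X (x i) * vnorm Y (y i) | N x y. tensor_rep X Y z N x y}"

lemma norm_tensor_eq: "vnorm (alg_tensor X Y) z = Inf (costs z)"
  by (simp add: alg_tensor_def costs_def)

lemma cost_ge_0:
  "tensor_rep X Y z N x y \<Longrightarrow> 0 \<le> (\<Sum>i<N. vnorm X (x i) * vnorm Y (y i))"
  using homX homY by (intro sum_nonneg) (auto simp: tensor_rep_def homogeneous_def)

lemma bdd_below_costs: "bdd_below (costs z)"
  by (rule bdd_belowI[of _ 0]) (auto simp: costs_def cost_ge_0)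

lemma norm_tensor_le:
  assumes "tensor_rep X Y z N x y"
  shows "vnorm (alg_tensor X Y) z \<le> (\<Sum>i<N. vnorm X (x i) * vnorm Y (y i))"
  unfolding norm_tensor_eq
  by (rule cInf_lower[OF _ bdd_below_costs]) (use assms in \<open>auto simp: costs_def\<close>)

lemma norm_tensor_ge:
  assumes "z \<in> pts (alg_tensor X Y)"
    and "\<And>N x y. tensor_rep X Y z N x y \<Longrightarrow> c \<le> (\<Sum>i<N. vnorm X (x i) * vnorm Y (y i))"
  shows "c \<le> vnorm (alg_tensor X Y) z"
  unfolding norm_tensor_eq
  by (rule cInf_greatest) (use assms in \<open>auto simp: costs_def pts_alg_tensor\<close>)

lemma norm_tensor_less_rep:
  assumes "z \<in> pts (alg_tensor X Y)" "vnorm (alg_tensor X Y) z < c"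
  obtains N x y where "tensor_rep X Y z N x y" "(\<Sum>i<N. vnorm X (x i) * vnorm Y (y i)) < c"
  using norm_tensor_ge[OF assms(1), of c] assms(2) by fastforce

lemma rep_scale:
  assumes "tensor_rep X Y z N x y"
  shows "tensor_rep X Y (\<lambda>B. r * z B) N (\<lambda>i. vscale X r (x i)) y"
    and "(\<Sum>i<N. vnorm X (vscale X r (x i)) * vnorm Y (y i)) =
      \<bar>r\<bar> * (\<Sum>i<N. vnorm X (x i) * vnorm Y (y i))"
proof -
  have "r * elem_tensor X Y (x i) (y i) B = elem_tensor X Y (vscale X r (x i)) (y i) B"
    if "i < N" for i B
    using assms that by (auto simp: elem_tensor_def tensor_rep_def bilinear_formD)
  then show "tensor_rep X Y (\<lambda>B. r * z B) N (\<lambda>i. vscale X r (x i)) y"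
    using assms homX by (auto simp: tensor_rep_def homogeneous_def sum_distrib_left)
  show "(\<Sum>i<N. vnorm X (vscale X r (x i)) * vnorm Y (y i)) =
      \<bar>r\<bar> * (\<Sum>i<N. vnorm X (x i) * vnorm Y (y i))"
    unfolding sum_distrib_left using assms homX
    by (intro sum.cong) (auto simp: tensor_rep_def homogeneous_def)
qed

lemma rep_add:
  assumes "tensor_rep X Y z N x y" "tensor_rep X Y w N' x' y'"
  obtains x'' y'' where "tensor_rep X Y (\<lambda>B. z B + w B) (N + N') x'' y''"
    and "(\<Sum>i<N + N'. vnorm X (x'' i) * vnorm Y (y'' i)) =
      (\<Sum>i<N. vnorm X (x i) * vnorm Y (y i)) + (\<Sum>i<N'. vnorm X (x' i) * vnorm Y (y' i))"
proof -
  define x'' where "x'' = (\<lambda>i. if i < N then x i else x' (i - N))"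
  define y'' where "y'' = (\<lambda>i. if i < N then y i else y' (i - N))"
  have split: "(\<Sum>i<N + N'. g (x'' i) (y'' i)) = (\<Sum>i<N. g (x i) (y i)) + (\<Sum>i<N'. g (x' i) (y' i))"
    for g :: "'a \<Rightarrow> 'b \<Rightarrow> real"
  proof -
    have "(\<Sum>i<N + N'. g (x'' i) (y'' i)) =
        (\<Sum>i<N. g (x'' i) (y'' i)) + (\<Sum>i<N'. g (x'' (N + i)) (y'' (N + i)))"
      by (induction N') simp_all
    then show ?thesis by (simp add: x''_def y''_def)
  qed
  have "tensor_rep X Y (\<lambda>B. z B + w B) (N + N') x'' y''"
    using assms split[of "\<lambda>x y. elem_tensor X Y x y B" for B]
    by (auto simp: tensor_rep_def x''_def y''_def)
  with split[of "\<lambda>x y. vnorm X x * vnorm Y y"] show ?thesis using that by blast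
qed

lemma function_space_alg_tensor: "function_space (alg_tensor X Y)"
proof
  let ?P = "pts (alg_tensor X Y)" and ?n = "vnorm (alg_tensor X Y)"
  have rep0: "tensor_rep X Y (\<lambda>B. 0) 0 x y" for x y by (simp add: tensor_rep_def)
  then show zero: "(\<lambda>_. 0) \<in> ?P" unfolding pts_alg_tensor by blast
  show ge0: "0 \<le> ?n z" if "z \<in> ?P" for z
    by (rule norm_tensor_ge[OF that], rule cost_ge_0)
  show scale: "(\<lambda>B. r * z B) \<in> ?P" if "z \<in> ?P" for r z
  proof -
    obtain N x y where "tensor_rep X Y z N x y" using \<open>z \<in> ?P\<close> by (auto simp: pts_alg_tensor)
    from rep_scale(1)[OF this] show ?thesis unfolding pts_alg_tensor by blast
  qed
  show add: "(\<lambda>B. z B + w B) \<in> ?P" if zw: "z \<in> ?P" "w \<in> ?P" for z w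
  proof -
    obtain N x y N' x' y' where "tensor_rep X Y z N x y" "tensor_rep X Y w N' x' y'"
      using zw unfolding pts_alg_tensor by blast
    from rep_add[OF this] show ?thesis unfolding pts_alg_tensor by blast
  qed
  show "?n (\<lambda>B. z B + w B) \<le> ?n z + ?n w" if zw: "z \<in> ?P" "w \<in> ?P" for z w
  proof (rule field_le_epsilon)
    fix e :: real assume "e > 0"
    obtain N x y where 1: "tensor_rep X Y z N x y"
      "(\<Sum>i<N. vnorm X (x i) * vnorm Y (y i)) < ?n z + e/2"
      using norm_tensor_less_rep[OF zw(1), of "?n z + e/2"] \<open>e > 0\<close> by auto
    obtain N' x' y' where 2: "tensor_rep X Y w N' x' y'"
      "(\<Sum>i<N'. vnorm X (x' i) * vnorm Y (y' i)) < ?n w + e/2"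
      using norm_tensor_less_rep[OF zw(2), of "?n w + e/2"] \<open>e > 0\<close> by auto
    obtain x'' y'' where "tensor_rep X Y (\<lambda>B. z B + w B) (N + N') x'' y''"
      "(\<Sum>i<N + N'. vnorm X (x'' i) * vnorm Y (y'' i)) =
      (\<Sum>i<N. vnorm X (x i) * vnorm Y (y i)) + (\<Sum>i<N'. vnorm X (x' i) * vnorm Y (y' i))"
      using rep_add[OF 1(1) 2(1)] .
    with norm_tensor_le[OF this(1)] 1(2) 2(2) show "?n (\<lambda>B. z B + w B) \<le> ?n z + ?n w + e"
      by linarith
  qed
  have scale_le: "?n (\<lambda>B. r * z B) \<le> \<bar>r\<bar> * ?n z" if z: "z \<in> ?P" for r z
  proof (cases "r = 0")
    case True
    then show ?thesis using norm_tensor_le[OF rep0] by simp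
  next
    case False
    have "?n (\<lambda>B. r * z B) / \<bar>r\<bar> \<le> ?n z"
    proof (rule norm_tensor_ge[OF z])
      fix N x y assume r: "tensor_rep X Y z N x y"
      from norm_tensor_le[OF rep_scale(1)[OF this, of r]]
      show "?n (\<lambda>B. r * z B) / \<bar>r\<bar> \<le> (\<Sum>i<N. vnorm X (x i) * vnorm Y (y i))"
        unfolding rep_scale(2)[OF r] using False by (simp add: field_simps)
    qed
    then show ?thesis using False by (simp add: field_simps)
  qed
  show "?n (\<lambda>B. r * z B) = \<bar>r\<bar> * ?n z" if z: "z \<in> ?P" for r z
  proof (rule antisym[OF scale_le[OF z]])
    show "\<bar>r\<bar> * ?n z \<le> ?n (\<lambda>B. r * z B)"
    proof (cases "r = 0")
      case True
      then show ?thesis using ge0[OF zero] by simp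
    next
      case False
      then have "?n z \<le> \<bar>1 / r\<bar> * ?n (\<lambda>B. r * z B)"
        using scale_le[OF scale[OF z, of r], of "1 / r"] by simp
      with False show ?thesis by (simp add: field_simps)
    qed
  qed
qed simp_all

sublocale T: function_space "alg_tensor X Y"
  by (rule function_space_alg_tensor)

lemma homogeneous_proj_tensor: "homogeneous (X \<otimes>\<^sub>\<pi> Y)"
  unfolding proj_tensor_def by (rule T.homogeneous_completion)

lemma elem_tensor_in:
  assumes "x \<in> pts X" "y \<in> pts Y"
  shows "elem_tensor X Y x y \<in> pts (alg_tensor X Y)"
    and "vnorm (alg_tensor X Y) (elem_tensor X Y x y) \<le> vnorm X x * vnorm Y y"
proof -
  have r: "tensor_rep X Y (elem_tensor X Y x y) 1 (\<lambda>_. x) (\<lambda>_. y)"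
    using assms by (simp add: tensor_rep_def)
  then show "elem_tensor X Y x y \<in> pts (alg_tensor X Y)" by (auto simp: pts_alg_tensor)
  show "vnorm (alg_tensor X Y) (elem_tensor X Y x y) \<le> vnorm X x * vnorm Y y"
    using norm_tensor_le[OF r] by simp
qed

text \<open>The easy half of the duality between the projective norm and bounded bilinear forms; the
  lower bounds for the norms of the arrays rest on it.\<close>

lemma tensor_apply_bound:
  assumes z: "z \<in> pts (alg_tensor X Y)" and B: "bilinear_form X Y B"
    and bound: "\<And>x y. x \<in> pts X \<Longrightarrow> y \<in> pts Y \<Longrightarrow> \<bar>B x y\<bar> \<le> K * (vnorm X x * vnorm Y y)"
    and K: "K \<ge> 0"
  shows "\<bar>z B\<bar> \<le> K * vnorm (alg_tensor X Y) z"
proof (cases "K = 0")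
  case True
  obtain N x y where r: "tensor_rep X Y z N x y" using z by (auto simp: pts_alg_tensor)
  then show ?thesis using B bound True by (auto simp: tensor_rep_def elem_tensor_def)
next
  case False
  have "\<bar>z B\<bar> / K \<le> vnorm (alg_tensor X Y) z"
  proof (rule norm_tensor_ge[OF z])
    fix N x y assume r: "tensor_rep X Y z N x y"
    have "\<bar>z B\<bar> = \<bar>\<Sum>i<N. B (x i) (y i)\<bar>"
      using r B by (auto simp: tensor_rep_def elem_tensor_def)
    also have "\<dots> \<le> (\<Sum>i<N. K * (vnorm X (x i) * vnorm Y (y i)))"
      using r bound by (intro order.trans[OF sum_abs] sum_mono) (auto simp: tensor_rep_def)
    finally show "\<bar>z B\<bar> / K \<le> (\<Sum>i<N. vnorm X (x i) * vnorm Y (y i))"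
      using False K by (simp add: field_simps flip: sum_distrib_left)
  qed
  then show ?thesis using False K by (simp add: field_simps)
qed

text \<open>Elements of the algebraic tensor product are functionals of the bilinear form, additive only
  on genuine bilinear forms because of the dummy value in \<^const>\<open>elem_tensor\<close>.\<close>

lemma tensor_apply_add:
  assumes "z \<in> pts (alg_tensor X Y)" "bilinear_form X Y B" "bilinear_form X Y B'"
    "bilinear_form X Y B''" "\<And>x y. x \<in> pts X \<Longrightarrow> y \<in> pts Y \<Longrightarrow> B'' x y = B x y + B' x y"
  shows "z B'' = z B + z B'"
proof -
  obtain N x y where r: "tensor_rep X Y z N x y" using assms by (auto simp: pts_alg_tensor)
  with assms show ?thesis by (simp add: tensor_rep_def elem_tensor_def sum.distrib)
qed

lemma tensor_apply_scale:
  assumes "z \<in> pts (alg_tensor X Y)" "bilinear_form X Y B"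
    "bilinear_form X Y B''" "\<And>x y. x \<in> pts X \<Longrightarrow> y \<in> pts Y \<Longrightarrow> B'' x y = r * B x y"
  shows "z B'' = r * z B"
proof -
  obtain N x y where r: "tensor_rep X Y z N x y" using assms by (auto simp: pts_alg_tensor)
  with assms show ?thesis by (simp add: tensor_rep_def elem_tensor_def sum_distrib_left)
qed

end

section \<open>Extension of trilinear forms\<close>

context homogeneous_pair
begin

text \<open>The left factor of the threefold product is itself a completion, so a trilinear test
  form must be extended by continuity from elementary tensors before
  \<open>tensor_apply_bound\<close> applies to it. For fixed z the class of a Cauchy sequence s goes
  to the limit of the values of \<open>s n\<close> at the form T(., ., z).\<close>

lemma extend_trilinear:
  fixes Z :: "'c nspace" and T :: "'a \<Rightarrow> 'b \<Rightarrow> 'c \<Rightarrow> real"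
  assumes bil: "\<And>z. z \<in> pts Z \<Longrightarrow> bilinear_form X Y (\<lambda>x y. T x y z)"
    and addZ: "\<And>z z'. z \<in> pts Z \<Longrightarrow> z' \<in> pts Z \<Longrightarrow> vadd Z z z' \<in> pts Z"
    and T_add: "\<And>x y z z'. x \<in> pts X \<Longrightarrow> y \<in> pts Y \<Longrightarrow> z \<in> pts Z \<Longrightarrow> z' \<in> pts Z \<Longrightarrow>
      T x y (vadd Z z z') = T x y z + T x y z'"
    and homZ: "homogeneous Z"
    and T_scale: "\<And>x y z r. x \<in> pts X \<Longrightarrow> y \<in> pts Y \<Longrightarrow> z \<in> pts Z \<Longrightarrow>
      T x y (vscale Z r z) = r * T x y z"
    and bound: "\<And>x y z. x \<in> pts X \<Longrightarrow> y \<in> pts Y \<Longrightarrow> z \<in> pts Z \<Longrightarrow>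
      \<bar>T x y z\<bar> \<le> K * (vnorm X x * vnorm Y y * vnorm Z z)"
    and K: "K \<ge> 0"
  obtains B where "bilinear_form (X \<otimes>\<^sub>\<pi> Y) Z B"
    and "\<And>A z. A \<in> pts (X \<otimes>\<^sub>\<pi> Y) \<Longrightarrow> z \<in> pts Z \<Longrightarrow>
      \<bar>B A z\<bar> \<le> K * (vnorm (X \<otimes>\<^sub>\<pi> Y) A * vnorm Z z)"
    and "\<And>x y z. x \<in> pts X \<Longrightarrow> y \<in> pts Y \<Longrightarrow> z \<in> pts Z \<Longrightarrow>
      B (T.emb (elem_tensor X Y x y)) z = T x y z"
proof -
  define Tz where "Tz z = (\<lambda>x y. T x y z)" for z
  \<comment> \<open>Tensors are functionals on bilinear forms, so pairing with \<open>Tz z\<close>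
    is plain application; the limit agrees on all representatives of A.\<close>
  define B where "B A z = (THE l :: real. \<forall>s\<in>A. (\<lambda>n. s n (Tz z)) \<longlonglongrightarrow> l)" for A z
  have normZ: "0 \<le> vnorm Z z" "vscale Z r z \<in> pts Z" if "z \<in> pts Z" for z r
    using homZ that by (auto simp: homogeneous_def)
  have Tz_bil: "bilinear_form X Y (Tz z)" if "z \<in> pts Z" for z
    using bil[OF that] by (simp add: Tz_def)
  have apply_bound: "\<bar>w (Tz z)\<bar> \<le> (K * vnorm Z z) * vnorm (alg_tensor X Y) w"
    if "w \<in> pts (alg_tensor X Y)" "z \<in> pts Z" for w z
    using that(1) Tz_bil[OF that(2)]
    by (rule tensor_apply_bound) (use that bound K normZ in \<open>auto simp: Tz_def mult_ac\<close>)
  have B_lim: "(\<lambda>n. s n (Tz z)) \<longlonglongrightarrow> B (T.cls s) z"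
    if s: "s \<in> cauchy_seqs (alg_tensor X Y)" and z: "z \<in> pts Z" for s z
  proof -
    \<comment> \<open>The summand 1 keeps the Lipschitz constant positive, so that one can divide by
      it.\<close>
    let ?K = "K * vnorm Z z + 1"
    have Kpos: "?K > 0" using K normZ(1)[OF z] by (simp add: add_nonneg_pos)
    have diff: "\<bar>v (Tz z) - w (Tz z)\<bar> \<le> ?K * vnorm (alg_tensor X Y) (\<lambda>B. v B - w B)"
      if "v \<in> pts (alg_tensor X Y)" "w \<in> pts (alg_tensor X Y)" for v w
      using apply_bound[OF T.diff_in[OF that] z] T.norm_ge_0[OF T.diff_in[OF that]]
      by (simp add: distrib_right)
    have "Cauchy (\<lambda>n. s n (Tz z))"
    proof (rule metric_CauchyI)
      fix e :: real assume "e > 0"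
      with Kpos have "e / ?K > 0" by simp
      then obtain M where M: "\<And>m n. m\<ge>M \<Longrightarrow> n\<ge>M \<Longrightarrow>
          vnorm (alg_tensor X Y) (\<lambda>k. s m k - s n k) < e / ?K"
        using s unfolding T.cauchy_seqs_iff by blast
      show "\<exists>M. \<forall>m\<ge>M. \<forall>n\<ge>M. dist (s m (Tz z)) (s n (Tz z)) < e"
      proof (intro exI[of _ M] allI impI)
        fix m n assume "m \<ge> M" "n \<ge> M"
        from M[OF this] have "?K * vnorm (alg_tensor X Y) (\<lambda>k. s m k - s n k) < e"
          using Kpos by (simp add: pos_less_divide_eq mult.commute)
        with diff[OF T.cauchy_seqs_in[OF s, of m] T.cauchy_seqs_in[OF s, of n]]
        show "dist (s m (Tz z)) (s n (Tz z)) < e" by (simp add: dist_real_def)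
      qed
    qed
    then obtain l where l: "(\<lambda>n. s n (Tz z)) \<longlonglongrightarrow> l"
      using Cauchy_convergent convergent_def by blast
    have other: "(\<lambda>n. t n (Tz z)) \<longlonglongrightarrow> l" if "t \<in> T.cls s" for t
    proof -
      have st: "t \<in> cauchy_seqs (alg_tensor X Y)"
        "(\<lambda>n. vnorm (alg_tensor X Y) (\<lambda>k. s n k - t n k)) \<longlonglongrightarrow> 0"
        using that by (auto simp: T.cls_def T.cauchy_eq_iff)
      have "(\<lambda>n. s n (Tz z) - t n (Tz z)) \<longlonglongrightarrow> 0"
      proof (rule Lim_null_comparison)
        show "\<forall>\<^sub>F n in sequentially. norm (s n (Tz z) - t n (Tz z)) \<le>
            ?K * vnorm (alg_tensor X Y) (\<lambda>k. s n k - t n k)"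
          using diff[OF T.cauchy_seqs_in[OF s] T.cauchy_seqs_in[OF st(1)]] by simp
        show "(\<lambda>n. ?K * vnorm (alg_tensor X Y) (\<lambda>k. s n k - t n k)) \<longlonglongrightarrow> 0"
          using tendsto_mult[OF tendsto_const st(2), of ?K] by simp
      qed
      from tendsto_diff[OF l this] show ?thesis by simp
    qed
    have "B (T.cls s) z = l"
      unfolding B_def
    proof (rule the_equality)
      show "\<forall>t\<in>T.cls s. (\<lambda>n. t n (Tz z)) \<longlonglongrightarrow> l" using other by blast
      show "l' = l" if "\<forall>t\<in>T.cls s. (\<lambda>n. t n (Tz z)) \<longlonglongrightarrow> l'" for l'
        using that l T.mem_cls[OF s] LIMSEQ_unique by blast
    qed
    with l show ?thesis by simp
  qed
  have pts_iff: "A \<in> pts (X \<otimes>\<^sub>\<pi> Y) \<longleftrightarrow> (\<exists>s\<in>cauchy_seqs (alg_tensor X Y). A = T.cls s)" for A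
    unfolding proj_tensor_def by (rule T.pts_completion_iff)
  have "bilinear_form (X \<otimes>\<^sub>\<pi> Y) Z B"
    unfolding bilinear_form_def
  proof (intro conjI ballI allI)
    fix A A' z assume "A \<in> pts (X \<otimes>\<^sub>\<pi> Y)" "A' \<in> pts (X \<otimes>\<^sub>\<pi> Y)" and z: "z \<in> pts Z"
    then obtain s t where s: "s \<in> cauchy_seqs (alg_tensor X Y)" "A = T.cls s"
      and t: "t \<in> cauchy_seqs (alg_tensor X Y)" "A' = T.cls t" by (auto simp: pts_iff)
    have "(\<lambda>n. s n (Tz z) + t n (Tz z)) \<longlonglongrightarrow> B A z + B A' z"
      unfolding s t by (intro tendsto_add B_lim s t z)
    moreover have "(\<lambda>n. s n (Tz z) + t n (Tz z)) \<longlonglongrightarrow> B (T.cls (\<lambda>n k. s n k + t n k)) z"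
      using B_lim[OF T.add_cauchy[OF s(1) t(1)] z] .
    ultimately show "B (vadd (X \<otimes>\<^sub>\<pi> Y) A A') z = B A z + B A' z"
      using s t by (simp add: proj_tensor_def T.vadd_cls LIMSEQ_unique)
  next
    fix A z z' assume "A \<in> pts (X \<otimes>\<^sub>\<pi> Y)" and z: "z \<in> pts Z" "z' \<in> pts Z"
    then obtain s where s: "s \<in> cauchy_seqs (alg_tensor X Y)" "A = T.cls s" by (auto simp: pts_iff)
    have "(\<lambda>n. s n (Tz z) + s n (Tz z')) \<longlonglongrightarrow> B A z + B A z'"
      unfolding s by (intro tendsto_add B_lim s z)
    moreover have "s n (Tz (vadd Z z z')) = s n (Tz z) + s n (Tz z')" for n
      by (rule tensor_apply_add[OF T.cauchy_seqs_in[OF s(1)]])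
        (use z addZ T_add Tz_bil in \<open>auto simp: Tz_def\<close>)
    ultimately show "B A (vadd Z z z') = B A z + B A z'"
      using B_lim[OF s(1) addZ[OF z]] LIMSEQ_unique unfolding s(2) by force
  next
    fix r A z assume "A \<in> pts (X \<otimes>\<^sub>\<pi> Y)" and z: "z \<in> pts Z"
    then obtain s where s: "s \<in> cauchy_seqs (alg_tensor X Y)" "A = T.cls s" by (auto simp: pts_iff)
    have 1: "(\<lambda>n. r * s n (Tz z)) \<longlonglongrightarrow> r * B A z"
      unfolding s by (intro tendsto_mult tendsto_const B_lim s z)
    have "(\<lambda>n. r * s n (Tz z)) \<longlonglongrightarrow> B (T.cls (\<lambda>n k. r * s n k)) z"
      using B_lim[OF T.scale_cauchy[OF s(1)] z] .
    with 1 show "B (vscale (X \<otimes>\<^sub>\<pi> Y) r A) z = r * B A z"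
      using s by (simp add: proj_tensor_def T.vscale_cls LIMSEQ_unique)
    have "s n (Tz (vscale Z r z)) = r * s n (Tz z)" for n
      by (rule tensor_apply_scale[OF T.cauchy_seqs_in[OF s(1)]])
        (use z normZ T_scale Tz_bil in \<open>auto simp: Tz_def\<close>)
    with 1 show "B A (vscale Z r z) = r * B A z"
      using B_lim[OF s(1) normZ(2)[OF z], of r] LIMSEQ_unique unfolding s(2) by force
  qed
  moreover have "\<bar>B A z\<bar> \<le> K * (vnorm (X \<otimes>\<^sub>\<pi> Y) A * vnorm Z z)"
    if "A \<in> pts (X \<otimes>\<^sub>\<pi> Y)" "z \<in> pts Z" for A z
  proof -
    obtain s where s: "s \<in> cauchy_seqs (alg_tensor X Y)" "A = T.cls s"
      using \<open>A \<in> pts (X \<otimes>\<^sub>\<pi> Y)\<close> by (auto simp: pts_iff)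
    have "(\<lambda>n. (K * vnorm Z z) * vnorm (alg_tensor X Y) (s n)) \<longlonglongrightarrow>
        (K * vnorm Z z) * vnorm (X \<otimes>\<^sub>\<pi> Y) A"
      unfolding s proj_tensor_def by (intro tendsto_mult tendsto_const T.norm_cls s)
    moreover have "(\<lambda>n. \<bar>s n (Tz z)\<bar>) \<longlonglongrightarrow> \<bar>B A z\<bar>"
      unfolding s by (intro tendsto_rabs B_lim s that)
    ultimately have "\<bar>B A z\<bar> \<le> (K * vnorm Z z) * vnorm (X \<otimes>\<^sub>\<pi> Y) A"
      using apply_bound[OF T.cauchy_seqs_in[OF s(1)] that(2)] by (intro LIMSEQ_le) auto
    then show ?thesis by (simp add: mult_ac)
  qed
  moreover have "B (T.emb (elem_tensor X Y x y)) z = T x y z"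
    if "x \<in> pts X" "y \<in> pts Y" "z \<in> pts Z" for x y z
  proof -
    have "(\<lambda>n. elem_tensor X Y x y (Tz z)) \<longlonglongrightarrow> B (T.emb (elem_tensor X Y x y)) z"
      unfolding T.emb_def by (intro B_lim T.const_cauchy elem_tensor_in that)
    then have "elem_tensor X Y x y (Tz z) = B (T.emb (elem_tensor X Y x y)) z"
      by (simp add: LIMSEQ_const_iff)
    then show ?thesis using Tz_bil[OF that(3)] by (simp add: elem_tensor_def Tz_def)
  qed
  ultimately show thesis using that by blast
qed

end

section \<open>The spaces $\ell_p$ and $\ell_p^n$\<close>

definition lp_norm :: "real \<Rightarrow> nat \<Rightarrow> (nat \<Rightarrow> real) \<Rightarrow> real" where
  "lp_norm p N x = (\<Sum>k<N. \<bar>x k\<bar> powr p) powr (1 / p)"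

lemma lp_norm_ge_0: "0 \<le> lp_norm p N x"
  by (simp add: lp_norm_def)

lemma lp_norm_eq_0: "p > 0 \<Longrightarrow> lp_norm p N x = 0 \<Longrightarrow> k < N \<Longrightarrow> x k = 0"
  by (auto simp: lp_norm_def sum_nonneg_eq_0_iff)

text \<open>The tangent line of ln at the geometric mean g, averaged over a, b, c and 1. The number
  1 receives the missing weight, which is how exponent sums below 1 are accommodated.\<close>

lemma weighted_am_gm:
  fixes a b c :: real
  assumes "0 < a" "0 < b" "0 < c" "0 \<le> \<alpha>" "0 \<le> \<beta>" "0 \<le> \<gamma>" "\<alpha> + \<beta> + \<gamma> \<le> 1"
  shows "a powr \<alpha> * b powr \<beta> * c powr \<gamma> \<le> \<alpha> * a + \<beta> * b + \<gamma> * c + (1 - \<alpha> - \<beta> - \<gamma>)"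
proof -
  define g where "g = a powr \<alpha> * b powr \<beta> * c powr \<gamma>"
  have g: "g > 0" using assms by (simp add: g_def)
  have ln_g: "ln g = \<alpha> * ln a + \<beta> * ln b + \<gamma> * ln c"
    using assms by (simp add: g_def ln_mult ln_powr)
  have tangent: "g * (1 + ln t - ln g) \<le> t" if "t > 0" for t
  proof -
    have "ln (t / g) \<le> t / g - 1" using that g by (intro ln_le_minus_one) simp
    then have "1 + ln t - ln g \<le> t / g" using that g by (simp add: ln_div)
    then show ?thesis using g by (simp add: field_simps)
  qed
  have "g = \<alpha> * (g * (1 + ln a - ln g)) + \<beta> * (g * (1 + ln b - ln g)) + \<gamma> * (g * (1 + ln c - ln g))
      + (1 - \<alpha> - \<beta> - \<gamma>) * (g * (1 + ln 1 - ln g))"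
    unfolding ln_g by (simp add: algebra_simps)
  also have "\<dots> \<le> \<alpha> * a + \<beta> * b + \<gamma> * c + (1 - \<alpha> - \<beta> - \<gamma>) * 1"
    using assms by (intro add_mono mult_left_mono tangent) auto
  finally show ?thesis by (simp add: g_def)
qed

text \<open>Injectivity is asked in each of the three positions separately; an index may recur in
  another position. This is what a trilinear form with one vector per position needs.\<close>

definition matching :: "nat \<Rightarrow> (nat \<times> nat \<times> nat) set \<Rightarrow> bool" where
  "matching N M \<longleftrightarrow> M \<subseteq> {..<N} \<times> {..<N} \<times> {..<N} \<and>
     inj_on fst M \<and> inj_on (fst \<circ> snd) M \<and> inj_on (snd \<circ> snd) M"

lemma matching_finite: "matching N M \<Longrightarrow> finite M"
  unfolding matching_def by (elim conjE, rule finite_subset) auto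

lemma matching_sum_le:
  fixes f :: "nat \<Rightarrow> real"
  assumes M: "matching N M" and f: "\<And>k. 0 \<le> f k"
  shows "(\<Sum>(a, b, c)\<in>M. f a) \<le> (\<Sum>k<N. f k)" "(\<Sum>(a, b, c)\<in>M. f b) \<le> (\<Sum>k<N. f k)"
    "(\<Sum>(a, b, c)\<in>M. f c) \<le> (\<Sum>k<N. f k)"
proof -
  have *: "(\<Sum>t\<in>M. f (h t)) \<le> (\<Sum>k<N. f k)" if "inj_on h M" "\<And>t. t \<in> M \<Longrightarrow> h t < N" for h
  proof -
    have "h ` M \<subseteq> {..<N}" using that(2) by auto
    then show ?thesis
      using sum.reindex[OF that(1), of f] sum_mono2[OF finite_lessThan, of "h ` M" N f] f
      by (simp add: o_def)
  qed
  show "(\<Sum>(a, b, c)\<in>M. f a) \<le> (\<Sum>k<N. f k)" "(\<Sum>(a, b, c)\<in>M. f b) \<le> (\<Sum>k<N. f k)"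
    "(\<Sum>(a, b, c)\<in>M. f c) \<le> (\<Sum>k<N. f k)"
    using *[of fst] *[of "fst \<circ> snd"] *[of "snd \<circ> snd"] M
    by (fastforce simp: matching_def case_prod_beta)+
qed

lemma matching_card_le: "matching N M \<Longrightarrow> card M \<le> N"
  using matching_sum_le(1)[of N M "\<lambda>_. 1"] by (simp add: case_prod_beta)

text \<open>Rescaling gives each \<open>F\<close> mean 1 over the N coordinates, and the weighted
  AM-GM inequality is applied triple by triple. Injectivity bounds the sum of each \<open>F\<close>
  over M by N, and card M <= N takes care of the leftover weight. Constant vectors on a matching of
  size N give equality.\<close>

lemma matching_hoelder:
  assumes M: "matching N M" and p: "p1 > 0" "p2 > 0" "p3 > 0" "1 / p1 + 1 / p2 + 1 / p3 \<le> 1"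
  shows "(\<Sum>(a, b, c)\<in>M. \<bar>x a\<bar> * \<bar>y b\<bar> * \<bar>z c\<bar>) \<le>
    N * real N powr - (1 / p1 + 1 / p2 + 1 / p3) * (lp_norm p1 N x * lp_norm p2 N y * lp_norm p3 N z)"
proof (cases "lp_norm p1 N x = 0 \<or> lp_norm p2 N y = 0 \<or> lp_norm p3 N z = 0")
  case True
  then have "(\<Sum>(a, b, c)\<in>M. \<bar>x a\<bar> * \<bar>y b\<bar> * \<bar>z c\<bar>) = 0"
    using M lp_norm_eq_0[OF p(1)] lp_norm_eq_0[OF p(2)] lp_norm_eq_0[OF p(3)]
    by (intro sum.neutral) (auto simp: matching_def)
  with True show ?thesis by auto
next
  case False
  define L where "L = lp_norm p1 N x * lp_norm p2 N y * lp_norm p3 N z"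
  define n where "n = real N powr - (1 / p1 + 1 / p2 + 1 / p3)"
  define F where "F p w k = N * (\<bar>w k\<bar> powr p / lp_norm p N w powr p)" for p w and k :: nat
  have N: "N > 0" using False by (auto simp: lp_norm_def intro: Nat.gr0I)
  have pos: "lp_norm p1 N x > 0" "lp_norm p2 N y > 0" "lp_norm p3 N z > 0"
    using False lp_norm_ge_0[of p1 N x] lp_norm_ge_0[of p2 N y] lp_norm_ge_0[of p3 N z] by auto
  have F0: "0 \<le> F p w k" for p w k by (simp add: F_def)
  have F_sum: "(\<Sum>k<N. F p w k) = N" if "p > 0" "lp_norm p N w > 0" for p w
  proof -
    have "lp_norm p N w powr p = (\<Sum>k<N. \<bar>w k\<bar> powr p)"
      using that(1) by (simp add: lp_norm_def powr_powr sum_nonneg)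
    moreover have "(\<Sum>k<N. \<bar>w k\<bar> powr p) \<noteq> 0" using that by (auto simp: lp_norm_def)
    ultimately show ?thesis by (simp add: F_def flip: sum_distrib_left sum_divide_distrib)
  qed
  have F_root: "\<bar>w k\<bar> = real N powr - (1 / p) * lp_norm p N w * F p w k powr (1 / p)"
    if "p > 0" "lp_norm p N w > 0" for p w k
    using that N by (simp add: F_def powr_mult powr_divide powr_powr flip: powr_add)
  have le: "\<bar>x a\<bar> * \<bar>y b\<bar> * \<bar>z c\<bar> \<le> n * L *
      (1 / p1 * F p1 x a + 1 / p2 * F p2 y b + 1 / p3 * F p3 z c + (1 - 1 / p1 - 1 / p2 - 1 / p3))"
    for a b c
  \<comment> \<open>AM-GM was shown for positive numbers, so vanishing entries are settled
    first.\<close>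
  proof (cases "x a = 0 \<or> y b = 0 \<or> z c = 0")
    case True
    then have "\<bar>x a\<bar> * \<bar>y b\<bar> * \<bar>z c\<bar> = 0" by auto
    also have "0 \<le> n * L *
        (1 / p1 * F p1 x a + 1 / p2 * F p2 y b + 1 / p3 * F p3 z c + (1 - 1 / p1 - 1 / p2 - 1 / p3))"
      unfolding n_def L_def using p F0
      by (intro mult_nonneg_nonneg add_nonneg_nonneg lp_norm_ge_0) auto
    finally show ?thesis .
  next
    case False
    then have "F p1 x a > 0" "F p2 y b > 0" "F p3 z c > 0" using N pos by (auto simp: F_def)
    then have "F p1 x a powr (1 / p1) * F p2 y b powr (1 / p2) * F p3 z c powr (1 / p3) \<le>
        1 / p1 * F p1 x a + 1 / p2 * F p2 y b + 1 / p3 * F p3 z c + (1 - 1 / p1 - 1 / p2 - 1 / p3)"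
      using p by (intro weighted_am_gm) auto
    moreover have "n = real N powr - (1 / p1) * real N powr - (1 / p2) * real N powr - (1 / p3)"
      by (simp add: n_def flip: powr_add)
    then have "\<bar>x a\<bar> * \<bar>y b\<bar> * \<bar>z c\<bar> = n * L *
        (F p1 x a powr (1 / p1) * F p2 y b powr (1 / p2) * F p3 z c powr (1 / p3))"
      by (subst F_root[OF p(1) pos(1)], subst F_root[OF p(2) pos(2)], subst F_root[OF p(3) pos(3)])
        (simp add: L_def mult_ac)
    moreover have "0 \<le> n * L" using pos by (simp add: n_def L_def)
    ultimately show ?thesis by (simp add: mult_left_mono)
  qed
  have "(\<Sum>(a, b, c)\<in>M. \<bar>x a\<bar> * \<bar>y b\<bar> * \<bar>z c\<bar>) \<le> (\<Sum>(a, b, c)\<in>M. n * L *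
      (1 / p1 * F p1 x a + 1 / p2 * F p2 y b + 1 / p3 * F p3 z c + (1 - 1 / p1 - 1 / p2 - 1 / p3)))"
    using le by (intro sum_mono) auto
  also have "\<dots> = n * L * (1 / p1 * (\<Sum>(a, b, c)\<in>M. F p1 x a) + 1 / p2 * (\<Sum>(a, b, c)\<in>M. F p2 y b)
      + 1 / p3 * (\<Sum>(a, b, c)\<in>M. F p3 z c) + (1 - 1 / p1 - 1 / p2 - 1 / p3) * card M)"
    by (simp add: case_prod_beta sum.distrib sum_distrib_left mult.assoc distrib_left)
  also have "\<dots> \<le> n * L * (1 / p1 * N + 1 / p2 * N + 1 / p3 * N + (1 - 1 / p1 - 1 / p2 - 1 / p3) * N)"
  proof (intro mult_left_mono add_mono)
    show "(\<Sum>(a, b, c)\<in>M. F p1 x a) \<le> N" "(\<Sum>(a, b, c)\<in>M. F p2 y b) \<le> N"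
      "(\<Sum>(a, b, c)\<in>M. F p3 z c) \<le> N"
      using matching_sum_le[OF M] F0 F_sum p pos by metis+
  qed (use p pos matching_card_le[OF M] in \<open>auto simp: n_def L_def\<close>)
  also have "\<dots> = n * L * N" by (simp add: algebra_simps)
  finally show ?thesis by (simp add: n_def L_def mult_ac)
qed

section \<open>Minkowski's inequality for series\<close>

lemma powr_convex_le:
  fixes a b u v p :: real
  assumes "p \<ge> 1" "u > 0" "v > 0"
  shows "\<bar>a + b\<bar> powr p \<le>
    (u + v) powr p * (u / (u + v) * (\<bar>a\<bar> / u) powr p + v / (u + v) * (\<bar>b\<bar> / v) powr p)"
proof -
  have conv: "((1 - t) * x + t * y) powr p \<le> (1 - t) * x powr p + t * y powr p"
    if "x \<ge> 0" "y \<ge> 0" "0 \<le> t" "t \<le> 1" for x y t :: real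
  proof -
    \<comment> \<open>Settles a zero argument: s^p <= s on [0, 1] for p >= 1.\<close>
    have scaled: "(s * z) powr p \<le> s * z powr p" if "0 \<le> s" "s \<le> 1" for s z :: real
    proof (cases "s = 0")
      case False
      then have "s powr p \<le> s powr 1" using that \<open>p \<ge> 1\<close> by (intro powr_mono') auto
      then show ?thesis using False that by (simp add: powr_mult mult_right_mono)
    qed simp
    have "x = 0 \<or> y = 0 \<or> (x > 0 \<and> y > 0)" using that by linarith
    then consider "x = 0" | "y = 0" | "x > 0" "y > 0" by blast
    then show ?thesis
    proof cases
      case 3
      then show ?thesis
        using convex_onD[OF powr_convex[OF \<open>p \<ge> 1\<close>], of t x y] that by simp
    qed (use scaled[of t y] scaled[of "1 - t" x] that in simp_all)
  qed
  define t where "t = v / (u + v)"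
  have t: "0 \<le> t" "t \<le> 1" "1 - t = u / (u + v)" using assms by (auto simp: t_def field_simps)
  have "\<bar>a\<bar> + \<bar>b\<bar> = (u + v) * ((1 - t) * (\<bar>a\<bar> / u) + t * (\<bar>b\<bar> / v))"
  proof -
    have "(u + v) * (u / (u + v) * (\<bar>a\<bar> / u)) = \<bar>a\<bar>" "(u + v) * (v / (u + v) * (\<bar>b\<bar> / v)) = \<bar>b\<bar>"
      using assms by simp_all
    then show ?thesis unfolding t(3) unfolding t_def distrib_left by linarith
  qed
  moreover have "\<bar>a + b\<bar> powr p \<le> (\<bar>a\<bar> + \<bar>b\<bar>) powr p"
    using assms by (intro powr_mono2) auto
  ultimately have "\<bar>a + b\<bar> powr p \<le> (u + v) powr p * ((1 - t) * (\<bar>a\<bar> / u) + t * (\<bar>b\<bar> / v)) powr p"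
    using assms t by (simp add: powr_mult)
  also have "\<dots> \<le> (u + v) powr p * ((1 - t) * (\<bar>a\<bar> / u) powr p + t * (\<bar>b\<bar> / v) powr p)"
    using assms t by (intro mult_left_mono conv) auto
  finally show ?thesis unfolding t(3) unfolding t_def .
qed

lemma summable_powr_abs_add:
  fixes x y :: "nat \<Rightarrow> real"
  assumes "p \<ge> 1" "summable (\<lambda>k. \<bar>x k\<bar> powr p)" "summable (\<lambda>k. \<bar>y k\<bar> powr p)"
  shows "summable (\<lambda>k. \<bar>x k + y k\<bar> powr p)"
proof (rule summable_comparison_test')
  show "summable (\<lambda>k. 2 powr p * (1 / 2 * \<bar>x k\<bar> powr p + 1 / 2 * \<bar>y k\<bar> powr p))"
    by (intro summable_mult summable_add assms)
  show "norm (\<bar>x k + y k\<bar> powr p) \<le> 2 powr p * (1 / 2 * \<bar>x k\<bar> powr p + 1 / 2 * \<bar>y k\<bar> powr p)" for k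
    using powr_convex_le[of p 1 1 "x k" "y k"] assms(1) by simp
qed

text \<open>With u and v the two norms, t^p is convex at the combination of |x_k| / u and |y_k| / v
  with weights u / (u + v) and v / (u + v). Both normalised series sum to 1, so summing over k
  leaves (u + v)^p.\<close>

lemma minkowski_suminf:
  fixes x y :: "nat \<Rightarrow> real"
  assumes p: "p \<ge> 1" and x: "summable (\<lambda>k. \<bar>x k\<bar> powr p)" and y: "summable (\<lambda>k. \<bar>y k\<bar> powr p)"
  shows "(\<Sum>k. \<bar>x k + y k\<bar> powr p) powr (1 / p) \<le>
    (\<Sum>k. \<bar>x k\<bar> powr p) powr (1 / p) + (\<Sum>k. \<bar>y k\<bar> powr p) powr (1 / p)"
proof -
  define u where "u = (\<Sum>k. \<bar>x k\<bar> powr p) powr (1 / p)"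
  define v where "v = (\<Sum>k. \<bar>y k\<bar> powr p) powr (1 / p)"
  have u: "u \<ge> 0" "u powr p = (\<Sum>k. \<bar>x k\<bar> powr p)" and v: "v \<ge> 0" "v powr p = (\<Sum>k. \<bar>y k\<bar> powr p)"
    using p x y by (auto simp: u_def v_def powr_powr suminf_nonneg)
  have zero: "w = (\<lambda>_. 0)" if "summable (\<lambda>k. \<bar>w k\<bar> powr p)" "(\<Sum>k. \<bar>w k\<bar> powr p) = 0" for w :: "nat \<Rightarrow> real"
    using suminf_eq_zero_iff[OF that(1)] that(2) by auto
  have "u = 0 \<or> v = 0 \<or> (u > 0 \<and> v > 0)" using u(1) v(1) by linarith
  then consider "u = 0" | "v = 0" | "u > 0" "v > 0" by blast
  then have "(\<Sum>k. \<bar>x k + y k\<bar> powr p) powr (1 / p) \<le> u + v"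
  proof cases
    case 1
    then have "x = (\<lambda>_. 0)" using zero[OF x, folded u(2)] p by (metis powr_0)
    then show ?thesis using u(1) by (simp add: v_def)
  next
    case 2
    then have "y = (\<lambda>_. 0)" using zero[OF y, folded v(2)] p by (metis powr_0)
    then show ?thesis using v(1) by (simp add: u_def)
  next
    case 3
    let ?g = "\<lambda>k. (u + v) powr p * (u / (u + v) * (\<bar>x k\<bar> powr p / u powr p) + v / (u + v) * (\<bar>y k\<bar> powr p / v powr p))"
    have g: "?g sums ((u + v) powr p * (u / (u + v) * (u powr p / u powr p) + v / (u + v) * (v powr p / v powr p)))"
      unfolding u(2) v(2) using x y
      by (intro sums_mult sums_add sums_divide summable_sums)
    have "(\<Sum>k. \<bar>x k + y k\<bar> powr p) \<le> (\<Sum>k. ?g k)"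
    proof (intro suminf_le summable_powr_abs_add p x y sums_summable[OF g])
      fix k
      show "\<bar>x k + y k\<bar> powr p \<le> ?g k"
        using powr_convex_le[of p u v "x k" "y k"] p 3 by (simp add: powr_divide)
    qed
    also have "\<dots> = (u + v) powr p"
      using sums_unique[OF g] 3 by (simp flip: add_divide_distrib)
    finally have "(\<Sum>k. \<bar>x k + y k\<bar> powr p) powr (1 / p) \<le> ((u + v) powr p) powr (1 / p)"
      using p by (intro powr_mono2 suminf_nonneg summable_powr_abs_add x y) auto
    then show ?thesis using p 3 by (simp add: powr_powr)
  qed
  then show ?thesis by (simp add: u_def v_def)
qed

text \<open>The common features of \<open>lp p\<close> and of \<open>lp_fin p n\<close> for N <= n:
  an isometric copy of N-dimensional l_p on the first N coordinates, and restriction to them as a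
  contraction. One argument then serves both claims about cotype.\<close>

locale lp_like = function_space X for X :: "(nat \<Rightarrow> real) nspace" +
  fixes p :: real and N :: nat
  assumes exponent: "p > 1"
    and supported_in: "(\<And>k. k \<ge> N \<Longrightarrow> x k = 0) \<Longrightarrow> x \<in> pts X"
    and norm_supported: "(\<And>k. k \<ge> N \<Longrightarrow> x k = 0) \<Longrightarrow> vnorm X x = lp_norm p N x"
    and norm_restrict: "x \<in> pts X \<Longrightarrow> lp_norm p N x \<le> vnorm X x"

lemma lp_sel [simp]:
  "pts (lp p) = {x. summable (\<lambda>k. \<bar>x k\<bar> powr p)}" "vzero (lp p) = (\<lambda>k. 0)"
  "vadd (lp p) = (\<lambda>x y k. x k + y k)" "vscale (lp p) = (\<lambda>r x k. r * x k)"
  "vnorm (lp p) = (\<lambda>x. (\<Sum>k. \<bar>x k\<bar> powr p) powr (1 / p))"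
  by (simp_all add: lp_def)

lemma lp_fin_sel [simp]:
  "pts (lp_fin p n) = {x. \<forall>k\<ge>n. x k = 0}" "vzero (lp_fin p n) = (\<lambda>k. 0)"
  "vadd (lp_fin p n) = (\<lambda>x y k. x k + y k)" "vscale (lp_fin p n) = (\<lambda>r x k. r * x k)"
  "vnorm (lp_fin p n) = (\<lambda>x. (\<Sum>k<n. \<bar>x k\<bar> powr p) powr (1 / p))"
  by (simp_all add: lp_fin_def)

lemma lp_like_lp:
  assumes "p > 1"
  shows "lp_like (lp p) p N"
proof
  fix x :: "nat \<Rightarrow> real" and r :: real
  assume x: "x \<in> pts (lp p)"
  then show "(\<lambda>k. r * x k) \<in> pts (lp p)"
    by (simp add: abs_mult powr_mult summable_mult)
  show "vnorm (lp p) (\<lambda>k. r * x k) = \<bar>r\<bar> * vnorm (lp p) x"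
    using x assms by (simp add: abs_mult powr_mult suminf_mult powr_powr suminf_nonneg)
  show "lp_norm p N x \<le> vnorm (lp p) x"
    using x assms by (auto simp: lp_norm_def intro!: powr_mono2 sum_le_suminf sum_nonneg)
  fix y assume y: "y \<in> pts (lp p)"
  show "(\<lambda>k. x k + y k) \<in> pts (lp p)"
    using x y assms by (auto intro!: summable_powr_abs_add)
  show "vnorm (lp p) (\<lambda>k. x k + y k) \<le> vnorm (lp p) x + vnorm (lp p) y"
    using x y assms minkowski_suminf[of p x y] by simp
next
  fix x :: "nat \<Rightarrow> real"
  assume *: "\<And>k. k \<ge> N \<Longrightarrow> x k = 0"
  then have "(\<lambda>k. \<bar>x k\<bar> powr p) sums (\<Sum>k<N. \<bar>x k\<bar> powr p)"
    by (intro sums_finite) auto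
  then show "x \<in> pts (lp p)" "vnorm (lp p) x = lp_norm p N x"
    by (auto simp: sums_iff lp_norm_def)
qed (use assms in simp_all)

lemma lp_like_lp_fin:
  assumes "p > 1" "N \<le> n"
  shows "lp_like (lp_fin p n) p N"
proof
  \<comment> \<open>Vectors of the finite space are functions vanishing from n on, hence already
    points of \<open>lp p\<close> with the same norm; the triangle inequality is inherited.\<close>
  have as_lp: "x \<in> pts (lp p) \<and> vnorm (lp p) x = vnorm (lp_fin p n) x" if "x \<in> pts (lp_fin p n)" for x
    using lp_like.supported_in[OF lp_like_lp[OF assms(1)], of n x] that
      lp_like.norm_supported[OF lp_like_lp[OF assms(1)], of n x] by (simp add: lp_norm_def)
  interpret lp: lp_like "lp p" p N by (rule lp_like_lp[OF assms(1)])
  fix x :: "nat \<Rightarrow> real" and r :: real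
  assume x: "x \<in> pts (lp_fin p n)"
  then show scale: "(\<lambda>k. r * x k) \<in> pts (lp_fin p n)" by simp
  show "vnorm (lp_fin p n) (\<lambda>k. r * x k) = \<bar>r\<bar> * vnorm (lp_fin p n) x"
    using as_lp[OF x] as_lp[OF scale] lp.norm_scale[of x r] by metis
  show "lp_norm p N x \<le> vnorm (lp_fin p n) x"
    using as_lp[OF x] lp.norm_restrict[of x] by metis
  fix y assume y: "y \<in> pts (lp_fin p n)"
  show add: "(\<lambda>k. x k + y k) \<in> pts (lp_fin p n)"
    using x y by simp
  show "vnorm (lp_fin p n) (\<lambda>k. x k + y k) \<le> vnorm (lp_fin p n) x + vnorm (lp_fin p n) y"
    using as_lp[OF x] as_lp[OF y] as_lp[OF add] lp.norm_add[of x y] by metis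
next
  fix x :: "nat \<Rightarrow> real"
  assume *: "\<And>k. k \<ge> N \<Longrightarrow> x k = 0"
  then show "x \<in> pts (lp_fin p n)" using assms by auto
  have "(\<Sum>k<n. \<bar>x k\<bar> powr p) = (\<Sum>k<N. \<bar>x k\<bar> powr p)"
    using assms * by (intro sum.mono_neutral_right) auto
  then show "vnorm (lp_fin p n) x = lp_norm p N x" by (simp add: lp_norm_def)
qed (use assms in \<open>simp_all\<close>)

lemma lp_norm_le_sup:
  assumes "p > 0" "\<And>k. k < N \<Longrightarrow> \<bar>x k\<bar> \<le> 1"
  shows "lp_norm p N x \<le> real N powr (1 / p)"
proof -
  have "(\<Sum>k<N. \<bar>x k\<bar> powr p) \<le> (\<Sum>k<N. 1)"
    using assms by (intro sum_mono powr_le1) auto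
  then show ?thesis using assms unfolding lp_norm_def
    by (intro powr_mono2) (auto intro!: sum_nonneg)
qed

section \<open>The projective norm of coefficient arrays\<close>

definition unit_vec :: "nat \<Rightarrow> nat \<Rightarrow> real" where
  "unit_vec a = (\<lambda>k. if k = a then 1 else 0)"

definition truncate :: "nat \<Rightarrow> (nat \<Rightarrow> real) \<Rightarrow> nat \<Rightarrow> real" where
  "truncate n f = (\<lambda>k. if k < n then f k else 0)"

context lp_like
begin

lemma unit_vec_in: "a < N \<Longrightarrow> unit_vec a \<in> pts X"
  by (rule supported_in) (simp add: unit_vec_def)

lemma truncate_in: "n \<le> N \<Longrightarrow> truncate n f \<in> pts X"
  by (rule supported_in) (simp add: truncate_def)

lemma norm_truncate: "vnorm X (truncate N f) = lp_norm p N f"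
  by (subst norm_supported) (simp_all add: truncate_def lp_norm_def)

lemma linear_expand:
  fixes L :: "(nat \<Rightarrow> real) \<Rightarrow> real"
  assumes L_add: "\<And>x y. x \<in> pts X \<Longrightarrow> y \<in> pts X \<Longrightarrow> L (\<lambda>k. x k + y k) = L x + L y"
    and L_scale: "\<And>r x. x \<in> pts X \<Longrightarrow> L (\<lambda>k. r * x k) = r * L x"
  shows "L (truncate N f) = (\<Sum>a<N. f a * L (unit_vec a))"
proof -
  have "L (truncate n f) = (\<Sum>a<n. f a * L (unit_vec a))" if "n \<le> N" for n
    using that
  proof (induction n)
    case 0
    then show ?case using L_scale[OF zero_in, of 0] by (simp add: truncate_def)
  next
    case (Suc n)
    have "truncate (Suc n) f = (\<lambda>k. truncate n f k + f n * unit_vec n k)"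
      by (auto simp: truncate_def unit_vec_def less_Suc_eq)
    then have "L (truncate (Suc n) f) = L (truncate n f) + f n * L (unit_vec n)"
      using Suc.prems by (simp add: L_add L_scale truncate_in unit_vec_in scale_in)
    then show ?case using Suc by simp
  qed
  then show ?thesis by simp
qed

end

lemma elem_tensor_linear:
  "x \<in> pts X \<Longrightarrow> x' \<in> pts X \<Longrightarrow> y \<in> pts Y \<Longrightarrow>
    elem_tensor X Y (vadd X x x') y = (\<lambda>\<beta>. elem_tensor X Y x y \<beta> + elem_tensor X Y x' y \<beta>)"
  "x \<in> pts X \<Longrightarrow> y \<in> pts Y \<Longrightarrow> y' \<in> pts Y \<Longrightarrow>
    elem_tensor X Y x (vadd Y y y') = (\<lambda>\<beta>. elem_tensor X Y x y \<beta> + elem_tensor X Y x y' \<beta>)"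
  "x \<in> pts X \<Longrightarrow> y \<in> pts Y \<Longrightarrow>
    elem_tensor X Y (vscale X r x) y = (\<lambda>\<beta>. r * elem_tensor X Y x y \<beta>)"
  "x \<in> pts X \<Longrightarrow> y \<in> pts Y \<Longrightarrow>
    elem_tensor X Y x (vscale Y r y) = (\<lambda>\<beta>. r * elem_tensor X Y x y \<beta>)"
  by (auto simp: elem_tensor_def bilinear_formD)

text \<open>A seminorm on the coefficient arrays of size \<open>N \<times> N \<times> N\<close>, scaled so that products of sign
  vectors have norm at most 1; this is all the combinatorial part needs to know about the tensor norm.\<close>

locale tensor_seminorm =
  fixes N :: nat and P :: "(nat \<Rightarrow> nat \<Rightarrow> nat \<Rightarrow> real) \<Rightarrow> real"
  assumes P_cong: "(\<And>a b c. a < N \<Longrightarrow> b < N \<Longrightarrow> c < N \<Longrightarrow> s a b c = t a b c) \<Longrightarrow> P s = P t"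
    and P_add: "P (\<lambda>a b c. s a b c + t a b c) \<le> P s + P t"
    and P_scale: "P (\<lambda>a b c. r * t a b c) = \<bar>r\<bar> * P t"
    and P_product: "(\<And>k. k < N \<Longrightarrow> \<bar>f k\<bar> \<le> 1 \<and> \<bar>g k\<bar> \<le> 1 \<and> \<bar>h k\<bar> \<le> 1) \<Longrightarrow>
      P (\<lambda>a b c. f a * g b * h c) \<le> 1"
    and P_matching: "matching N M \<Longrightarrow> (\<Sum>(a, b, c)\<in>M. t a b c) \<le> N * P t"

locale tensor_triple = A: lp_like X p1 N + B: lp_like Y p2 N + C: lp_like Z p3 N
  for X Y Z p1 p2 p3 N +
  assumes exponents: "1 / p1 + 1 / p2 + 1 / p3 \<le> 1"
    and N_pos: "N > 0"
begin

sublocale XY: homogeneous_pair X Y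
  by unfold_locales (rule A.homogeneous B.homogeneous)+

sublocale XYZ: homogeneous_pair "X \<otimes>\<^sub>\<pi> Y" Z
  by unfold_locales (rule XY.homogeneous_proj_tensor C.homogeneous)+

definition tensor3 :: "(nat \<Rightarrow> real) \<Rightarrow> (nat \<Rightarrow> real) \<Rightarrow> (nat \<Rightarrow> real) \<Rightarrow>
    ((nat \<Rightarrow> (nat \<Rightarrow> real, nat \<Rightarrow> real) tens) set, nat \<Rightarrow> real) tens" where
  "tensor3 x y z = elem_tensor (X \<otimes>\<^sub>\<pi> Y) Z (XY.T.emb (elem_tensor X Y x y)) z"

definition of_array :: "(nat \<Rightarrow> nat \<Rightarrow> nat \<Rightarrow> real) \<Rightarrow>
    ((nat \<Rightarrow> (nat \<Rightarrow> real, nat \<Rightarrow> real) tens) set, nat \<Rightarrow> real) tens" where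
  "of_array t = (\<lambda>\<beta>. \<Sum>a<N. \<Sum>b<N. \<Sum>c<N.
     t a b c * tensor3 (unit_vec a) (unit_vec b) (unit_vec c) \<beta>)"

text \<open>The norm before the last completion, which \<open>emb\<close> preserves. The factor is
  the reciprocal of the product of the norms of three sign vectors of length N and removes the
  exponents from all later bounds.\<close>

definition array_norm :: "(nat \<Rightarrow> nat \<Rightarrow> nat \<Rightarrow> real) \<Rightarrow> real" where
  "array_norm t = real N powr - (1 / p1 + 1 / p2 + 1 / p3) *
     vnorm (alg_tensor (X \<otimes>\<^sub>\<pi> Y) Z) (of_array t)"

lemma emb_elem_in:
  assumes "x \<in> pts X" "y \<in> pts Y"
  shows "XY.T.emb (elem_tensor X Y x y) \<in> pts (X \<otimes>\<^sub>\<pi> Y)"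
    and "vnorm (X \<otimes>\<^sub>\<pi> Y) (XY.T.emb (elem_tensor X Y x y)) \<le> vnorm X x * vnorm Y y"
  using XY.elem_tensor_in[OF assms]
  by (simp_all add: proj_tensor_def XY.T.emb_in XY.T.norm_emb)

lemma tensor3_in:
  assumes "x \<in> pts X" "y \<in> pts Y" "z \<in> pts Z"
  shows "tensor3 x y z \<in> pts (alg_tensor (X \<otimes>\<^sub>\<pi> Y) Z)"
    and "vnorm (alg_tensor (X \<otimes>\<^sub>\<pi> Y) Z) (tensor3 x y z) \<le> vnorm X x * vnorm Y y * vnorm Z z"
  unfolding tensor3_def
  using XYZ.elem_tensor_in[OF emb_elem_in(1)[OF assms(1,2)] assms(3)]
    mult_right_mono[OF emb_elem_in(2)[OF assms(1,2)] C.norm_ge_0[OF assms(3)]] by auto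

lemma tensor3_unit_in:
  "a < N \<Longrightarrow> b < N \<Longrightarrow> c < N \<Longrightarrow>
    tensor3 (unit_vec a) (unit_vec b) (unit_vec c) \<in> pts (alg_tensor (X \<otimes>\<^sub>\<pi> Y) Z)"
  by (intro tensor3_in A.unit_vec_in B.unit_vec_in C.unit_vec_in)

lemma of_array_in: "of_array t \<in> pts (alg_tensor (X \<otimes>\<^sub>\<pi> Y) Z)"
  unfolding of_array_def
  by (intro XYZ.T.sum_in XYZ.T.scale_in tensor3_unit_in) auto

lemma tensor3_linear:
  assumes "x \<in> pts X" "x' \<in> pts X" "y \<in> pts Y" "y' \<in> pts Y" "z \<in> pts Z" "z' \<in> pts Z"
  shows "tensor3 (\<lambda>k. x k + x' k) y z \<beta> = tensor3 x y z \<beta> + tensor3 x' y z \<beta>"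
    and "tensor3 x (\<lambda>k. y k + y' k) z \<beta> = tensor3 x y z \<beta> + tensor3 x y' z \<beta>"
    and "tensor3 x y (\<lambda>k. z k + z' k) \<beta> = tensor3 x y z \<beta> + tensor3 x y z' \<beta>"
    and "tensor3 (\<lambda>k. r * x k) y z \<beta> = r * tensor3 x y z \<beta>"
    and "tensor3 x (\<lambda>k. r * y k) z \<beta> = r * tensor3 x y z \<beta>"
    and "tensor3 x y (\<lambda>k. r * z k) \<beta> = r * tensor3 x y z \<beta>"
proof -
  note el = assms XY.elem_tensor_in(1) emb_elem_in(1)
  have lin: "elem_tensor X Y (\<lambda>k. x k + x' k) y = (\<lambda>\<beta>. elem_tensor X Y x y \<beta> + elem_tensor X Y x' y \<beta>)"
    "elem_tensor X Y x (\<lambda>k. y k + y' k) = (\<lambda>\<beta>. elem_tensor X Y x y \<beta> + elem_tensor X Y x y' \<beta>)"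
    "elem_tensor X Y (\<lambda>k. r * x k) y = (\<lambda>\<beta>. r * elem_tensor X Y x y \<beta>)"
    "elem_tensor X Y x (\<lambda>k. r * y k) = (\<lambda>\<beta>. r * elem_tensor X Y x y \<beta>)"
    using elem_tensor_linear(1)[OF assms(1-3)] elem_tensor_linear(2)[OF assms(1,3,4)]
      elem_tensor_linear(3,4)[OF assms(1,3)] by simp_all
  have emb: "XY.T.emb (elem_tensor X Y (\<lambda>k. x k + x' k) y) =
      vadd (X \<otimes>\<^sub>\<pi> Y) (XY.T.emb (elem_tensor X Y x y)) (XY.T.emb (elem_tensor X Y x' y))"
    "XY.T.emb (elem_tensor X Y x (\<lambda>k. y k + y' k)) =
      vadd (X \<otimes>\<^sub>\<pi> Y) (XY.T.emb (elem_tensor X Y x y)) (XY.T.emb (elem_tensor X Y x y'))"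
    "XY.T.emb (elem_tensor X Y (\<lambda>k. r * x k) y) = vscale (X \<otimes>\<^sub>\<pi> Y) r (XY.T.emb (elem_tensor X Y x y))"
    "XY.T.emb (elem_tensor X Y x (\<lambda>k. r * y k)) = vscale (X \<otimes>\<^sub>\<pi> Y) r (XY.T.emb (elem_tensor X Y x y))"
    unfolding lin proj_tensor_def using assms
    by (simp_all add: XY.T.vadd_emb XY.T.vscale_emb XY.elem_tensor_in)
  have Z: "(\<lambda>k. z k + z' k) = vadd Z z z'" "(\<lambda>k. r * z k) = vscale Z r z" by simp_all
  show "tensor3 (\<lambda>k. x k + x' k) y z \<beta> = tensor3 x y z \<beta> + tensor3 x' y z \<beta>"
    "tensor3 x (\<lambda>k. y k + y' k) z \<beta> = tensor3 x y z \<beta> + tensor3 x y' z \<beta>"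
    "tensor3 x y (\<lambda>k. z k + z' k) \<beta> = tensor3 x y z \<beta> + tensor3 x y z' \<beta>"
    "tensor3 (\<lambda>k. r * x k) y z \<beta> = r * tensor3 x y z \<beta>"
    "tensor3 x (\<lambda>k. r * y k) z \<beta> = r * tensor3 x y z \<beta>"
    "tensor3 x y (\<lambda>k. r * z k) \<beta> = r * tensor3 x y z \<beta>"
    unfolding tensor3_def emb unfolding Z using assms
    by (simp_all only: elem_tensor_linear emb_elem_in)
qed

lemma of_array_product:
  "of_array (\<lambda>a b c. f a * g b * h c) = tensor3 (truncate N f) (truncate N g) (truncate N h)"
proof
  fix \<beta>
  note tr = A.truncate_in[OF order_refl] B.truncate_in[OF order_refl] C.truncate_in[OF order_refl]
  have "tensor3 (truncate N f) (truncate N g) (truncate N h) \<beta> =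
      (\<Sum>a<N. f a * tensor3 (unit_vec a) (truncate N g) (truncate N h) \<beta>)"
    by (rule A.linear_expand) (rule tensor3_linear(1)[OF _ _ tr(2,2,3,3)] tensor3_linear(4)[OF _ A.zero_in tr(2,2,3,3)],
        assumption+)+
  also have "\<dots> = (\<Sum>a<N. f a * (\<Sum>b<N. g b * tensor3 (unit_vec a) (unit_vec b) (truncate N h) \<beta>))"
  proof (intro sum.cong refl arg_cong2[where f = "(*)"])
    fix a assume "a \<in> {..<N}"
    then have a: "unit_vec a \<in> pts X" by (simp add: A.unit_vec_in)
    show "tensor3 (unit_vec a) (truncate N g) (truncate N h) \<beta> =
        (\<Sum>b<N. g b * tensor3 (unit_vec a) (unit_vec b) (truncate N h) \<beta>)"
      by (rule B.linear_expand) (rule tensor3_linear(2)[OF a a _ _ tr(3,3)]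
          tensor3_linear(5)[OF a a _ B.zero_in tr(3,3)], assumption+)+
  qed
  also have "\<dots> = (\<Sum>a<N. f a * (\<Sum>b<N. g b *
      (\<Sum>c<N. h c * tensor3 (unit_vec a) (unit_vec b) (unit_vec c) \<beta>)))"
  proof (intro sum.cong refl arg_cong2[where f = "(*)"])
    fix a b assume "a \<in> {..<N}" "b \<in> {..<N}"
    then have ab: "unit_vec a \<in> pts X" "unit_vec b \<in> pts Y"
      by (simp_all add: A.unit_vec_in B.unit_vec_in)
    show "tensor3 (unit_vec a) (unit_vec b) (truncate N h) \<beta> =
        (\<Sum>c<N. h c * tensor3 (unit_vec a) (unit_vec b) (unit_vec c) \<beta>)"
      by (rule C.linear_expand) (rule tensor3_linear(3)[OF ab(1,1,2,2)]
          tensor3_linear(6)[OF ab(1,1,2,2) _ C.zero_in], assumption+)+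
  qed
  finally show "of_array (\<lambda>a b c. f a * g b * h c) \<beta> =
      tensor3 (truncate N f) (truncate N g) (truncate N h) \<beta>"
    by (simp add: of_array_def sum_distrib_left mult_ac)
qed

text \<open>The sum over M is the value at the array of one test form, namely the extension of the
  trilinear form that sums x_a y_b z_c over M. Hoelder on the matching bounds that form.\<close>

lemma matching_le_norm:
  assumes M: "matching N M"
  shows "(\<Sum>(a, b, c)\<in>M. t a b c) \<le> N * array_norm t"
proof -
  define T where "T x y z = (\<Sum>(a, b, c)\<in>M. x a * y b * z c)" for x y z :: "nat \<Rightarrow> real"
  define K where "K = N * real N powr - (1 / p1 + 1 / p2 + 1 / p3)"
  have K: "K \<ge> 0" by (simp add: K_def)
  have bound: "\<bar>T x y z\<bar> \<le> K * (vnorm X x * vnorm Y y * vnorm Z z)"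
    if "x \<in> pts X" "y \<in> pts Y" "z \<in> pts Z" for x y z
  proof -
    have "\<bar>T x y z\<bar> \<le> (\<Sum>(a, b, c)\<in>M. \<bar>x a\<bar> * \<bar>y b\<bar> * \<bar>z c\<bar>)"
      unfolding T_def by (rule order.trans[OF sum_abs]) (auto simp: case_prod_beta abs_mult)
    also have "\<dots> \<le> K * (lp_norm p1 N x * lp_norm p2 N y * lp_norm p3 N z)"
      unfolding K_def using A.exponent B.exponent C.exponent exponents
      by (intro matching_hoelder M) auto
    also have "\<dots> \<le> K * (vnorm X x * vnorm Y y * vnorm Z z)"
      using that by (intro mult_left_mono[OF _ K] mult_mono A.norm_restrict B.norm_restrict
        C.norm_restrict lp_norm_ge_0 mult_nonneg_nonneg A.norm_ge_0 B.norm_ge_0)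
    finally show ?thesis .
  qed
  have bil: "bilinear_form X Y (\<lambda>x y. T x y z)" for z
    by (simp add: bilinear_form_def T_def case_prod_beta sum_distrib_left algebra_simps
      flip: sum.distrib)
  obtain \<beta> where \<beta>: "bilinear_form (X \<otimes>\<^sub>\<pi> Y) Z \<beta>"
    "\<And>A z. A \<in> pts (X \<otimes>\<^sub>\<pi> Y) \<Longrightarrow> z \<in> pts Z \<Longrightarrow> \<bar>\<beta> A z\<bar> \<le> K * (vnorm (X \<otimes>\<^sub>\<pi> Y) A * vnorm Z z)"
    "\<And>x y z. x \<in> pts X \<Longrightarrow> y \<in> pts Y \<Longrightarrow> z \<in> pts Z \<Longrightarrow>
      \<beta> (XY.T.emb (elem_tensor X Y x y)) z = T x y z"
    by (rule XY.extend_trilinear[of Z T K, OF bil _ _ C.homogeneous _ bound K])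
      (auto simp: T_def case_prod_beta sum_distrib_left algebra_simps simp flip: sum.distrib)
  have "of_array t \<beta> = (\<Sum>a<N. \<Sum>b<N. \<Sum>c<N. t a b c * T (unit_vec a) (unit_vec b) (unit_vec c))"
    unfolding of_array_def tensor3_def using \<beta>(1,3)
    by (intro sum.cong refl) (simp add: elem_tensor_def A.unit_vec_in B.unit_vec_in C.unit_vec_in)
  also have "\<dots> = (\<Sum>a<N. \<Sum>b<N. \<Sum>c<N. t a b c * (if (a, b, c) \<in> M then 1 else 0))"
  proof (intro sum.cong refl arg_cong2[where f = "(*)"])
    fix a b c
    have "T (unit_vec a) (unit_vec b) (unit_vec c) = (\<Sum>m\<in>M. if m = (a, b, c) then 1 else 0)"
      unfolding T_def by (intro sum.cong refl) (auto simp: unit_vec_def split: if_splits)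
    then show "T (unit_vec a) (unit_vec b) (unit_vec c) = (if (a, b, c) \<in> M then 1 else 0)"
      using matching_finite[OF M] by simp
  qed
  also have "\<dots> = (\<Sum>m\<in>{..<N} \<times> {..<N} \<times> {..<N}. if m \<in> M then (case m of (a, b, c) \<Rightarrow> t a b c) else 0)"
    by (simp add: sum.cartesian_product case_prod_beta) (intro sum.cong, auto)
  also have "\<dots> = (\<Sum>(a, b, c)\<in>M. t a b c)"
    using M by (subst sum.inter_restrict[symmetric]) (auto simp: matching_def Int_absorb1)
  finally have "(\<Sum>(a, b, c)\<in>M. t a b c) \<le> \<bar>of_array t \<beta>\<bar>" by simp
  also have "\<dots> \<le> K * vnorm (alg_tensor (X \<otimes>\<^sub>\<pi> Y) Z) (of_array t)"
    by (rule XYZ.tensor_apply_bound[OF of_array_in \<beta>(1) \<beta>(2) K])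
  finally show ?thesis by (simp add: K_def array_norm_def mult.assoc)
qed

lemma tensor_seminorm: "tensor_seminorm N array_norm"
proof
  show "array_norm s = array_norm t"
    if "\<And>a b c. a < N \<Longrightarrow> b < N \<Longrightarrow> c < N \<Longrightarrow> s a b c = t a b c" for s t
    using that by (simp add: array_norm_def of_array_def)
  show "array_norm (\<lambda>a b c. s a b c + t a b c) \<le> array_norm s + array_norm t" for s t
    using XYZ.T.norm_add[OF of_array_in of_array_in, of s t]
    unfolding array_norm_def distrib_left[symmetric]
    by (intro mult_left_mono) (simp_all add: of_array_def sum.distrib distrib_right)
  show "array_norm (\<lambda>a b c. r * t a b c) = \<bar>r\<bar> * array_norm t" for r t
    using XYZ.T.norm_scale[OF of_array_in, of r t]
    by (simp add: array_norm_def of_array_def sum_distrib_left mult_ac)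
  show "array_norm (\<lambda>a b c. f a * g b * h c) \<le> 1"
    if "\<And>k. k < N \<Longrightarrow> \<bar>f k\<bar> \<le> 1 \<and> \<bar>g k\<bar> \<le> 1 \<and> \<bar>h k\<bar> \<le> 1" for f g h
  proof -
    have "array_norm (\<lambda>a b c. f a * g b * h c) \<le> real N powr - (1 / p1 + 1 / p2 + 1 / p3) *
        (lp_norm p1 N f * lp_norm p2 N g * lp_norm p3 N h)"
      unfolding array_norm_def of_array_product
      using tensor3_in(2)[OF A.truncate_in B.truncate_in C.truncate_in, OF order_refl order_refl order_refl]
      by (intro mult_left_mono) (auto simp: A.norm_truncate B.norm_truncate C.norm_truncate)
    also have "\<dots> \<le> real N powr - (1 / p1 + 1 / p2 + 1 / p3) *
        (real N powr (1 / p1) * real N powr (1 / p2) * real N powr (1 / p3))"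
      using that A.exponent B.exponent C.exponent
      by (intro mult_left_mono mult_mono lp_norm_le_sup lp_norm_ge_0 mult_nonneg_nonneg) auto
    also have "\<dots> = 1" using N_pos by (simp flip: powr_add)
    finally show ?thesis .
  qed
  show "(\<Sum>(a, b, c)\<in>M. t a b c) \<le> N * array_norm t" if "matching N M" for M t
    by (rule matching_le_norm[OF that])
qed

text \<open>The mean square over the signs is estimated by the uniform bound. The factor s between
  tensor norm and \<open>array_norm\<close> appears on both sides and cancels.\<close>

lemma cotype_ineq_array:
  assumes cotype: "cotype_ineq q (X \<otimes>\<^sub>\<pi> Y \<otimes>\<^sub>\<pi> Z) C" and q: "q > 0" and C: "C > 0"
    and upper: "\<And>\<epsilon>. (\<And>i. i < k \<Longrightarrow> \<epsilon> i = 1 \<or> \<epsilon> i = -1) \<Longrightarrow>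
      array_norm (\<lambda>a b c. \<Sum>i<k. \<epsilon> i * t i a b c) \<le> K"
    and lower: "\<And>i. i < k \<Longrightarrow> \<delta> \<le> array_norm (t i)" and \<delta>: "\<delta> \<ge> 0" and K: "K \<ge> 0"
  shows "real k powr (1 / q) * \<delta> \<le> C * K"
proof -
  let ?V = "X \<otimes>\<^sub>\<pi> Y \<otimes>\<^sub>\<pi> Z" and ?n = "vnorm (alg_tensor (X \<otimes>\<^sub>\<pi> Y) Z)"
  let ?E = "{..<k} \<rightarrow>\<^sub>E {-1, 1 :: real}"
  define s where "s = real N powr (1 / p1 + 1 / p2 + 1 / p3)"
  have s: "s > 0" using N_pos by (simp add: s_def)
  have norm_eq: "?n (of_array t) = s * array_norm t" for t
    using N_pos by (simp add: s_def array_norm_def mult.assoc[symmetric] flip: powr_add)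
  define v where "v i = XYZ.T.emb (of_array (t i))" for i
  have v: "v i \<in> pts ?V" "vnorm ?V (v i) = s * array_norm (t i)" for i
    using of_array_in by (auto simp: v_def proj_tensor_def[of "X \<otimes>\<^sub>\<pi> Y"] XYZ.T.emb_in XYZ.T.norm_emb norm_eq)
  have sum_norm: "(vnorm ?V (vsum ?V (\<lambda>i. vscale ?V (\<epsilon> i) (v i)) k))\<^sup>2 \<le> (s * K)\<^sup>2"
    if "\<epsilon> \<in> ?E" for \<epsilon>
  proof -
    have "vsum ?V (\<lambda>i. vscale ?V (\<epsilon> i) (v i)) k =
        vsum ?V (\<lambda>i. XYZ.T.emb (\<lambda>\<beta>. \<epsilon> i * of_array (t i) \<beta>)) k"
      using of_array_in by (simp add: v_def proj_tensor_def[of "X \<otimes>\<^sub>\<pi> Y"] XYZ.T.vscale_emb)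
    also have "\<dots> = XYZ.T.emb (\<lambda>\<beta>. \<Sum>i<k. \<epsilon> i * of_array (t i) \<beta>)"
      unfolding proj_tensor_def[of "X \<otimes>\<^sub>\<pi> Y"] by (intro XYZ.T.vsum_emb XYZ.T.scale_in of_array_in)
    also have "(\<lambda>\<beta>. \<Sum>i<k. \<epsilon> i * of_array (t i) \<beta>) = of_array (\<lambda>a b c. \<Sum>i<k. \<epsilon> i * t i a b c)"
    proof
      fix \<beta>
      show "(\<Sum>i<k. \<epsilon> i * of_array (t i) \<beta>) = of_array (\<lambda>a b c. \<Sum>i<k. \<epsilon> i * t i a b c) \<beta>"
        by (simp add: of_array_def sum_distrib_left sum_distrib_right mult.assoc
          sum.swap[of _ "{..<N}" "{..<k}"])
    qed
    finally have "vnorm ?V (vsum ?V (\<lambda>i. vscale ?V (\<epsilon> i) (v i)) k) =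
        ?n (of_array (\<lambda>a b c. \<Sum>i<k. \<epsilon> i * t i a b c))"
      using of_array_in by (simp add: proj_tensor_def[of "X \<otimes>\<^sub>\<pi> Y"] XYZ.T.norm_emb)
    moreover have "0 \<le> ?n (of_array (\<lambda>a b c. \<Sum>i<k. \<epsilon> i * t i a b c))"
      by (intro XYZ.T.norm_ge_0 of_array_in)
    moreover have "array_norm (\<lambda>a b c. \<Sum>i<k. \<epsilon> i * t i a b c) \<le> K"
      by (rule upper) (use that in auto)
    ultimately show ?thesis using s by (simp add: norm_eq power_mono)
  qed
  have E: "finite ?E" "?E \<noteq> {}" by (auto intro: finite_PiE simp: PiE_eq_empty_iff)
  have "measure_pmf.expectation (pmf_of_set ?E)
      (\<lambda>\<epsilon>. (vnorm ?V (vsum ?V (\<lambda>i. vscale ?V (\<epsilon> i) (v i)) k))\<^sup>2) \<le> (s * K)\<^sup>2"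
  proof -
    have "(\<Sum>\<epsilon>\<in>?E. (vnorm ?V (vsum ?V (\<lambda>i. vscale ?V (\<epsilon> i) (v i)) k))\<^sup>2) \<le> (\<Sum>\<epsilon>\<in>?E. (s * K)\<^sup>2)"
      by (intro sum_mono sum_norm)
    then show ?thesis using E
      by (simp add: integral_pmf_of_set pos_divide_le_eq card_gt_0_iff mult.commute)
  qed
  then have rhs: "sqrt (measure_pmf.expectation (pmf_of_set ?E)
      (\<lambda>\<epsilon>. (vnorm ?V (vsum ?V (\<lambda>i. vscale ?V (\<epsilon> i) (v i)) k))\<^sup>2)) \<le> s * K"
    using s K by (intro real_le_lsqrt) auto
  have "real k powr (1 / q) * (s * \<delta>) = (\<Sum>i<k. (s * \<delta>) powr q) powr (1 / q)"
    using s \<delta> q by (simp add: powr_mult powr_powr)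
  also have "\<dots> \<le> (\<Sum>i<k. vnorm ?V (v i) powr q) powr (1 / q)"
    unfolding v using s \<delta> q lower
    by (intro powr_mono2 sum_mono sum_nonneg mult_left_mono) auto
  also have "\<dots> \<le> C * sqrt (measure_pmf.expectation (pmf_of_set ?E)
      (\<lambda>\<epsilon>. (vnorm ?V (vsum ?V (\<lambda>i. vscale ?V (\<epsilon> i) (v i)) k))\<^sup>2))"
    using cotype v(1) unfolding cotype_ineq_def by blast
  also have "\<dots> \<le> C * (s * K)" using rhs C by (intro mult_left_mono) auto
  finally show ?thesis using s by (simp add: mult.left_commute)
qed

end

section \<open>A three-query code from matching vectors\<close>

lemma prime_dvd_choose_prime_power:
  fixes p :: nat
  assumes "prime p" "0 < k" "k < p ^ e"
  shows "p dvd (p ^ e choose k)"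
proof (rule ccontr)
  assume "\<not> p dvd (p ^ e choose k)"
  then have "coprime (p ^ e) (p ^ e choose k)"
    using assms(1) by (simp add: prime_imp_coprime)
  \<comment> \<open>From k C(q, k) = q C(q - 1, k - 1) with q = p^e.\<close>
  moreover have "p ^ e dvd k * (p ^ e choose k)"
    using times_binomial_minus1_eq[OF assms(2), of "p ^ e"] by simp
  ultimately have "p ^ e dvd k" using coprime_dvd_mult_left_iff by blast
  with assms show False by (auto dest: dvd_imp_le)
qed

text \<open>In Vandermonde's sum of C(p^e, k) C(a, j - k) only k = 0 survives modulo p, because 0 <
  k <= j < p^e makes the first factor divisible by p.\<close>

lemma choose_prime_power_periodic:
  fixes p :: nat
  assumes p: "prime p" and j: "j < p ^ e"
  shows "((p ^ e + a) choose j) mod p = (a choose j) mod p"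
proof -
  have "((p ^ e + a) choose j) = (\<Sum>k\<le>j. (p ^ e choose k) * (a choose (j - k)))"
    by (rule vandermonde[symmetric])
  also have "\<dots> = (a choose j) + (\<Sum>k\<in>{..j} - {0}. (p ^ e choose k) * (a choose (j - k)))"
    by (subst sum.remove[of _ 0]) auto
  finally have "((p ^ e + a) choose j) =
    (a choose j) + (\<Sum>k\<in>{..j} - {0}. (p ^ e choose k) * (a choose (j - k)))" .
  moreover have "p dvd (\<Sum>k\<in>{..j} - {0}. (p ^ e choose k) * (a choose (j - k)))"
    using assms by (intro dvd_sum dvd_mult2 prime_dvd_choose_prime_power) auto
  ultimately show ?thesis by (auto elim!: dvdE)
qed

text \<open>Periodicity replaces a by its residue r < q = p^e, and C(r, q - 1) is 1 at r = q - 1 and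
  0 below.\<close>

lemma choose_prime_power_minus_one_mod:
  fixes p :: nat
  assumes p: "prime p"
  shows "(a choose (p ^ e - 1)) mod p = (if a mod p ^ e = p ^ e - 1 then 1 else 0)"
proof -
  let ?q = "p ^ e"
  have q: "?q > 0" "?q - 1 < ?q" using p prime_gt_0_nat by simp_all
  have "((?q * n + r) choose (?q - 1)) mod p = (r choose (?q - 1)) mod p" for n r
    by (induction n) (simp_all add: choose_prime_power_periodic[OF p q(2)] add.assoc del: One_nat_def)
  from this[of "a div ?q" "a mod ?q"]
  have "(a choose (?q - 1)) mod p = ((a mod ?q) choose (?q - 1)) mod p" by simp
  moreover have "a mod ?q = ?q - 1 \<or> a mod ?q < ?q - 1"
    using mod_less_divisor[OF q(1), of a] by linarith
  ultimately show ?thesis using prime_gt_1_nat[OF p] by (auto simp: binomial_eq_0)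
qed

text \<open>Fermat: 4^33 = 2^66 = 1 modulo 67.\<close>

lemma four_power_mod: "(4::nat) ^ n mod 67 = 4 ^ (n mod 33) mod 67"
proof -
  have "(4::nat) ^ n mod 67 = (4 ^ 33) ^ (n div 33) * 4 ^ (n mod 33) mod 67"
    by (simp only: power_mult[symmetric] power_add[symmetric] mult_div_mod_eq)
  also have "\<dots> = ((4 ^ 33) mod 67) ^ (n div 33) * 4 ^ (n mod 33) mod 67"
    by (metis mod_mult_left_eq power_mod)
  finally show ?thesis by simp
qed

text \<open>Three-term decoding: $20 + 3 X^5 + 44 X^{25}$ over $\mathbb{F}_{67}$ vanishes at $4^0, 4^{22}, 4^{12}$
  and equals 1 at 4, an element of order 33.  Here 22 and 12 are the idempotents modulo 33
  lying over $(1, 0)$ and $(0, 1)$ in $\mathbb{Z}/3 \times \mathbb{Z}/11$.\<close>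

lemma decoding_polynomial:
  fixes t :: nat
  shows "t mod 33 \<in> {0, 22, 12} \<Longrightarrow> (20 + 3 * 4 ^ (5 * t) + 44 * 4 ^ (25 * t)) mod 67 = (0::nat)"
    and "t mod 33 = 1 \<Longrightarrow> (20 + 3 * 4 ^ (5 * t) + 44 * 4 ^ (25 * t)) mod 67 = (1::nat)"
proof -
  have "(20 + 3 * 4 ^ (5 * t) + 44 * 4 ^ (25 * t)) mod 67 =
      (20 + 3 * (4 ^ (5 * t) mod 67) + 44 * (4 ^ (25 * t) mod 67)) mod (67::nat)"
    by (intro mod_add_cong) (simp_all add: mod_mult_right_eq)
  moreover have "(4::nat) ^ (5 * t) mod 67 = 4 ^ (5 * (t mod 33) mod 33) mod 67"
    "(4::nat) ^ (25 * t) mod 67 = 4 ^ (25 * (t mod 33) mod 33) mod 67"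
    by (subst four_power_mod, simp add: mod_simps)+
  ultimately have *: "(20 + 3 * 4 ^ (5 * t) + 44 * 4 ^ (25 * t)) mod 67 =
      (20 + 3 * (4 ^ (5 * (t mod 33) mod 33) mod 67) + 44 * (4 ^ (25 * (t mod 33) mod 33) mod 67)) mod (67::nat)"
    by (simp only:)
  show "t mod 33 \<in> {0, 22, 12} \<Longrightarrow> (20 + 3 * 4 ^ (5 * t) + 44 * 4 ^ (25 * t)) mod 67 = (0::nat)"
    "t mod 33 = 1 \<Longrightarrow> (20 + 3 * 4 ^ (5 * t) + 44 * 4 ^ (25 * t)) mod 67 = (1::nat)"
    unfolding * by auto
qed

text \<open>A code of length \<open>N\<close> over $\mathbb{F}_{67}$ given by the exponents \<open>S\<close> of its coordinates, with a
  matching \<open>M i\<close> of decoding triples for each of the \<open>k\<close> message symbols.\<close>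

definition decodable :: "nat \<Rightarrow> nat \<Rightarrow> (nat \<Rightarrow> nat \<Rightarrow> nat) \<Rightarrow> (nat \<Rightarrow> (nat \<times> nat \<times> nat) set) \<Rightarrow> bool" where
  "decodable N k S M \<longleftrightarrow> (\<forall>i<k. matching N (M i) \<and> 67 * card (M i) = N \<and>
     (\<forall>(a, b, c)\<in>M i. \<forall>j<k. (S a j + S b j + S c j) mod 67 = (if i = j then 1 else 0)))"

text \<open>Efremenko's matching vector code: up to a scalar, the coordinate at w sends the message
  z to the sum over j of z_j 4^(u_j . w). On the line w + b v_i the j-th term gains the factor 4^(b
  t) with t = u_j . v_i, and the queries b = 0, 5, 25 with coefficients 20, 3, 44 evaluate the
  decoding polynomial at 4^t.\<close>

lemma matching_vectors_decodable:
  fixes u v :: "nat \<Rightarrow> 'c \<Rightarrow> nat"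
  assumes I: "finite I"
    and diag: "\<And>i. i < k \<Longrightarrow> (\<Sum>x\<in>I. u i x * v i x) mod 33 = 1"
    and off: "\<And>i j. i < k \<Longrightarrow> j < k \<Longrightarrow> i \<noteq> j \<Longrightarrow> (\<Sum>x\<in>I. u j x * v i x) mod 33 \<in> {0, 22, 12}"
  shows "\<exists>S M. decodable (67 * 33 ^ card I) k S M"
proof -
  define W where "W = I \<rightarrow>\<^sub>E {..<33::nat}"
  \<comment> \<open>The second entry is a scalar multiplying the coordinate. It absorbs the decoding
    coefficients, so that the three exponent vectors of a triple can simply be added; the price is
    that each matching has density only 1/67.\<close>
  define Idx where "Idx = W \<times> {..<67::nat}"
  let ?N = "67 * 33 ^ card I :: nat"
  have card_W: "finite W" "card W = 33 ^ card I"
    using I by (auto simp: W_def card_PiE intro: finite_PiE)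
  then have Idx: "finite Idx" "card Idx = ?N" by (auto simp: Idx_def card_cartesian_product)
  obtain \<phi> where \<phi>: "bij_betw \<phi> Idx {..<?N}"
    using ex_bij_betw_finite_nat[OF Idx(1)] Idx(2) by (auto simp: atLeast0LessThan)
  define \<psi> where "\<psi> = inv_into Idx \<phi>"
  have \<psi>: "\<psi> (\<phi> x) = x" if "x \<in> Idx" for x
    using \<phi> that by (simp add: \<psi>_def bij_betw_def)
  define dot where "dot j w = (\<Sum>x\<in>I. u j x * w x)" for j and w :: "'c \<Rightarrow> nat"
  define S where "S a j = (case \<psi> a of (w, \<mu>) \<Rightarrow> \<mu> * 4 ^ dot j w)" for a j
  define shift where "shift i b w = (\<lambda>x\<in>I. (w x + b * v i x) mod 33)" for i b and w :: "'c \<Rightarrow> nat"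
  \<comment> \<open>As 32 = -1 modulo 33, the power of 4 cancels the factor 4^(u_i . w) of the i-th
    term.\<close>
  define pt where "pt i b \<mu> w = (shift i b w, (\<mu> * 4 ^ (32 * dot i w)) mod 67)"
    for i b and \<mu> :: nat and w :: "'c \<Rightarrow> nat"
  define M where "M i = (\<lambda>w. (\<phi> (pt i 0 20 w), \<phi> (pt i 5 3 w), \<phi> (pt i 25 44 w))) ` W" for i
  have pt_in: "pt i b \<mu> w \<in> Idx" for i b \<mu> w
    by (auto simp: Idx_def W_def pt_def shift_def)
  have cancel: "a mod 33 = a' mod 33" if "(a + c) mod 33 = (a' + c) mod 33" for a a' c :: nat
  proof -
    \<comment> \<open>On natural numbers, adding 32 c serves as subtracting c modulo 33.\<close>
    have "(a + c + 32 * c) mod 33 = (a' + c + 32 * c) mod 33"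
      by (rule mod_add_cong[OF that refl])
    moreover have "x + c + 32 * c = x + c * 33" for x by simp
    ultimately show ?thesis by (simp only: mod_mult_self1)
  qed
  have inj_shift: "inj_on (shift i b) W" for i b
  proof (rule inj_onI)
    fix w w' assume w: "w \<in> W" "w' \<in> W" and eq: "shift i b w = shift i b w'"
    show "w = w'"
    proof (rule PiE_ext)
      show "w \<in> I \<rightarrow>\<^sub>E {..<33}" "w' \<in> I \<rightarrow>\<^sub>E {..<33}" using w by (auto simp: W_def)
      fix x assume x: "x \<in> I"
      have "(w x + b * v i x) mod 33 = (w' x + b * v i x) mod 33"
        using fun_cong[OF eq, of x] x by (simp add: shift_def)
      then have "w x mod 33 = w' x mod 33" by (rule cancel)
      moreover have "w x < 33" "w' x < 33" using w x by (auto simp: W_def)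
      ultimately show "w x = w' x" by simp
    qed
  qed
  \<comment> \<open>The shifted vector alone already determines w, although the scalar depends on w
    too.\<close>
  have inj_pt: "inj_on (\<lambda>w. \<phi> (pt i b \<mu> w)) W" for i b \<mu>
  proof (rule inj_onI)
    fix w w' assume w: "w \<in> W" "w' \<in> W" and "\<phi> (pt i b \<mu> w) = \<phi> (pt i b \<mu> w')"
    then have "pt i b \<mu> w = pt i b \<mu> w'" using \<psi>[OF pt_in] by metis
    then have "shift i b w = shift i b w'" by (simp add: pt_def)
    then show "w = w'" by (rule inj_onD[OF inj_shift _ w])
  qed
  have S_pt: "S (\<phi> (pt i b \<mu> w)) j mod 67 =
      4 ^ (32 * dot i w + dot j w) * (\<mu> * 4 ^ (b * (\<Sum>x\<in>I. u j x * v i x))) mod 67"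
    if "w \<in> W" for i j b \<mu> w
  proof -
    have "dot j (shift i b w) mod 33 = (\<Sum>x\<in>I. (u j x * ((w x + b * v i x) mod 33)) mod 33) mod 33"
      by (simp add: dot_def shift_def mod_sum_eq)
    also have "\<dots> = (\<Sum>x\<in>I. u j x * (w x + b * v i x)) mod 33"
      by (simp add: mod_mult_right_eq mod_sum_eq)
    also have "(\<Sum>x\<in>I. u j x * (w x + b * v i x)) = dot j w + b * (\<Sum>x\<in>I. u j x * v i x)"
      by (simp add: dot_def sum.distrib sum_distrib_left algebra_simps)
    finally have "(4::nat) ^ dot j (shift i b w) mod 67 =
        4 ^ (dot j w + b * (\<Sum>x\<in>I. u j x * v i x)) mod 67"
      by (subst (1 2) four_power_mod) simp
    then have "(\<mu> * 4 ^ (32 * dot i w)) * 4 ^ dot j (shift i b w) mod 67 =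
        (\<mu> * 4 ^ (32 * dot i w)) * 4 ^ (dot j w + b * (\<Sum>x\<in>I. u j x * v i x)) mod 67"
      by (rule mod_mult_cong[OF refl])
    moreover have "S (\<phi> (pt i b \<mu> w)) j mod 67 =
        (\<mu> * 4 ^ (32 * dot i w)) * 4 ^ dot j (shift i b w) mod 67"
      by (simp add: S_def \<psi>[OF pt_in]) (simp add: pt_def mod_mult_left_eq)
    ultimately show ?thesis by (simp add: power_add mult_ac)
  qed
  have "decodable ?N k S M"
    unfolding decodable_def
  proof (intro allI impI conjI)
    fix i assume i: "i < k"
    have "\<phi> (pt i b \<mu> w) < ?N" for b \<mu> w
      using bij_betwE[OF \<phi>] pt_in by blast
    then show "matching ?N (M i)"
      unfolding matching_def M_def using inj_pt
      by (auto intro!: inj_on_imageI simp: o_def)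
    have "card (M i) = card W"
      unfolding M_def by (rule card_image, rule inj_onI) (use inj_pt in \<open>auto dest: inj_onD\<close>)
    then show "67 * card (M i) = ?N" using card_W by simp
    have "(S a j + S b j + S c j) mod 67 = (if i = j then 1 else 0)"
      if "(a, b, c) \<in> M i" and j: "j < k" for a b c j
    proof -
      obtain w where w: "w \<in> W" and abc: "a = \<phi> (pt i 0 20 w)" "b = \<phi> (pt i 5 3 w)"
        "c = \<phi> (pt i 25 44 w)" using \<open>(a, b, c) \<in> M i\<close> by (auto simp: M_def)
      define t where "t = (\<Sum>x\<in>I. u j x * v i x)"
      let ?F = "4 ^ (32 * dot i w + dot j w) :: nat"
      have "(S a j + S b j + S c j) mod 67 = (S a j mod 67 + S b j mod 67 + S c j mod 67) mod 67"
        by (intro mod_add_cong) simp_all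
      also have "\<dots> = (?F * (20 * 4 ^ (0 * t)) + ?F * (3 * 4 ^ (5 * t)) + ?F * (44 * 4 ^ (25 * t))) mod 67"
        unfolding abc S_pt[OF w] t_def[symmetric] by (intro mod_add_cong) simp_all
      also have "\<dots> = (?F mod 67) * ((20 + 3 * 4 ^ (5 * t) + 44 * 4 ^ (25 * t)) mod 67) mod 67"
        by (simp add: mod_mult_eq distrib_left)
      finally have eq: "(S a j + S b j + S c j) mod 67 =
        (?F mod 67) * ((20 + 3 * 4 ^ (5 * t) + 44 * 4 ^ (25 * t)) mod 67) mod 67" .
      show ?thesis
      proof (cases "i = j")
        case True
        \<comment> \<open>The exponent of 4 is now 33 times \<open>dot i w\<close>.\<close>
        moreover from this have "?F mod 67 = 1"
          by (subst four_power_mod) simp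
        ultimately show ?thesis
          unfolding eq using decoding_polynomial(2)[of t] diag[OF i] by (simp add: t_def)
      next
        case False
        then show ?thesis
          unfolding eq using decoding_polynomial(1)[of t] off[OF i j] by (simp add: t_def)
      qed
    qed
    then show "\<forall>(a, b, c)\<in>M i. \<forall>j<k. (S a j + S b j + S c j) mod 67 = (if i = j then 1 else 0)"
      by blast
  qed
  then show ?thesis by blast
qed

text \<open>The matching vectors are indicator vectors of set inclusion: by the periodicity of binomial
  coefficients the number of common \<open>q - 1\<close>-subsets detects, modulo the prime, whether the
  intersection has size $-1$ modulo the prime power \<open>q\<close>.\<close>

lemma subset_code:
  fixes e f g :: nat
  assumes "e \<ge> 1" "f \<ge> 1"
  defines "q1 \<equiv> 3 ^ e" and "q2 \<equiv> 11 ^ f"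
  shows "\<exists>S M. decodable (67 * 33 ^ ((g choose (q1 - 1)) + (g choose (q2 - 1)))) (g choose (q1 * q2 - 1)) S M"
proof -
  let ?l = "q1 * q2 - 1" and ?k = "g choose (q1 * q2 - 1)"
  define sub where "sub m = {A. A \<subseteq> {..<g} \<and> card A = m}" for m
  have fin: "finite (sub m)" for m
    unfolding sub_def by (rule finite_subset[of _ "Pow {..<g}"]) auto
  have card_sub: "card (sub m) = g choose m" for m
    using n_subsets[of "{..<g}" m] by (simp add: sub_def)
  have coprime: "coprime q1 q2"
    using primes_coprime[of "3::nat" 11] by (simp add: q1_def q2_def)
  have q: "q1 > 1" "q2 > 1"
    unfolding q1_def q2_def using assms by (intro one_less_power; simp)+
  then have q12: "q1 \<noteq> q2" using coprime by auto
  then have neq: "q1 - 1 \<noteq> q2 - 1" using q by linarith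
  define I where "I = sub (q1 - 1) \<union> sub (q2 - 1)"
  have I: "finite I" "card I = (g choose (q1 - 1)) + (g choose (q2 - 1))"
  proof -
    have "sub (q1 - 1) \<inter> sub (q2 - 1) = {}" using neq by (auto simp: sub_def)
    then show "card I = (g choose (q1 - 1)) + (g choose (q2 - 1))"
      unfolding I_def by (simp only: card_Un_disjoint[OF fin fin] card_sub)
  qed (simp add: I_def fin)
  obtain G where G: "bij_betw G {..<?k} (sub ?l)"
    using ex_bij_betw_nat_finite[OF fin, of ?l] by (auto simp: card_sub atLeast0LessThan)
  have G_in: "G i \<subseteq> {..<g}" "card (G i) = ?l" "finite (G i)" if "i < ?k" for i
    using bij_betwE[OF G] that by (auto simp: sub_def intro: finite_subset)
  define u where "u i A = (if A \<subseteq> G i then 1 else 0 :: nat)" for i A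
  \<comment> \<open>By the Chinese remainder theorem 22 x + 12 y has residue x modulo 3 and y modulo
    11. For x and y in {0, 1} the values modulo 33 are 0, 22, 12 and, with both equal to 1, 34 =
    1.\<close>
  define v where "v i A = (if A \<subseteq> G i then (if card A = q1 - 1 then 22 else 12) else 0 :: nat)" for i A
  have count: "(\<Sum>A\<in>sub m. u j A * (if A \<subseteq> G i then d else 0)) = d * (card (G i \<inter> G j) choose m)"
    if "i < ?k" "j < ?k" for i j m d
  proof -
    have "(\<Sum>A\<in>sub m. u j A * (if A \<subseteq> G i then d else 0)) = (\<Sum>A\<in>sub m. if A \<subseteq> G i \<inter> G j then d else 0)"
      by (intro sum.cong) (auto simp: u_def)
    also have "\<dots> = (\<Sum>A\<in>{A. A \<subseteq> G i \<inter> G j \<and> card A = m}. d)"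
      using G_in[OF that(1)] by (subst sum.inter_filter[symmetric, OF fin])
        (intro sum.cong, auto simp: sub_def)
    also have "\<dots> = d * (card (G i \<inter> G j) choose m)"
      using n_subsets[of "G i \<inter> G j" m] G_in[OF that(1)] by (simp add: mult.commute)
    finally show ?thesis .
  qed
  have dot: "(\<Sum>A\<in>I. u j A * v i A) = 22 * (card (G i \<inter> G j) choose (q1 - 1)) +
      12 * (card (G i \<inter> G j) choose (q2 - 1))" if "i < ?k" "j < ?k" for i j
  proof -
    have "(\<Sum>A\<in>I. u j A * v i A) = (\<Sum>A\<in>sub (q1 - 1). u j A * v i A) + (\<Sum>A\<in>sub (q2 - 1). u j A * v i A)"
      unfolding I_def using fin neq by (intro sum.union_disjoint) (auto simp: sub_def)
    also have "(\<Sum>A\<in>sub (q1 - 1). u j A * v i A) = (\<Sum>A\<in>sub (q1 - 1). u j A * (if A \<subseteq> G i then 22 else 0))"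
      by (intro sum.cong) (auto simp: v_def sub_def)
    also have "(\<Sum>A\<in>sub (q2 - 1). u j A * v i A) = (\<Sum>A\<in>sub (q2 - 1). u j A * (if A \<subseteq> G i then 12 else 0))"
      using neq by (intro sum.cong) (auto simp: v_def sub_def)
    finally show ?thesis using count[OF that] by simp
  qed
  have mod33: "(22 * x + 12 * y) mod 33 = (22 * (x mod 3) + 12 * (y mod 11)) mod 33" for x y :: nat
  proof -
    have "22 * (3 * a + b) + 12 * (11 * c + d) = 22 * b + 12 * d + (2 * a + 4 * c) * 33"
      for a b c d :: nat by simp
    from this[of "x div 3" "x mod 3" "y div 11" "y mod 11"]
    have "22 * x + 12 * y = 22 * (x mod 3) + 12 * (y mod 11) + (2 * (x div 3) + 4 * (y div 11)) * 33"
      by (simp only: mult_div_mod_eq)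
    then show ?thesis by (simp only: mod_mult_self1)
  qed
  have dot_mod: "(\<Sum>A\<in>I. u j A * v i A) mod 33 =
      (22 * (if card (G i \<inter> G j) mod q1 = q1 - 1 then 1 else 0) +
       12 * (if card (G i \<inter> G j) mod q2 = q2 - 1 then 1 else 0)) mod 33" if "i < ?k" "j < ?k" for i j
  proof -
    have "prime (3::nat)" "prime (11::nat)" by simp_all
    then show ?thesis
      unfolding dot[OF that] q1_def q2_def
      by (subst mod33) (simp only: choose_prime_power_minus_one_mod)
  qed
  have mod_iff: "a mod r = r - 1 \<longleftrightarrow> r dvd a + 1" if "r > 1" for a r :: nat
    using that by (auto simp: dvd_eq_mod_eq_0 mod_Suc)
  \<comment> \<open>The two congruences say that the coprime numbers q1 and q2 divide the size of
    the intersection plus one, which lies between 1 and q1 q2. So the intersection has the full size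
    q1 q2 - 1 and the two sets coincide.\<close>
  have both: "card (G i \<inter> G j) mod q1 = q1 - 1 \<and> card (G i \<inter> G j) mod q2 = q2 - 1 \<longleftrightarrow> i = j"
    if ij: "i < ?k" "j < ?k" for i j
  proof -
    have "card (G i \<inter> G j) mod q1 = q1 - 1 \<and> card (G i \<inter> G j) mod q2 = q2 - 1 \<longleftrightarrow>
        q1 * q2 dvd card (G i \<inter> G j) + 1"
      unfolding mod_iff[OF q(1)] mod_iff[OF q(2)]
      by (rule iffI, elim conjE, rule divides_mult[OF _ _ coprime], assumption+)
        (rule conjI, erule dvd_mult_left, erule dvd_mult_right)
    also have "\<dots> \<longleftrightarrow> card (G i \<inter> G j) = ?l"
    proof
      assume "q1 * q2 dvd card (G i \<inter> G j) + 1"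
      then have "q1 * q2 \<le> card (G i \<inter> G j) + 1" by (rule dvd_imp_le) simp
      moreover have "card (G i \<inter> G j) \<le> ?l"
        using card_mono[OF G_in(3)[OF ij(1)], of "G i \<inter> G j"] G_in(2)[OF ij(1)] by simp
      ultimately show "card (G i \<inter> G j) = ?l" by linarith
    next
      assume "card (G i \<inter> G j) = ?l"
      then show "q1 * q2 dvd card (G i \<inter> G j) + 1" using q by simp
    qed
    also have "\<dots> \<longleftrightarrow> i = j"
    proof
      assume c: "card (G i \<inter> G j) = ?l"
      have "G i \<inter> G j = G i" "G i \<inter> G j = G j"
        by (rule card_subset_eq; use c G_in[OF ij(1)] G_in[OF ij(2)] in simp)+
      then show "i = j" using G ij by (auto simp: bij_betw_def dest: inj_onD)
    qed (use G_in[OF ij(1)] in simp)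
    finally show ?thesis .
  qed
  have "\<exists>S M. decodable (67 * 33 ^ card I) ?k S M"
  proof (rule matching_vectors_decodable[OF I(1), of ?k u v])
    show "(\<Sum>A\<in>I. u i A * v i A) mod 33 = 1" if "i < ?k" for i
      using dot_mod[OF that that] both[OF that that] by simp
    show "(\<Sum>A\<in>I. u j A * v i A) mod 33 \<in> {0, 22, 12}" if "i < ?k" "j < ?k" "i \<noteq> j" for i j
      using dot_mod[OF that(1,2)] both[OF that(1,2)] that(3) by (auto split: if_splits)
  qed
  then show ?thesis by (simp only: I(2))
qed

section \<open>Extraction of the first-order part\<close>

text \<open>A geometric sum over roots of unity. It is applied with M = 2m + 1 to the quadrature
  nodes and with M = 67 to the average over the shifts of one message symbol.\<close>

lemma sum_cis_multiples:
  fixes M :: nat and s :: int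
  assumes M: "M > 0"
  shows "(\<Sum>l<M. cis (2 * pi * s * l / M)) = (if int M dvd s then of_nat M else 0)"
proof -
  define \<omega> where "\<omega> = cis (2 * pi * s / M)"
  have pow: "cis (2 * pi * s * l / M) = \<omega> ^ l" for l :: nat
    by (simp add: \<omega>_def Complex.DeMoivre mult_ac)
  have "\<omega> ^ M = cis (2 * pi * real_of_int s)"
    using M by (simp add: \<omega>_def Complex.DeMoivre)
  then have \<omega>M: "\<omega> ^ M = 1" by simp
  have \<omega>1: "\<omega> = 1 \<longleftrightarrow> int M dvd s"
  proof
    assume "\<omega> = 1"
    then have "cos (2 * pi * s / M) = 1" by (simp add: \<omega>_def complex_eq_iff)
    then obtain n :: int where "2 * pi * s / M = of_int n * (2 * pi)"
      using cos_one_2pi_int by (metis mult.assoc mult.commute)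
    then have "real_of_int s = of_int (n * int M)" using M by (simp add: field_simps)
    then have "s = n * int M" by (simp only: of_int_eq_iff)
    then show "int M dvd s" by simp
  next
    assume "int M dvd s"
    then obtain n where "s = int M * n" by (auto elim: dvdE)
    then have "2 * pi * s / M = 2 * pi * real_of_int n" using M by simp
    then show "\<omega> = 1" by (simp add: \<omega>_def)
  qed
  show ?thesis
    unfolding pow using \<omega>1 \<omega>M by (auto simp: sum_gp_strict)
qed

text \<open>Evaluation of the derivative at 0 of a trigonometric polynomial of degree \<open>m\<close>, from its values
  at the \<open>2 * m + 1\<close> equidistant nodes via the derivative of the Dirichlet kernel; applied to the
  powers of the sine.\<close>

lemma dirichlet_derivative:
  fixes m :: nat and s :: int and \<theta> \<kappa> :: "nat \<Rightarrow> real"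
  assumes \<theta>: "\<And>l. \<theta> l = 2 * pi * l / (2 * m + 1)"
    and \<kappa>: "\<And>l. \<kappa> l = (\<Sum>j=1..m. 2 * real j * sin (j * \<theta> l))"
    and "\<bar>s\<bar> + int d \<le> int m"
  shows "(\<Sum>l<2*m+1. of_real (\<kappa> l * sin (\<theta> l) ^ d) * cis (s * \<theta> l)) =
    of_nat (2 * m + 1) * (if d = 0 then \<i> * of_int s else if d = 1 then 1 else 0)"
  using assms(3)
\<comment> \<open>A factor sin t turns the frequency s into a combination of s + 1 and s - 1, so
  each step trades one unit of d for one unit of |s|; the bound on |s| + d is shaped for
  this.\<close>
proof (induction d arbitrary: s)
  case 0
  let ?M = "2 * m + 1"
  have orth: "(\<Sum>l<?M. cis (r * \<theta> l)) = (if int ?M dvd r then of_nat ?M else 0)" for r :: int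
    using sum_cis_multiples[of ?M r] by (simp add: \<theta> mult_ac)
  have two_sin: "of_real (2 * sin (j * t)) * cis (s * t) = - \<i> * (cis ((s + j) * t) - cis ((s - j) * t))"
    for j s :: int and t :: real
    by (simp add: complex_eq_iff cos_add sin_add cos_diff sin_diff distrib_right left_diff_distrib)
  have "(\<Sum>l<?M. of_real (\<kappa> l) * cis (s * \<theta> l)) =
      (\<Sum>l<?M. \<Sum>j=1..m. of_nat j * (- \<i> * (cis ((s + int j) * \<theta> l) - cis ((s - int j) * \<theta> l))))"
  proof (intro sum.cong refl)
    fix l
    have "of_real (\<kappa> l) * cis (s * \<theta> l) =
        (\<Sum>j=1..m. of_nat j * (of_real (2 * sin (int j * \<theta> l)) * cis (s * \<theta> l)))"
      unfolding \<kappa> of_real_sum sum_distrib_right by (intro sum.cong refl) (simp add: mult_ac)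
    then show "of_real (\<kappa> l) * cis (s * \<theta> l) =
        (\<Sum>j=1..m. of_nat j * (- \<i> * (cis ((s + int j) * \<theta> l) - cis ((s - int j) * \<theta> l))))"
      unfolding two_sin by simp
  qed
  also have "\<dots> = (\<Sum>j=1..m. of_nat j * (- \<i> * ((\<Sum>l<?M. cis ((s + int j) * \<theta> l)) - (\<Sum>l<?M. cis ((s - int j) * \<theta> l)))))"
    by (subst sum.swap) (simp only: sum_distrib_left sum_subtractf right_diff_distrib)
  also have "\<dots> = (\<Sum>j=1..m. of_nat ?M * (if j = nat \<bar>s\<bar> then \<i> * of_int s else 0))"
  proof (intro sum.cong refl)
    fix j assume j: "j \<in> {1..m}"
    \<comment> \<open>Both are at most 2m, one less than the number of nodes, so nothing aliases:
      divisibility forces zero.\<close>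
    have bounds: "\<bar>s + int j\<bar> < int ?M" "\<bar>s - int j\<bar> < int ?M" using j 0 by auto
    have dvd: "int ?M dvd s + int j \<longleftrightarrow> s + int j = 0" "int ?M dvd s - int j \<longleftrightarrow> s - int j = 0"
      using dvd_imp_le_int[of "s + int j" "int ?M"] dvd_imp_le_int[of "s - int j" "int ?M"] bounds by auto
    consider "s = int j" | "s = - int j" | "s \<noteq> int j" "s \<noteq> - int j" by blast
    then show "of_nat j * (- \<i> * ((\<Sum>l<?M. cis ((s + int j) * \<theta> l)) - (\<Sum>l<?M. cis ((s - int j) * \<theta> l)))) =
        of_nat ?M * (if j = nat \<bar>s\<bar> then \<i> * of_int s else 0)"
      unfolding orth dvd using j by cases (auto simp: algebra_simps)
  qed
  also have "\<dots> = of_nat ?M * (\<i> * of_int s)"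
    using 0 by (cases "s = 0") (auto simp flip: sum_distrib_left simp: nat_le_iff)
  finally show ?case by simp
next
  case (Suc d)
  have sin_cis: "of_real (sin t) * cis (s * t) = - \<i> / 2 * (cis ((s + 1) * t) - cis ((s - 1) * t))"
    for t :: real
    by (simp add: complex_eq_iff cos_add sin_add cos_diff sin_diff distrib_right left_diff_distrib)
  have "(\<Sum>l<2*m+1. of_real (\<kappa> l * sin (\<theta> l) ^ Suc d) * cis (s * \<theta> l)) =
      (\<Sum>l<2*m+1. of_real (\<kappa> l * sin (\<theta> l) ^ d) * (of_real (sin (\<theta> l)) * cis (s * \<theta> l)))"
    by (simp add: mult_ac)
  also have "\<dots> = - \<i> / 2 * ((\<Sum>l<2*m+1. of_real (\<kappa> l * sin (\<theta> l) ^ d) * cis (of_int (s + 1) * \<theta> l)) -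
      (\<Sum>l<2*m+1. of_real (\<kappa> l * sin (\<theta> l) ^ d) * cis (of_int (s - 1) * \<theta> l)))"
    unfolding sin_cis sum_subtractf[symmetric] sum_distrib_left
    by (intro sum.cong refl) (simp add: algebra_simps)
  also have "\<dots> = of_nat (2 * m + 1) * (if Suc d = 0 then \<i> * of_int s else if Suc d = 1 then 1 else 0)"
    using Suc.prems by (subst (1 2) Suc.IH) (auto simp: field_simps)
  finally show ?case .
qed

text \<open>Exact quadrature for p'(0) over polynomials p of degree at most m: under x = sin t / 67
  such a p becomes a trigonometric polynomial of degree at most m. The 67 in the weights is the
  chain rule factor, and m (m + 1) bounds the derivative of the Dirichlet kernel.\<close>

lemma first_order_weights:
  fixes m :: nat
  obtains c \<rho> :: "nat \<Rightarrow> real" and n :: nat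
  where "\<And>l. \<bar>\<rho> l\<bar> \<le> 1 / 67" "(\<Sum>l<n. \<bar>c l\<bar>) \<le> 67 * m * (m + 1)"
    "\<And>d. d \<le> m \<Longrightarrow> (\<Sum>l<n. c l * \<rho> l ^ d) = (if d = 1 then 1 else 0)"
proof -
  define \<theta> :: "nat \<Rightarrow> real" where "\<theta> = (\<lambda>l::nat. 2 * pi * l / (2 * m + 1))"
  define \<kappa> :: "nat \<Rightarrow> real" where "\<kappa> = (\<lambda>l. \<Sum>j=1..m. 2 * real j * sin (j * \<theta> l))"
  define c where "c = (\<lambda>l. 67 / real (2 * m + 1) * \<kappa> l)"
  define \<rho> where "\<rho> = (\<lambda>l. sin (\<theta> l) / 67)"
  have cancel: "y * (67 / y * x) = 67 * x" if "y \<noteq> 0" for x y :: real using that by simp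
  have gauss: "(\<Sum>j=1..m. 2 * real j) = m * (m + 1)"
    by (induction m) (simp_all add: algebra_simps)
  have "\<bar>\<kappa> l\<bar> \<le> m * (m + 1)" for l
  proof -
    have "\<bar>\<kappa> l\<bar> \<le> (\<Sum>j=1..m. 2 * real j)"
      unfolding \<kappa>_def
      by (rule order.trans[OF sum_abs]) (auto intro!: sum_mono simp: abs_mult mult_left_le)
    then show ?thesis by (simp only: gauss)
  qed
  then have "\<bar>c l\<bar> \<le> 67 / real (2 * m + 1) * (m * (m + 1))" for l
    unfolding c_def abs_mult by (intro mult_mono) auto
  then have "(\<Sum>l<2*m+1. \<bar>c l\<bar>) \<le> (\<Sum>l<2*m+1. 67 / real (2 * m + 1) * (m * (m + 1)))"
    by (intro sum_mono)
  also have "\<dots> = real (2 * m + 1) * (67 / real (2 * m + 1) * (m * (m + 1)))"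
    by (simp only: sum_constant card_lessThan)
  also have "\<dots> = 67 * real (m * (m + 1))"
    by (rule cancel) simp
  also have "\<dots> = 67 * m * (m + 1)"
    by (simp add: algebra_simps)
  finally have "(\<Sum>l<2*m+1. \<bar>c l\<bar>) \<le> 67 * m * (m + 1)" .
  moreover have "(\<Sum>l<2*m+1. c l * \<rho> l ^ d) = (if d = 1 then 1 else 0)" if "d \<le> m" for d
  proof -
    have "(\<Sum>l<2*m+1. complex_of_real (\<kappa> l * sin (\<theta> l) ^ d)) =
        of_nat (2 * m + 1) * (if d = 1 then 1 else 0)"
      using dirichlet_derivative[of \<theta> m \<kappa> 0 d, OF \<theta>_def[THEN fun_cong] \<kappa>_def[THEN fun_cong]] that
      by (simp split: if_splits del: sum.lessThan_Suc)
    then have "complex_of_real (\<Sum>l<2*m+1. \<kappa> l * sin (\<theta> l) ^ d) =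
        complex_of_real (real (2 * m + 1) * (if d = 1 then 1 else 0))"
      by (simp del: of_nat_add of_nat_mult)
    then have *: "(\<Sum>l<2*m+1. \<kappa> l * sin (\<theta> l) ^ d) = real (2 * m + 1) * (if d = 1 then 1 else 0)"
      by (simp only: of_real_eq_iff)
    have "(\<Sum>l<2*m+1. c l * \<rho> l ^ d) =
        67 / (real (2 * m + 1) * 67 ^ d) * (\<Sum>l<2*m+1. \<kappa> l * sin (\<theta> l) ^ d)"
      unfolding sum_distrib_left by (intro sum.cong refl) (simp add: c_def \<rho>_def power_divide)
    then show ?thesis unfolding * by (simp del: of_nat_add of_nat_mult)
  qed
  moreover have "\<bar>\<rho> l\<bar> \<le> 1 / 67" for l
    by (simp add: \<rho>_def)
  ultimately show thesis using that by blast
qed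

section \<open>Seminorm estimates and the noise operator\<close>

context tensor_seminorm
begin

lemma P_zero: "P (\<lambda>_ _ _. 0) = 0"
  using P_scale[of 0] by simp

lemma P_sum: "finite I \<Longrightarrow> P (\<lambda>a b c. \<Sum>i\<in>I. t i a b c) \<le> (\<Sum>i\<in>I. P (t i))"
proof (induction I rule: finite_induct)
  case empty
  then show ?case by (simp add: P_zero)
next
  case (insert x F)
  then show ?case using P_add[of "t x" "\<lambda>a b c. \<Sum>i\<in>F. t i a b c"] by simp
qed

text \<open>Each single entry is a product of unit vectors. This crude bound over N^3 entries is
  spent only on the high-degree remainder, whose entries are tiny.\<close>

lemma P_le_sum_abs: "P t \<le> (\<Sum>a<N. \<Sum>b<N. \<Sum>c<N. \<bar>t a b c\<bar>)"
proof -
  define I where "I = {..<N} \<times> {..<N} \<times> {..<N}"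
  define e where "e i a = (if a = i then 1 else 0 :: real)" for i a :: nat
  have "P t = P (\<lambda>a b c. \<Sum>(x, y, z)\<in>I. t x y z * (e x a * e y b * e z c))"
  proof (rule P_cong)
    fix a b c assume "a < N" "b < N" "c < N"
    then have "(a, b, c) \<in> I" by (simp add: I_def)
    have "(\<Sum>(x, y, z)\<in>I. t x y z * (e x a * e y b * e z c)) =
        (\<Sum>i\<in>I. if i = (a, b, c) then t a b c else 0)"
      by (intro sum.cong refl) (auto simp: e_def split: if_splits)
    then show "t a b c = (\<Sum>(x, y, z)\<in>I. t x y z * (e x a * e y b * e z c))"
      using \<open>(a, b, c) \<in> I\<close> by (simp add: I_def)
  qed
  also have "\<dots> \<le> (\<Sum>(x, y, z)\<in>I. P (\<lambda>a b c. t x y z * (e x a * e y b * e z c)))"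
    using P_sum[of I "\<lambda>(x, y, z) a b c. t x y z * (e x a * e y b * e z c)"]
    by (simp add: case_prod_beta I_def)
  also have "\<dots> \<le> (\<Sum>(x, y, z)\<in>I. \<bar>t x y z\<bar>)"
  proof (intro sum_mono, clarify)
    fix x y z
    have "P (\<lambda>a b c. e x a * e y b * e z c) \<le> 1"
      by (rule P_product) (simp add: e_def)
    then show "P (\<lambda>a b c. t x y z * (e x a * e y b * e z c)) \<le> \<bar>t x y z\<bar>"
      unfolding P_scale by (simp add: mult_left_le)
  qed
  also have "\<dots> = (\<Sum>a<N. \<Sum>b<N. \<Sum>c<N. \<bar>t a b c\<bar>)"
    by (simp add: I_def sum.cartesian_product case_prod_beta)
  finally show ?thesis .
qed

lemma P_sin_sum:
  "P (\<lambda>a b c. sin (\<alpha> a + \<alpha> b + \<alpha> c)) \<le> 4"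
proof -
  let ?p = "\<lambda>f g h (a::nat) (b::nat) (c::nat). f (\<alpha> a) * g (\<alpha> b) * h (\<alpha> c) :: real"
  have le: "P (?p f g h) \<le> 1" if "f \<in> {sin, cos}" "g \<in> {sin, cos}" "h \<in> {sin, cos}" for f g h
    by (rule P_product) (use that in auto)
  have "P (\<lambda>a b c. sin (\<alpha> a + \<alpha> b + \<alpha> c)) =
      P (\<lambda>a b c. ((?p sin cos cos a b c + ?p cos sin cos a b c) + ?p cos cos sin a b c)
        + - 1 * ?p sin sin sin a b c)"
    by (simp add: sin_add cos_add algebra_simps)
  also have "\<dots> \<le> P (?p sin cos cos) + P (?p cos sin cos) + P (?p cos cos sin) + \<bar>- 1\<bar> * P (?p sin sin sin)"
    unfolding P_scale[symmetric] by (intro order.trans[OF P_add] add_right_mono order_refl)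
  also have "\<dots> \<le> 1 + 1 + 1 + \<bar>- 1\<bar> * 1"
    by (intro add_mono mult_left_mono le) auto
  finally show ?thesis by simp
qed

end

text \<open>The coordinates of z on which the character \<open>cis (phase k z s)\<close> depends.
  Their number is the degree of the character, hence the exponent of the noise parameter.\<close>

definition residue_support :: "nat \<Rightarrow> (nat \<Rightarrow> nat) \<Rightarrow> nat set" where
  "residue_support k s = {j. j < k \<and> \<not> 67 dvd s j}"

definition phase :: "nat \<Rightarrow> (nat \<Rightarrow> int) \<Rightarrow> (nat \<Rightarrow> nat) \<Rightarrow> real" where
  "phase k z s = (\<Sum>j<k. 2 * pi / 67 * (z j * s j))"

lemma cis_multiple_67: "67 dvd s \<Longrightarrow> cis (2 * pi / 67 * (of_int z * real s)) = 1"
  using cis_multiple_2pi[of "of_int z * of_nat (s div 67)"]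
  by (auto elim!: dvdE simp: mult_ac)

lemma cis_sum: "cis (\<Sum>j\<in>A. f j) = (\<Prod>j\<in>A. cis (f j))"
  by (induction A rule: infinite_finite_induct) (simp_all flip: cis_mult)

context tensor_seminorm
begin

text \<open>Rerandomising a coordinate of \<open>z\<close> with probability \<open>1 - \<rho>\<close> multiplies a nontrivial character
  of that coordinate by \<open>\<rho>\<close>.  This averaging is still convex for slightly negative \<open>\<rho>\<close>, where
  each new value gets weight \<open>(1 - \<rho>) / 67\<close>, the old one \<open>\<rho>\<close> more.\<close>

lemma P_noise_prod:
  fixes \<rho> :: real and \<sigma> :: "nat \<Rightarrow> nat \<Rightarrow> nat"
  assumes \<rho>: "\<bar>\<rho>\<bar> \<le> 1 / 67" and "J \<le> k"
  shows "P (\<lambda>a b c. Im (\<Prod>j<k. (if j < J \<and> \<not> 67 dvd \<sigma> a j + \<sigma> b j + \<sigma> c j then of_real \<rho> else 1) *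
    cis (2 * pi / 67 * (of_int (z j) * real (\<sigma> a j + \<sigma> b j + \<sigma> c j))))) \<le> 4"
  using \<open>J \<le> k\<close>
\<comment> \<open>The coordinates below J have been rerandomised. The induction hypothesis is used
  at all shifted messages, hence the arbitrary z.\<close>
proof (induction J arbitrary: z)
  case 0
  define \<alpha> where "\<alpha> a = (\<Sum>j<k. 2 * pi / 67 * (of_int (z j) * real (\<sigma> a j)))" for a
  have "(\<Prod>j<k. cis (2 * pi / 67 * (of_int (z j) * real (\<sigma> a j + \<sigma> b j + \<sigma> c j)))) =
      cis (\<alpha> a + \<alpha> b + \<alpha> c)" for a b c
    unfolding \<alpha>_def by (simp add: algebra_simps flip: sum.distrib cis_sum)
  then show ?case using P_sin_sum[of \<alpha>] by simp
next
  case (Suc J)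
  define F where "F J z a b c = (\<Prod>j<k. (if j < J \<and> \<not> 67 dvd \<sigma> a j + \<sigma> b j + \<sigma> c j then of_real \<rho> else 1) *
    cis (2 * pi / 67 * (of_int (z j) * real (\<sigma> a j + \<sigma> b j + \<sigma> c j))))"
    for J and z :: "nat \<Rightarrow> int" and a b c
  have IH: "P (\<lambda>a b c. Im (F J z a b c)) \<le> 4" for z
    unfolding F_def using Suc by simp
  have F_upd: "F J (z(J := z J + v)) a b c =
      cis (2 * pi / 67 * (of_int v * real (\<sigma> a J + \<sigma> b J + \<sigma> c J))) * F J z a b c" for v a b c
  proof -
    let ?s = "\<lambda>j. \<sigma> a j + \<sigma> b j + \<sigma> c j"
    let ?f = "\<lambda>z j. (if j < J \<and> \<not> 67 dvd ?s j then of_real \<rho> else 1) *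
        cis (2 * pi / 67 * (of_int (z j) * real (?s j)))"
    have J: "J \<in> {..<k}" "finite {..<k}" using Suc.prems by auto
    have "(\<Prod>j<k. ?f (z(J := z J + v)) j) = ?f (z(J := z J + v)) J * (\<Prod>j\<in>{..<k}-{J}. ?f z j)"
      unfolding prod.remove[OF J(2,1), of "?f (z(J := z J + v))"] by (intro arg_cong2[where f = "(*)"] refl prod.cong) auto
    also have "?f (z(J := z J + v)) J = cis (2 * pi / 67 * (of_int v * real (?s J))) * ?f z J"
      by (simp add: cis_mult distrib_right distrib_left add.commute del: of_nat_add)
    finally show ?thesis
      unfolding F_def prod.remove[OF J(2,1), of "?f z"] by (simp only: mult.assoc)
  qed
  have F_Suc: "F (Suc J) z a b c =
      (if 67 dvd \<sigma> a J + \<sigma> b J + \<sigma> c J then 1 else of_real \<rho>) * F J z a b c" for a b c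
  proof -
    let ?s = "\<lambda>j. \<sigma> a j + \<sigma> b j + \<sigma> c j"
    let ?f = "\<lambda>J j. (if j < J \<and> \<not> 67 dvd ?s j then of_real \<rho> else 1) *
        cis (2 * pi / 67 * (of_int (z j) * real (?s j)))"
    have J: "J \<in> {..<k}" "finite {..<k}" using Suc.prems by auto
    have "(\<Prod>j<k. ?f (Suc J) j) = ?f (Suc J) J * (\<Prod>j\<in>{..<k}-{J}. ?f J j)"
      unfolding prod.remove[OF J(2,1), of "?f (Suc J)"]
      by (intro arg_cong2[where f = "(*)"] refl prod.cong) (auto simp: less_Suc_eq)
    also have "?f (Suc J) J = (if 67 dvd ?s J then 1 else of_real \<rho>) * ?f J J"
      by simp
    finally show ?thesis
      unfolding F_def prod.remove[OF J(2,1), of "?f J"] by (simp only: mult.assoc)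
  qed
  have average: "F (Suc J) z a b c = of_real \<rho> * F J z a b c +
      (\<Sum>v<67. of_real ((1 - \<rho>) / 67) * F J (z(J := z J + int v)) a b c)" for a b c
  proof -
    define s where "s = \<sigma> a J + \<sigma> b J + \<sigma> c J"
    have "(\<Sum>v<67. cis (2 * pi / 67 * (of_int (int v) * real s))) = (if 67 dvd s then 67 else 0)"
      using sum_cis_multiples[of 67 "int s"] int_dvd_int_iff[of 67 s] by (simp add: mult_ac)
    from this[symmetric] have avg: "(\<Sum>v<67. of_real ((1 - \<rho>) / 67) * F J (z(J := z J + int v)) a b c) =
        of_real ((1 - \<rho>) / 67) * (if 67 dvd s then 67 else 0) * F J z a b c"
      unfolding F_upd s_def[symmetric] sum_distrib_left sum_distrib_right
      by (simp only: sum_distrib_left sum_distrib_right mult.assoc)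
    show ?thesis
      unfolding F_Suc s_def[symmetric] avg by (simp add: field_simps)
  qed
  let ?w = "(1 - \<rho>) / 67"
  \<comment> \<open>The weight of the old value is (66 \<open>\<rho>\<close> + 1) / 67, nonnegative
    down to \<open>\<rho>\<close> = -1/66.\<close>
  have "?w \<ge> 0 \<and> \<rho> + ?w \<ge> 0" using abs_le_D1[OF \<rho>] abs_le_D2[OF \<rho>] by (simp add: field_simps)
  then have w: "?w \<ge> 0" "\<rho> + ?w \<ge> 0" by auto
  \<comment> \<open>The shift v = 0 is the old value. Its weight is merged with
    \<open>\<rho>\<close> before norms are taken; apart from each other they would cost
    |\<open>\<rho>\<close>| + 1 - \<open>\<rho>\<close>, which exceeds 1 for negative
    \<open>\<rho>\<close>.\<close>
  have split: "Im (F (Suc J) z a b c) = (\<rho> + ?w) * Im (F J z a b c) +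
      (\<Sum>v\<in>{1..<67}. ?w * Im (F J (z(J := z J + int v)) a b c))" for a b c
  proof -
    have "{..<67} = insert 0 {1..<67::nat}" by auto
    then show ?thesis
      unfolding average by (simp add: distrib_right del: of_real_divide)
  qed
  have "P (\<lambda>a b c. Im (F (Suc J) z a b c)) \<le> P (\<lambda>a b c. (\<rho> + ?w) * Im (F J z a b c)) +
      P (\<lambda>a b c. \<Sum>v\<in>{1..<67}. ?w * Im (F J (z(J := z J + int v)) a b c))"
    unfolding split by (rule P_add)
  also have "\<dots> \<le> \<bar>\<rho> + ?w\<bar> * P (\<lambda>a b c. Im (F J z a b c)) +
      (\<Sum>v\<in>{1..<67}. \<bar>?w\<bar> * P (\<lambda>a b c. Im (F J (z(J := z J + int v)) a b c)))"
    unfolding P_scale[symmetric] by (intro add_left_mono P_sum) simp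
  also have "\<dots> \<le> \<bar>\<rho> + ?w\<bar> * 4 + (\<Sum>v\<in>{1..<67::nat}. \<bar>?w\<bar> * 4)"
    by (intro add_mono mult_left_mono sum_mono IH) auto
  also have "\<dots> = 4" using w by (simp add: field_simps)
  finally show ?case by (simp add: F_def)
qed

lemma P_noise:
  fixes \<rho> :: real and \<sigma> :: "nat \<Rightarrow> nat \<Rightarrow> nat"
  assumes \<rho>: "\<bar>\<rho>\<bar> \<le> 1 / 67"
  defines "s \<equiv> \<lambda>a b c j. \<sigma> a j + \<sigma> b j + \<sigma> c j"
  shows "P (\<lambda>a b c. \<rho> ^ card (residue_support k (s a b c)) * sin (phase k z (s a b c))) \<le> 4"
proof -
  have "Im (\<Prod>j<k. (if j < k \<and> \<not> 67 dvd \<sigma> a j + \<sigma> b j + \<sigma> c j then of_real \<rho> else 1) *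
      cis (2 * pi / 67 * (of_int (z j) * real (\<sigma> a j + \<sigma> b j + \<sigma> c j)))) =
    \<rho> ^ card (residue_support k (s a b c)) * sin (phase k z (s a b c))" for a b c
  proof -
    have "(\<Prod>j<k. if j < k \<and> \<not> 67 dvd \<sigma> a j + \<sigma> b j + \<sigma> c j then complex_of_real \<rho> else 1) =
        of_real (\<rho> ^ card (residue_support k (s a b c)))"
    proof -
      have "(\<Prod>j<k. if j < k \<and> \<not> 67 dvd \<sigma> a j + \<sigma> b j + \<sigma> c j then complex_of_real \<rho> else 1) =
          (\<Prod>j\<in>residue_support k (s a b c). complex_of_real \<rho>)"
        by (rule prod.mono_neutral_cong_right) (auto simp: residue_support_def s_def)
      then show ?thesis by simp
    qed
    then show ?thesis
      by (simp add: prod.distrib phase_def cis_sum[symmetric] s_def del: of_real_power of_nat_add)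
  qed
  then show ?thesis using P_noise_prod[OF \<rho> order_refl, of k \<sigma> z] by simp
qed

text \<open>\<open>t i\<close> collects the entries of the sine array whose phase depends on z_i
  alone. The noise combination \<open>V\<close> is exact where the degree is at most m; the error
  \<open>R\<close> in higher degrees has entries of size at most 67 m (m + 1) / 67^m. The constant
  335 is 4 * 67 for \<open>V\<close> plus 67 for \<open>R\<close>. The lower bound is the common
  entry sin (2 pi / 67) on a matching of N / 67 triples.\<close>

lemma spread_arrays:
  assumes code: "decodable N k S M" and N: "N > 0" and m: "m \<ge> 1" "real N ^ 3 \<le> 67 ^ m"
  obtains t where
    "\<And>\<epsilon>. (\<And>i. i < k \<Longrightarrow> \<epsilon> i = 1 \<or> \<epsilon> i = - 1) \<Longrightarrow>
      P (\<lambda>a b c. \<Sum>i<k. \<epsilon> i * t i a b c) \<le> 335 * m * (m + 1)"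
    and "\<And>i. i < k \<Longrightarrow> sin (2 * pi / 67) / 67 \<le> P (t i)"
proof -
  define s where "s a b c j = S a j + S b j + S c j" for a b c j
  define t where "t i a b c =
    (if residue_support k (s a b c) = {i} then sin (2 * pi / 67 * s a b c i) else 0)" for i a b c
  obtain w \<rho> :: "nat \<Rightarrow> real" and n :: nat where \<rho>: "\<And>l. \<bar>\<rho> l\<bar> \<le> 1 / 67"
    and w: "(\<Sum>l<n. \<bar>w l\<bar>) \<le> 67 * m * (m + 1)"
    and moments: "\<And>d. d \<le> m \<Longrightarrow> (\<Sum>l<n. w l * \<rho> l ^ d) = (if d = 1 then 1 else 0)"
    by (rule first_order_weights[of m], rule that; assumption)
  have upper: "P (\<lambda>a b c. \<Sum>i<k. \<epsilon> i * t i a b c) \<le> 335 * m * (m + 1)"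
    if \<epsilon>: "\<And>i. i < k \<Longrightarrow> \<epsilon> i = 1 \<or> \<epsilon> i = - 1" for \<epsilon>
  proof -
    define z where "z i = (if \<epsilon> i = 1 then 1 else - 1 :: int)" for i
    define d where "d a b c = card (residue_support k (s a b c))" for a b c
    define V where "V a b c = (\<Sum>l<n. w l * (\<rho> l ^ d a b c * sin (phase k z (s a b c))))" for a b c
    define R where "R a b c = (\<Sum>i<k. \<epsilon> i * t i a b c) - V a b c" for a b c
    have main: "(\<Sum>i<k. \<epsilon> i * t i a b c) = (if d a b c = 1 then sin (phase k z (s a b c)) else 0)" for a b c
    proof (cases "d a b c = 1")
      case True
      then obtain i where i: "residue_support k (s a b c) = {i}"
        unfolding d_def using card_1_singletonE by blast
      then have "i < k" by (auto simp: residue_support_def)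
      have "(\<Sum>j<k. \<epsilon> j * t j a b c) = (\<Sum>j<k. if j = i then \<epsilon> i * sin (2 * pi / 67 * s a b c i) else 0)"
        by (intro sum.cong refl) (auto simp: t_def i)
      then have "(\<Sum>j<k. \<epsilon> j * t j a b c) = \<epsilon> i * sin (2 * pi / 67 * s a b c i)"
        using \<open>i < k\<close> by simp
      moreover have "cis (phase k z (s a b c)) = cis (2 * pi / 67 * (z i * s a b c i))"
      proof -
        have "cis (phase k z (s a b c)) = (\<Prod>j<k. cis (2 * pi / 67 * (z j * s a b c j)))"
          unfolding phase_def by (rule cis_sum)
        also have "\<dots> = (\<Prod>j\<in>{i}. cis (2 * pi / 67 * (z j * s a b c j)))"
        proof (rule prod.mono_neutral_right)
          show "\<forall>j\<in>{..<k} - {i}. cis (2 * pi / 67 * (z j * s a b c j)) = 1"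
          proof
            fix j assume "j \<in> {..<k} - {i}"
            then have "67 dvd s a b c j" using i by (auto simp: residue_support_def)
            then show "cis (2 * pi / 67 * (z j * s a b c j)) = 1"
              using cis_multiple_67[of "s a b c j" "z j"] by simp
          qed
        qed (use \<open>i < k\<close> in auto)
        finally show ?thesis by simp
      qed
      then have "sin (phase k z (s a b c)) = sin (2 * pi / 67 * (z i * s a b c i))"
        by (simp add: complex_eq_iff)
      \<comment> \<open>Oddness in z_i = 1 or -1; this is why the array is built from the
        sine.\<close>
      moreover have "sin (2 * pi / 67 * (z i * s a b c i)) = \<epsilon> i * sin (2 * pi / 67 * s a b c i)"
        using \<epsilon>[OF \<open>i < k\<close>] by (auto simp: z_def)
      ultimately show ?thesis using True by simp
    next
      case False
      then have "t i a b c = 0" for i by (auto simp: t_def d_def)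
      with False show ?thesis by simp
    qed
    have V_eq: "V a b c = (\<Sum>l<n. w l * \<rho> l ^ d a b c) * sin (phase k z (s a b c))" for a b c
      by (simp add: V_def sum_distrib_right mult.assoc)
    have R_le: "\<bar>R a b c\<bar> \<le> real (67 * m * (m + 1)) / 67 ^ m" for a b c
    proof (cases "d a b c \<le> m")
      case True
      then show ?thesis by (simp add: R_def main V_eq moments)
    next
      case False
      then have "R a b c = - (\<Sum>l<n. w l * \<rho> l ^ d a b c) * sin (phase k z (s a b c))"
        using m by (simp add: R_def main V_eq)
      then have "\<bar>R a b c\<bar> \<le> \<bar>\<Sum>l<n. w l * \<rho> l ^ d a b c\<bar>"
        by (simp add: abs_mult mult_left_le)
      also have "\<dots> \<le> (\<Sum>l<n. \<bar>w l\<bar> * (1 / 67) ^ m)"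
      proof (rule order.trans[OF sum_abs], rule sum_mono)
        fix l
        have "\<bar>\<rho> l\<bar> ^ d a b c \<le> \<bar>\<rho> l\<bar> ^ m"
          using False \<rho>[of l] by (intro power_decreasing) auto
        also have "\<dots> \<le> (1 / 67) ^ m" using \<rho>[of l] by (intro power_mono) auto
        finally show "\<bar>w l * \<rho> l ^ d a b c\<bar> \<le> \<bar>w l\<bar> * (1 / 67) ^ m"
          by (simp add: abs_mult power_abs mult_left_mono)
      qed
      also have "\<dots> \<le> real (67 * m * (m + 1)) * (1 / 67) ^ m"
        unfolding sum_distrib_right[symmetric] using w by (intro mult_right_mono) auto
      finally show ?thesis by (simp add: power_one_over)
    qed
    have "P V \<le> (\<Sum>l<n. P (\<lambda>a b c. w l * (\<rho> l ^ d a b c * sin (phase k z (s a b c)))))"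
      unfolding V_def by (rule P_sum) simp
    also have "\<dots> \<le> (\<Sum>l<n. \<bar>w l\<bar> * 4)"
      unfolding P_scale d_def s_def by (intro sum_mono mult_left_mono P_noise \<rho>) auto
    also have "\<dots> \<le> real (67 * m * (m + 1)) * 4"
      unfolding sum_distrib_right[symmetric] using w by (intro mult_right_mono) auto
    finally have PV: "P V \<le> real (67 * m * (m + 1)) * 4" .
    have "P R \<le> (\<Sum>a<N. \<Sum>b<N. \<Sum>c<N. real (67 * m * (m + 1)) / 67 ^ m)"
      by (rule order.trans[OF P_le_sum_abs]) (intro sum_mono R_le)
    also have "\<dots> = real N ^ 3 / 67 ^ m * real (67 * m * (m + 1))"
      by (simp add: power3_eq_cube)
    also have "\<dots> \<le> 1 * real (67 * m * (m + 1))"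
      using m(2) by (intro mult_right_mono) simp_all
    finally have PR: "P R \<le> 67 * m * (m + 1)" by simp
    have "P (\<lambda>a b c. \<Sum>i<k. \<epsilon> i * t i a b c) = P (\<lambda>a b c. V a b c + R a b c)"
      by (simp add: R_def)
    also have "\<dots> \<le> P V + P R" by (rule P_add)
    finally show ?thesis using PV PR by (simp add: algebra_simps)
  qed
  have lower: "sin (2 * pi / 67) / 67 \<le> P (t i)" if i: "i < k" for i
  proof -
    have M: "matching N (M i)" "67 * card (M i) = N"
      and M_sum: "\<And>a b c j. (a, b, c) \<in> M i \<Longrightarrow> j < k \<Longrightarrow> s a b c j mod 67 = (if i = j then 1 else 0)"
      using code i unfolding decodable_def s_def by blast+
    have "t i a b c = sin (2 * pi / 67)" if abc: "(a, b, c) \<in> M i" for a b c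
    proof -
      have "residue_support k (s a b c) = {i}"
        using i M_sum[OF abc] by (auto simp: residue_support_def dvd_eq_mod_eq_0 split: if_splits)
      then have "t i a b c = sin (2 * pi / 67 * s a b c i)" by (simp add: t_def)
      also have "s a b c i = 67 * (s a b c i div 67) + 1"
        using M_sum[OF abc i] mult_div_mod_eq[of 67 "s a b c i"] by simp
      also have "2 * pi / 67 * real (67 * (s a b c i div 67) + 1) =
          2 * pi / 67 + 2 * pi * of_int (int (s a b c i div 67))"
        by (simp add: algebra_simps)
      also have "sin \<dots> = sin (2 * pi / 67)"
        using cos_2npi[of "s a b c i div 67"] sin_2npi[of "s a b c i div 67"]
        by (simp add: sin_add mult_ac)
      finally show ?thesis .
    qed
    then have "(\<Sum>(a, b, c)\<in>M i. t i a b c) = (\<Sum>x\<in>M i. sin (2 * pi / 67))"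
      by (intro sum.cong refl) auto
    then have "card (M i) * sin (2 * pi / 67) \<le> N * P (t i)"
      using P_matching[OF M(1), of "t i"] by simp
    also have "real N = 67 * card (M i)" using M(2) by (simp flip: of_nat_mult)
    finally show ?thesis using M(2) N by (simp add: field_simps)
  qed
  show thesis using upper lower by (rule that)
qed

end

section \<open>Choice of the parameters\<close>

text \<open>Prime powers q1 and q2 within constant factors of r give sets of size l of order r^2.
  The dimension of the matching vectors is then r^(O(r)), while log k is at least of order r^2 log
  r. The factor 5 on h anticipates 67 <= e^5.\<close>

lemma subset_code_bounds:
  fixes r :: nat
  assumes r: "r \<ge> 34"
  obtains N k h :: nat and S M where "decodable N k S M" "0 < N" "N \<le> 67 ^ h" "h \<ge> 1"
    "5 * h \<le> r ^ (5 * r)" "0 < k" "real r ^ 2 * ln r / 34 \<le> ln k"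
proof -
  obtain e where e: "3 ^ e \<le> r" "r < 3 ^ (e + 1)" using ex_power_ivl1[of 3 r] r by auto
  obtain f where f: "11 ^ f \<le> r" "r < 11 ^ (f + 1)" using ex_power_ivl1[of 11 r] r by auto
  have ef: "e \<ge> 1" "f \<ge> 1" using e f r by (auto simp: Suc_le_eq intro!: Nat.gr0I)
  define q1 q2 :: nat where "q1 = 3 ^ e" and "q2 = 11 ^ f"
  define l where "l = q1 * q2 - 1"
  \<comment> \<open>A ground set of size l^2 gives k >= (l^2 / l)^l = l^l and keeps g polynomial in
    r.\<close>
  define g where "g = l ^ 2"
  define H where "H = (g choose (q1 - 1)) + (g choose (q2 - 1))"
  define k where "k = (g choose l)"
  have q: "q1 \<ge> 1" "q2 \<ge> 1" "q1 \<le> r" "q2 \<le> r" "r < 3 * q1" "r < 11 * q2"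
    using e f by (simp_all add: q1_def q2_def)
  obtain S M where code: "decodable (67 * 33 ^ H) k S M"
    using subset_code[OF ef, of g] by (auto simp: H_def k_def l_def q1_def q2_def)
  \<comment> \<open>The factors 3 and 11 are how far q1 and q2 may fall below r. Passing from 33 to
    34 absorbs the -1 in l, which is where r >= 34 enters.\<close>
  have "r * r \<le> (3 * q1) * (11 * q2)" using q by (intro mult_mono) auto
  then have l_ge: "r * r \<le> 33 * (l + 1)" using q by (simp add: l_def)
  have "34 * r \<le> r * r" using r by (intro mult_right_mono) auto
  have "34 * 34 \<le> r * r" using r by (intro mult_mono) auto
  moreover have "x \<le> 34 * y" if "34 * 34 \<le> x" "x \<le> 33 * (y + 1)" for x y :: nat
    using that by simp
  ultimately have l34: "r * r \<le> 34 * l" using l_ge by blast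
  then have l_r: "l \<ge> r" using \<open>34 * r \<le> r * r\<close> by linarith
  have l_pos: "l > 0" using l_r r by simp
  have "l \<le> r ^ 2" unfolding l_def power2_eq_square using mult_mono[OF q(3,4)] by linarith
  then have g_le: "g \<le> r ^ 4" using power_mono[of l "r ^ 2" 2] by (simp add: g_def flip: power_mult)
  have choose_le: "(g choose (x - 1)) \<le> r ^ (4 * r)" if "x \<le> r" for x
  proof (cases "x - 1 \<le> g")
    case True
    then have "(g choose (x - 1)) \<le> g ^ (x - 1)" by (rule binomial_le_pow)
    also have "\<dots> \<le> (r ^ 4) ^ (x - 1)" using g_le by (intro power_mono) auto
    also have "\<dots> \<le> (r ^ 4) ^ r" using r that by (intro power_increasing) auto
    finally show ?thesis by (simp add: power_mult)
  next
    case False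
    then show ?thesis by (simp add: binomial_eq_0)
  qed
  have r4: "1 \<le> r ^ (4 * r)" using r by simp
  have "r ^ 1 \<le> r ^ r" using r by (intro power_increasing) auto
  then have "15 \<le> r ^ r" using r unfolding power_one_right by linarith
  then have "15 * r ^ (4 * r) \<le> r ^ r * r ^ (4 * r)"
    by (intro mult_right_mono) auto
  also have "\<dots> = r ^ (5 * r)" by (simp flip: power_add)
  finally have r5: "15 * r ^ (4 * r) \<le> r ^ (5 * r)" .
  have h_le: "5 * (H + 1) \<le> r ^ (5 * r)"
  proof -
    have "5 * (x + y + 1) \<le> z" if "15 * w \<le> z" "x \<le> w" "y \<le> w" "1 \<le> w" for w x y z :: nat
      using that by presburger
    from this[OF r5 choose_le[OF q(3)] choose_le[OF q(4)] r4] show ?thesis by (simp only: H_def)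
  qed
  have k_ge: "real l ^ l \<le> k"
    using binomial_ge_n_over_k_pow_k[of l g, where 'a = real] l_pos
    by (simp add: k_def g_def power2_eq_square)
  have k_pos: "0 < k" using l_pos by (simp add: k_def g_def power2_eq_square)
  have "real (r * r) \<le> real (34 * l)" using l34 by (simp only: of_nat_le_iff)
  then have rr: "real (r * r) / 34 \<le> real l" by simp
  have "real r ^ 2 * ln r / 34 = real (r * r) / 34 * ln r" by (simp add: power2_eq_square)
  also have "\<dots> \<le> real l * ln l"
    using l_r r by (intro mult_mono rr) auto
  also have "\<dots> = ln (real l ^ l)" using l_pos by (simp add: ln_realpow)
  also have "\<dots> \<le> ln k" using k_ge l_pos k_pos by simp
  finally have ln_k: "real r ^ 2 * ln r / 34 \<le> ln k" .
  have "67 * 33 ^ H \<le> (67::nat) ^ (H + 1)" by (simp add: power_mono)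
  then show thesis using that[OF code _ _ _ h_le k_pos ln_k] by simp
qed

text \<open>log log N is at most of order r log r while log k is at least of order r^2 log r.
  Solving the first for r at the scale L = ln (ln n) gives r of order L / ln L and log k of order
  L^2 / ln L.\<close>

lemma code_parameters:
  obtains L0 :: real where "L0 \<ge> 1"
    and "\<And>n. ln (ln (real n)) \<ge> L0 \<Longrightarrow> \<exists>N k S M m. decodable N k S M \<and> 0 < N \<and> N \<le> n \<and>
      1 \<le> m \<and> real N ^ 3 \<le> 67 ^ m \<and> real m + 1 \<le> ln n \<and> 0 < k \<and>
      (ln (ln n))\<^sup>2 / (6800 * ln (ln (ln n))) \<le> ln k"
proof -
  have "eventually (\<lambda>L::real. L \<ge> 3 \<and> L / (5 * ln L) \<ge> 34 \<and> L / (10 * ln L) \<ge> sqrt L) at_top"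
    by (intro eventually_conj; real_asymp)
  then obtain L0 :: real where L0: "\<And>L. L \<ge> L0 \<Longrightarrow> L \<ge> 3 \<and> L / (5 * ln L) \<ge> 34 \<and>
      L / (10 * ln L) \<ge> sqrt L"
    unfolding eventually_at_top_linorder by blast
  have "\<exists>N k S M m. decodable N k S M \<and> 0 < N \<and> N \<le> n \<and> 1 \<le> m \<and> real N ^ 3 \<le> 67 ^ m \<and>
      real m + 1 \<le> ln n \<and> 0 < k \<and> (ln (ln n))\<^sup>2 / (6800 * ln (ln (ln n))) \<le> ln k"
    if n: "ln (ln (real n)) \<ge> max 1 L0" for n :: nat
  proof -
    define L where "L = ln (ln (real n))"
    have L: "L \<ge> 3" "L / (5 * ln L) \<ge> 34" "L / (10 * ln L) \<ge> sqrt L"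
      using L0[of L] n by (auto simp: L_def)
    have lnL: "ln L > 0" using L(1) by simp
    have n_pos: "n > 0" using L(1) by (auto simp: L_def intro!: Nat.gr0I)
    have ln_n: "ln n > 0"
    proof (rule ccontr)
      assume "\<not> ln n > 0"
      then have "ln (real n) = 0" using n_pos by (simp add: not_less)
      then show False using L(1) by (simp add: L_def)
    qed
    then have ln_n_eq: "ln n = exp L" by (simp add: L_def)
    \<comment> \<open>Chosen so that r^(5 r) = exp (5 r ln r) is at most exp L = ln n.\<close>
    define r where "r = nat \<lfloor>L / (5 * ln L)\<rfloor>"
    have r: "real r \<le> L / (5 * ln L)" "L / (5 * ln L) < real r + 1" "r \<ge> 34"
      using L(2) by (auto simp: r_def le_nat_iff le_floor_iff)
    have "real r + 1 \<le> 2 * real r" using r(3) by simp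
    then have r_ge: "L / (10 * ln L) \<le> r" using r(2) by (simp add: field_simps)
    have "real r \<le> L"
    proof -
      have "ln 3 \<le> ln L" using L(1) by simp
      moreover have "(1::real) \<le> ln 3" using exp_le by (subst ln_ge_iff) auto
      ultimately have "1 \<le> 5 * ln L" by linarith
      then have "L / (5 * ln L) \<le> L / 1" using L(1) by (intro divide_left_mono) auto
      then show ?thesis using r(1) by simp
    qed
    then have ln_r: "ln r \<le> ln L" using r(3) by simp
    have "5 * real r * ln r \<le> 5 * (L / (5 * ln L)) * ln L"
      using r ln_r L lnL by (intro mult_mono) auto
    then have "5 * real r * ln r \<le> L" using lnL by simp
    then have "exp (5 * real r * ln r) \<le> ln n" by (simp add: ln_n_eq)
    moreover have "real (r ^ (5 * r)) = exp (5 * real r * ln r)"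
      using r(3) by (simp add: powr_def flip: powr_realpow)
    ultimately have r_pow: "real (r ^ (5 * r)) \<le> ln n" by simp
    obtain N k h :: nat and S M where code: "decodable N k S M" "0 < N" "N \<le> 67 ^ h" "h \<ge> 1"
      "5 * h \<le> r ^ (5 * r)" "0 < k" "real r ^ 2 * ln r / 34 \<le> ln k"
      using subset_code_bounds[OF r(3)] .
    have h: "5 * real h \<le> ln n" using code(5) r_pow by linarith
    have "real N \<le> 67 ^ h" using code(3) by (metis of_nat_le_iff of_nat_numeral of_nat_power)
    \<comment> \<open>Through 67 <= (1 + 1/4)^20 <= e^5.\<close>
    also have "\<dots> \<le> exp 5 ^ h"
    proof (rule power_mono)
      have "(1 + 5 / real 20) ^ 20 \<le> exp (5::real)"
        using exp_ge_one_plus_x_over_n_power_n[of 20 5] by simp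
      moreover have "(67::real) \<le> (1 + 5 / real 20) ^ 20" by (simp add: power_divide)
      ultimately show "(67::real) \<le> exp 5" by linarith
    qed simp
    also have "\<dots> = exp (5 * h)" by (simp add: exp_of_nat_mult[symmetric] mult.commute)
    also have "\<dots> \<le> exp (ln n)" using h by simp
    finally have N_le: "N \<le> n" using n_pos by simp
    have N3: "real N ^ 3 \<le> 67 ^ (3 * h)"
      using power_mono[OF \<open>real N \<le> 67 ^ h\<close>, of 3] by (simp add: power_mult mult.commute flip: power_mult)
    have m1: "real (3 * h) + 1 \<le> ln n" using h code(4) by simp
    \<comment> \<open>The condition on sqrt L in the choice of \<open>L0\<close> exists for this: it
      turns ln r into ln L at the price of a factor 2.\<close>
    have "ln (sqrt L) \<le> ln r" using L r_ge r(3) by (intro ln_mono) auto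
    then have ln_r_ge: "ln L / 2 \<le> ln r" using L(1) by (simp add: ln_sqrt)
    \<comment> \<open>Here 6800 = 10^2 * 2 * 34.\<close>
    have "L\<^sup>2 / (6800 * ln L) = (L / (10 * ln L)) ^ 2 * (ln L / 2) / 34"
      using lnL by (simp add: field_simps power2_eq_square)
    also have "\<dots> \<le> real r ^ 2 * ln r / 34"
      using r_ge ln_r_ge L lnL by (intro divide_right_mono mult_mono power_mono) auto
    finally have "L\<^sup>2 / (6800 * ln L) \<le> ln k" using code(7) by simp
    with code N_le N3 m1 show ?thesis unfolding L_def[symmetric]
      by (intro exI[of _ N] exI[of _ k] exI[of _ S] exI[of _ M] exI[of _ "3 * h"]) auto
  qed
  then show thesis using that[of "max 1 L0"] by simp
qed

section \<open>Lower bounds for the cotype constant\<close>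

lemma cotype_ge_one:
  assumes "tensor_triple X Y Z p1 p2 p3 1" "cotype_ineq q (X \<otimes>\<^sub>\<pi> Y \<otimes>\<^sub>\<pi> Z) C" "q > 0" "C > 0"
  shows "1 \<le> C"
proof -
  interpret tensor_triple X Y Z p1 p2 p3 1 by (rule assms(1))
  interpret P: tensor_seminorm 1 array_norm by (rule tensor_seminorm)
  \<comment> \<open>A single vector of nonzero norm makes the two sides of the cotype inequality
    agree up to C; the matching with one triple certifies that this one is nonzero.\<close>
  define u where "u = (\<lambda>(_ :: nat) (_ :: nat) (_ :: nat). 1 :: real)"
  have u: "1 \<le> array_norm u"
    using P.P_matching[of "{(0, 0, 0)}" u] by (simp add: u_def matching_def)
  have "real 1 powr (1 / q) * array_norm u \<le> C * array_norm u"
  proof (rule cotype_ineq_array[OF assms(2-4), of 1 "\<lambda>_. u"])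
    fix \<epsilon> :: "nat \<Rightarrow> real" assume "\<And>i. i < 1 \<Longrightarrow> \<epsilon> i = 1 \<or> \<epsilon> i = - 1"
    then have "\<epsilon> 0 = 1 \<or> \<epsilon> 0 = - 1" by simp
    then show "array_norm (\<lambda>a b c. \<Sum>i<1. \<epsilon> i * u a b c) \<le> array_norm u"
      using P.P_scale[of "\<epsilon> 0" u] by auto
  qed (use u in auto)
  then show ?thesis using u by simp
qed

lemma cotype_ge_exp:
  "\<exists>L0::real. \<forall>X Y Z p1 p2 p3 q C n. (\<forall>N. 0 < N \<and> N \<le> n \<longrightarrow> tensor_triple X Y Z p1 p2 p3 N) \<longrightarrow>
     cotype_ineq q (X \<otimes>\<^sub>\<pi> Y \<otimes>\<^sub>\<pi> Z) C \<longrightarrow> q > 0 \<longrightarrow> C > 0 \<longrightarrow> ln (ln (real n)) \<ge> L0 \<longrightarrow>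
     exp ((ln (ln n))\<^sup>2 / ln (ln (ln n)) / (6800 * q) - 3 * ln (ln n)) \<le> C"
proof -
  obtain L0 :: real where L0: "L0 \<ge> 1"
    and param: "\<And>n. ln (ln (real n)) \<ge> L0 \<Longrightarrow> \<exists>N k S M m. decodable N k S M \<and> 0 < N \<and> N \<le> n \<and>
      1 \<le> m \<and> real N ^ 3 \<le> 67 ^ m \<and> real m + 1 \<le> ln n \<and> 0 < k \<and>
      (ln (ln n))\<^sup>2 / (6800 * ln (ln (ln n))) \<le> ln k"
    using code_parameters by blast
  \<comment> \<open>The lower constant of \<open>spread_arrays\<close> over its upper constant 335.
    The threshold - ln \<open>\<delta>\<close> lets one factor exp L outweigh it.\<close>
  define \<delta> where "\<delta> = sin (2 * pi / 67) / 67 / 335"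
  have "sin (2 * pi / 67) > 0" by (rule sin_gt_zero) auto
  then have \<delta>: "\<delta> > 0" by (simp add: \<delta>_def)
  have claim: "exp ((ln (ln n))\<^sup>2 / ln (ln (ln n)) / (6800 * q) - 3 * ln (ln n)) \<le> C"
    if tt: "\<forall>N. 0 < N \<and> N \<le> n \<longrightarrow> tensor_triple X Y Z p1 p2 p3 N"
      and cot: "cotype_ineq q (X \<otimes>\<^sub>\<pi> Y \<otimes>\<^sub>\<pi> Z) C" and q: "q > 0" and C: "C > 0"
      and n: "ln (ln (real n)) \<ge> max L0 (- ln \<delta>)" for X Y Z p1 p2 p3 q C and n :: nat
  proof -
    define L where "L = ln (ln (real n))"
    have L: "L \<ge> 1" "- ln \<delta> \<le> L" using n L0 by (auto simp: L_def)
    obtain N k S M m where code: "decodable N k S M" "0 < N" "N \<le> n" "1 \<le> m"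
      "real N ^ 3 \<le> 67 ^ m" "real m + 1 \<le> ln n" "0 < k" "L\<^sup>2 / (6800 * ln L) \<le> ln k"
      using param[of n] n unfolding L_def by auto
    interpret tensor_triple X Y Z p1 p2 p3 N using tt code(2,3) by blast
    interpret P: tensor_seminorm N array_norm by (rule tensor_seminorm)
    obtain t where t: "\<And>\<epsilon>. (\<And>i. i < k \<Longrightarrow> \<epsilon> i = 1 \<or> \<epsilon> i = - 1) \<Longrightarrow>
        array_norm (\<lambda>a b c. \<Sum>i<k. \<epsilon> i * t i a b c) \<le> 335 * m * (m + 1)"
      "\<And>i. i < k \<Longrightarrow> sin (2 * pi / 67) / 67 \<le> array_norm (t i)"
      using P.spread_arrays[OF code(1,2,4,5)] by blast
    have main: "real k powr (1 / q) * (sin (2 * pi / 67) / 67) \<le> C * (335 * m * (m + 1))"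
      by (rule cotype_ineq_array[OF cot q C t]) (use \<delta> in \<open>auto simp: \<delta>_def\<close>)
    have ln_n: "ln n = exp L" using code(4,6) by (simp add: L_def)
    have "real m * (real m + 1) \<le> ln n * ln n"
      using code(4,6) by (intro mult_mono) auto
    also have "\<dots> = exp (2 * L)" unfolding ln_n by (simp flip: exp_add)
    finally have m_le: "real m * (real m + 1) \<le> exp (2 * L)" .
    have "exp (L\<^sup>2 / ln L / (6800 * q)) = exp (L\<^sup>2 / (6800 * ln L) * (1 / q))"
      by (simp add: mult_ac)
    also have "\<dots> \<le> exp (ln k * (1 / q))"
      using code(8) q by (intro exp_le_cancel_iff[THEN iffD2] mult_right_mono) auto
    also have "\<dots> = real k powr (1 / q)" using code(7) by (simp add: powr_def mult.commute)
    finally have "exp (L\<^sup>2 / ln L / (6800 * q)) * \<delta> \<le> real k powr (1 / q) * \<delta>"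
      using \<delta> by (intro mult_right_mono) auto
    also have "\<dots> \<le> C * (real m * (real m + 1))"
      using main by (simp add: \<delta>_def field_simps)
    also have "\<dots> \<le> C * exp (2 * L)" using m_le C by (intro mult_left_mono) auto
    finally have *: "exp (L\<^sup>2 / ln L / (6800 * q)) * \<delta> \<le> C * exp (2 * L)" .
    have "exp (- L) \<le> exp (ln \<delta>)" using L(2) by simp
    then have "exp (- L) \<le> \<delta>" using \<delta> by simp
    have "exp (L\<^sup>2 / ln L / (6800 * q) - 3 * L) =
        exp (L\<^sup>2 / ln L / (6800 * q)) * exp (- L) * exp (- 2 * L)"
      by (simp flip: exp_add)
    also have "\<dots> \<le> exp (L\<^sup>2 / ln L / (6800 * q)) * \<delta> * exp (- 2 * L)"
      using \<open>exp (- L) \<le> \<delta>\<close> by (intro mult_right_mono mult_left_mono) auto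
    also have "\<dots> \<le> C * exp (2 * L) * exp (- 2 * L)" using * by (intro mult_right_mono) auto
    also have "\<dots> = C" by (simp add: mult.assoc flip: exp_add)
    finally show ?thesis by (simp add: L_def)
  qed
  show ?thesis
    by (intro exI[of _ "max L0 (- ln \<delta>)"] allI impI, rule claim) assumption+
qed

section \<open>Application to the infinite and the finite-dimensional spaces\<close>

lemma tensor_triple_lp:
  assumes "p1 > 1" "p2 > 1" "p3 > 1" "1 / p1 + 1 / p2 + 1 / p3 \<le> 1" "0 < N"
  shows "tensor_triple (lp p1) (lp p2) (lp p3) p1 p2 p3 N"
  using assms by (simp add: tensor_triple_def tensor_triple_axioms_def lp_like_lp)

lemma tensor_triple_lp_fin:
  assumes "p1 > 1" "p2 > 1" "p3 > 1" "1 / p1 + 1 / p2 + 1 / p3 \<le> 1" "0 < N" "N \<le> n"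
  shows "tensor_triple (lp_fin p1 n) (lp_fin p2 n) (lp_fin p3 n) p1 p2 p3 N"
  using assms by (simp add: tensor_triple_def tensor_triple_axioms_def lp_like_lp_fin)

text \<open>For integers n > 15 is the condition n > e^e, under which the triple logarithm is
  positive.\<close>

lemma exp_one_less_ln_16: "exp 1 < ln (16::real)"
proof -
  have "exp (exp 1) < exp (272 / 100 :: real)" using e_less_272 by simp
  also have "\<dots> < 16"
  proof (rule power_less_imp_less_base)
    \<comment> \<open>The power 25 clears the denominator: 25 * 2.72 = 68.\<close>
    have "exp (272 / 100 :: real) ^ 25 = exp 1 ^ 68" by (simp flip: exp_of_nat_mult)
    also have "\<dots> \<le> (272 / 100) ^ 68" using e_less_272 by (intro power_mono) auto
    also have "\<dots> < 16 ^ 25" by (simp add: power_divide)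
    finally show "exp (272 / 100 :: real) ^ 25 < 16 ^ 25" .
  qed simp
  finally have "ln (exp (exp 1)) < ln (16::real)" by (subst ln_less_cancel_iff) auto
  then show ?thesis by simp
qed

lemma one_less_ln_ln_16: "1 < ln (ln (16::real))"
proof -
  have "ln (exp 1) < ln (ln (16::real))"
    using exp_one_less_ln_16 by (subst ln_less_cancel_iff) (auto intro: less_trans[OF exp_gt_zero])
  then show ?thesis by simp
qed

text \<open>Every n is admissible for the infinite-dimensional spaces, and at fixed q the exponent
  is unbounded in n because L^2 / ln L outgrows L.\<close>

lemma not_finite_cotype_lp:
  assumes p: "p1 > 1" "p2 > 1" "p3 > 1" "1 / p1 + 1 / p2 + 1 / p3 \<le> 1"
  shows "\<not> has_finite_cotype (lp p1 \<otimes>\<^sub>\<pi> lp p2 \<otimes>\<^sub>\<pi> lp p3)"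
proof
  assume "has_finite_cotype (lp p1 \<otimes>\<^sub>\<pi> lp p2 \<otimes>\<^sub>\<pi> lp p3)"
  then obtain q C where q: "q \<ge> 2" "C > 0" "cotype_ineq q (lp p1 \<otimes>\<^sub>\<pi> lp p2 \<otimes>\<^sub>\<pi> lp p3) C"
    unfolding has_finite_cotype_def has_cotype_def by blast
  obtain L0 :: real where bound: "\<forall>X Y Z p1 p2 p3 q C n.
      (\<forall>N. 0 < N \<and> N \<le> n \<longrightarrow> tensor_triple X Y Z p1 p2 p3 N) \<longrightarrow>
      cotype_ineq q (X \<otimes>\<^sub>\<pi> Y \<otimes>\<^sub>\<pi> Z) C \<longrightarrow> q > 0 \<longrightarrow> C > 0 \<longrightarrow> ln (ln (real n)) \<ge> L0 \<longrightarrow>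
      exp ((ln (ln n))\<^sup>2 / ln (ln (ln n)) / (6800 * q) - 3 * ln (ln n)) \<le> C"
    using cotype_ge_exp ..
  define c where "c = 1 / (6800 * q)"
  have c: "c > 0" using q by (simp add: c_def)
  have "filterlim (\<lambda>n::nat. c * ((ln (ln n))\<^sup>2 / ln (ln (ln n))) - 3 * ln (ln n)) at_top at_top"
    using c by real_asymp
  then have "\<forall>\<^sub>F n::nat in at_top. c * ((ln (ln n))\<^sup>2 / ln (ln (ln n))) - 3 * ln (ln n) \<ge> C"
    by (simp add: filterlim_at_top)
  moreover have "\<forall>\<^sub>F n::nat in at_top. ln (ln n) \<ge> L0"
    by real_asymp
  ultimately have "\<forall>\<^sub>F n::nat in at_top. ln (ln n) \<ge> L0 \<and>
      c * ((ln (ln n))\<^sup>2 / ln (ln (ln n))) - 3 * ln (ln n) \<ge> C"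
    by eventually_elim auto
  then obtain n :: nat where n: "ln (ln n) \<ge> L0" "c * ((ln (ln n))\<^sup>2 / ln (ln (ln n))) - 3 * ln (ln n) \<ge> C"
    by (auto simp: eventually_at_top_linorder)
  have "exp ((ln (ln n))\<^sup>2 / ln (ln (ln n)) / (6800 * q) - 3 * ln (ln n)) \<le> C"
    by (rule bound[rule_format, OF tensor_triple_lp[OF p] q(3)]) (use q n in auto)
  moreover have "(ln (ln n))\<^sup>2 / ln (ln (ln n)) / (6800 * q) - 3 * ln (ln n) \<ge> C"
    using n(2) by (simp add: c_def mult_ac)
  ultimately have "exp C \<le> C" by (meson exp_le_cancel_iff order_trans)
  then show False using exp_gt_self[of C] by simp
qed

lemma cotype_const_lp_fin_ge:
  "\<exists>c c' :: real. c > 0 \<and> c' > 0 \<and>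
      (\<forall>(p1::real) (p2::real) (p3::real) (q::real) (n::nat).
         p1 > 1 \<and> p2 > 1 \<and> p3 > 1 \<and> 1 / p1 + 1 / p2 + 1 / p3 \<le> 1 \<and> q \<ge> 2 \<and> n > 15 \<longrightarrow>
         cotype_const q (lp_fin p1 n \<otimes>\<^sub>\<pi> lp_fin p2 n \<otimes>\<^sub>\<pi> lp_fin p3 n)
           \<ge> ereal (c' / ln (real n) *
                exp (c / q * ((ln (ln (real n)))\<^sup>2 / ln (ln (ln (real n)))))))"
proof -
  obtain L0 :: real where bound: "\<forall>X Y Z p1 p2 p3 q C n.
      (\<forall>N. 0 < N \<and> N \<le> n \<longrightarrow> tensor_triple X Y Z p1 p2 p3 N) \<longrightarrow>
      cotype_ineq q (X \<otimes>\<^sub>\<pi> Y \<otimes>\<^sub>\<pi> Z) C \<longrightarrow> q > 0 \<longrightarrow> C > 0 \<longrightarrow> ln (ln (real n)) \<ge> L0 \<longrightarrow>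
      exp ((ln (ln n))\<^sup>2 / ln (ln (ln n)) / (6800 * q) - 3 * ln (ln n)) \<le> C"
    using cotype_ge_exp ..
  \<comment> \<open>One third of 1 / 6800: the claim allows the loss of a single factor log n, so
    the bound that loses its cube enters a geometric mean with weight 1/3 against the trivial bound
    with weight 2/3.\<close>
  define c :: real where "c = 1 / 20400"
  \<comment> \<open>Bounds L^2 / ln L for those n > 15 whose L = ln (ln n) lies below
    \<open>L0\<close>, where only the trivial bound is at hand.\<close>
  define F0 where "F0 = (max 1 L0)\<^sup>2 / ln (ln (ln 16))"
  define c' where "c' = exp (- F0)"
  have lll16: "ln (ln (ln (16::real))) > 0" by (rule ln_gt_zero[OF one_less_ln_ln_16])
  then have F0: "F0 \<ge> 0" by (simp add: F0_def)
  have ineq: "c' / ln (real n) * exp (c / q * ((ln (ln (real n)))\<^sup>2 / ln (ln (ln (real n))))) \<le> C"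
    if p: "p1 > 1" "p2 > 1" "p3 > 1" "1 / p1 + 1 / p2 + 1 / p3 \<le> 1" and q: "q \<ge> 2" and n: "n > 15"
      and C: "C > 0" "cotype_ineq q (lp_fin p1 n \<otimes>\<^sub>\<pi> lp_fin p2 n \<otimes>\<^sub>\<pi> lp_fin p3 n) C"
    for p1 p2 p3 q C and n :: nat
  proof -
    define L where "L = ln (ln (real n))"
    define F where "F = L\<^sup>2 / ln L"
    have "ln (16::real) \<le> ln n" using n by simp
    moreover have ln16: "ln (16::real) > 1"
      using less_trans[OF _ exp_one_less_ln_16, of 1] by simp
    ultimately have ln_n: "ln n > 1" "ln (ln 16) \<le> L" by (auto simp: L_def)
    then have L1: "L > 1" using one_less_ln_ln_16 by simp
    have lnL: "ln (ln (ln 16)) \<le> ln L"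
      by (rule ln_mono[OF ln_n(2) less_trans[OF zero_less_one one_less_ln_ln_16]])
    have exp_L: "ln n = exp L" using ln_n(1) by (simp add: L_def)
    have C1: "1 \<le> C"
      by (rule cotype_ge_one[OF tensor_triple_lp_fin[OF p] C(2)]) (use q n C in auto)
    have lhs: "c' / ln (real n) * exp (c / q * ((ln (ln (real n)))\<^sup>2 / ln (ln (ln (real n))))) =
        exp (c / q * F - L - F0)"
      unfolding F_def c'_def exp_L ln_exp exp_diff exp_minus by (simp add: field_simps)
    have "exp (c / q * F - L - F0) \<le> C"
    proof (cases "L \<ge> L0")
      case True
      have "exp (F / (6800 * q) - 3 * L) \<le> C"
        unfolding L_def F_def
        by (rule bound[rule_format, OF tensor_triple_lp_fin[OF p] C(2)]) (use q C True in \<open>auto simp: L_def\<close>)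
      moreover have "c / q * F - L - F0 \<le> max 0 (F / (6800 * q) - 3 * L)"
      proof -
        have "c / q * F - L = (F / (6800 * q) - 3 * L) / 3" using q by (simp add: c_def field_simps)
        moreover have "x / 3 - F0 \<le> max 0 x" for x :: real
          using F0 by (cases "x \<ge> 0") (auto simp: max_def)
        ultimately show ?thesis by metis
      qed
      ultimately show ?thesis
      proof -
        have "exp (c / q * F - L - F0) \<le> exp (max 0 (F / (6800 * q) - 3 * L))"
          using \<open>c / q * F - L - F0 \<le> _\<close> by simp
        also have "\<dots> \<le> C" using C1 \<open>exp (F / (6800 * q) - 3 * L) \<le> C\<close> by (simp add: max_def)
        finally show ?thesis .
      qed
    next
      case False
      then have "F \<le> F0" unfolding F_def F0_def
        using L1 lnL lll16 by (intro frac_le power_mono) auto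
      moreover have "c / q * F \<le> 1 * F"
        using q L1 by (intro mult_right_mono) (auto simp: c_def F_def field_simps)
      ultimately have "exp (c / q * F - L - F0) \<le> exp 0" using L1 by simp
      then have "exp (c / q * F - L - F0) \<le> 1" unfolding exp_zero .
      then show ?thesis using C1 by (rule order_trans)
    qed
    then show ?thesis unfolding lhs .
  qed
  have "ereal (c' / ln (real n) * exp (c / q * ((ln (ln (real n)))\<^sup>2 / ln (ln (ln (real n)))))) \<le>
      cotype_const q (lp_fin p1 n \<otimes>\<^sub>\<pi> lp_fin p2 n \<otimes>\<^sub>\<pi> lp_fin p3 n)"
    if "p1 > 1 \<and> p2 > 1 \<and> p3 > 1 \<and> 1 / p1 + 1 / p2 + 1 / p3 \<le> 1 \<and> q \<ge> 2 \<and> n > 15"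
    for p1 p2 p3 q and n :: nat
    unfolding cotype_const_def
  proof (rule INF_greatest)
    fix C assume C: "C \<in> {C. C > 0 \<and> cotype_ineq q (lp_fin p1 n \<otimes>\<^sub>\<pi> lp_fin p2 n \<otimes>\<^sub>\<pi> lp_fin p3 n) C}"
    show "ereal (c' / ln (real n) * exp (c / q * ((ln (ln (real n)))\<^sup>2 / ln (ln (ln (real n)))))) \<le> ereal C"
      unfolding ereal_less_eq by (rule ineq[of p1 p2 p3 q n C]) (use that C in auto)
  qed
  moreover have "c > 0" "c' > 0" by (simp_all add: c_def c'_def)
  ultimately show ?thesis by blast
qed

theorem theorem1p1:
  "(\<forall>p1 p2 p3 :: real. p1 > 1 \<and> p2 > 1 \<and> p3 > 1 \<and> 1 / p1 + 1 / p2 + 1 / p3 \<le> 1 \<longrightarrow>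
      \<not> has_finite_cotype (lp p1 \<otimes>\<^sub>\<pi> lp p2 \<otimes>\<^sub>\<pi> lp p3)) \<and>
   (\<exists>c c' :: real. c > 0 \<and> c' > 0 \<and>
      (\<forall>(p1::real) (p2::real) (p3::real) (q::real) (n::nat).
         p1 > 1 \<and> p2 > 1 \<and> p3 > 1 \<and> 1 / p1 + 1 / p2 + 1 / p3 \<le> 1 \<and> q \<ge> 2 \<and> n > 15 \<longrightarrow>
         cotype_const q (lp_fin p1 n \<otimes>\<^sub>\<pi> lp_fin p2 n \<otimes>\<^sub>\<pi> lp_fin p3 n)
           \<ge> ereal (c' / ln (real n) *
                exp (c / q * ((ln (ln (real n)))\<^sup>2 / ln (ln (ln (real n))))))))"
  using not_finite_cotype_lp cotype_const_lp_fin_ge by blast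

end
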